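(* Let $\Omega\subset\mathbb{R}^2$ be a bounded and simply connected domain with smooth boundary. Let $p\in[2,\infty)$, let $\beta\in(0,1)$ and let $$0<\alpha<\min\left\{\frac17,\frac{\beta}{2}\right\}.$$ Then there exists a constant $C>0$ (depending only on $\Omega$, $p$, $\beta$, $\alpha$) such that the following is true. For any $v\in C^2(\overline\Omega)$, any $w\in C^2(\overline\Omega,\mathbb{R}^2)$ and any $A\in C^{0,\beta}(\overline\Omega,\mathbb{R}^{2\times2}_{\mathrm{sym}})$ there exist $\overline v\in C^{1,\alpha}(\overline\Omega)$ and $\overline w\in C^{1,\alpha}(\overline\Omega,\mathbb{R}^2)$ such that $$2\,\mathrm{sym}\nabla\overline w+\nabla\overline v\otimes\nabla\overline v=A \quad\text{on }\Omega,$$ $$\|\nabla\overline v-\nabla v\|_{C^0(\Omega)}\le C\,\|\nabla v\otimes\nabla v+2\,\mathrm{sym}\nabla w-A\|_{C^0(\Omega)}^{1/2},$$ and $$\|\nabla\overline w-\nabla w\|_{L^p(\Omega)}\le C\left(\|\nabla v\|_{C^0(\Omega)}\,\|\nabla v\otimes\nabla v+2\,\mathrm{sym}\nabla w-A\|_{C^0(\Omega)}^{1/2}+\|\nabla v\otimes\nabla v+2\,\mathrm{sym}\nabla w-A\|_{C^0(\Omega)}\right).$$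
   Context: $\mathbb{R}^{2\times2}_{\mathrm{sym}}$ is the space of symmetric real $2\times2$ matrices. For $v:\Omega\to\mathbb{R}$, $\nabla v\otimes\nabla v$ is the matrix field with entries $\partial_iv\,\partial_jv$. For $w:\Omega\to\mathbb{R}^2$, $\nabla w$ is the Jacobian matrix and $\mathrm{sym}\nabla w=\frac12(\nabla w+(\nabla w)^T)$. $\|\cdot\|_{C^0(\Omega)}$ is the supremum norm. $C^{0,\beta}(\overline\Omega)$ and $C^{1,\alpha}(\overline\Omega)$ are the usual Hölder spaces. *)

theory Defs
  imports "HOL-Analysis.Analysis"
begin

definition smooth_real :: "(real \<Rightarrow> real) \<Rightarrow> bool" where
  "smooth_real \<gamma> \<longleftrightarrow> (\<forall>k. (deriv ^^ k) \<gamma> differentiable_on UNIV)"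

(* Near every boundary point, up to an orthogonal change of coordinates, \<Omega> is the
   strict epigraph of a C-infinity function of one variable. *)
definition smooth_boundary :: "(real^2) set \<Rightarrow> bool" where
  "smooth_boundary \<Omega> \<longleftrightarrow>
     (\<forall>x0 \<in> frontier \<Omega>. \<exists>r > 0. \<exists>T :: real^2 \<Rightarrow> real^2. \<exists>\<gamma>.
        orthogonal_transformation T \<and> smooth_real \<gamma> \<and>
        \<Omega> \<inter> ball x0 r = {x \<in> ball x0 r. \<gamma> (T x $ 1) < T x $ 2})"

definition partial :: "'n \<Rightarrow> (real^'n \<Rightarrow> 'b::real_normed_vector) \<Rightarrow> real^'n \<Rightarrow> 'b" where
  "partial i f x = frechet_derivative f (at x) (axis i 1)"

definition grad :: "(real^'n \<Rightarrow> real) \<Rightarrow> real^'n \<Rightarrow> real^'n" where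
  "grad v x = (\<chi> i. partial i v x)"

(* C^k up to the boundary: f lives on the closure of the open set \<Omega>, and each partial
   derivative of order at most k, which exists in \<Omega>, is the restriction of a continuous
   function g on the closure. The values of f and g off the closure are irrelevant. *)
primrec Ck_closure ::
  "nat \<Rightarrow> (real^'n) set \<Rightarrow> (real^'n \<Rightarrow> 'b::real_normed_vector) \<Rightarrow> bool" where
  "Ck_closure 0 \<Omega> f \<longleftrightarrow> continuous_on (closure \<Omega>) f"
| "Ck_closure (Suc k) \<Omega> f \<longleftrightarrow>
     continuous_on (closure \<Omega>) f \<and> (\<forall>x\<in>\<Omega>. f differentiable (at x)) \<and>
     (\<forall>i. \<exists>g. (\<forall>x\<in>\<Omega>. g x = partial i f x) \<and> Ck_closure k \<Omega> g)"

(* The same recursion for the spaces C^(k,a); boundedness of f and of its derivatives makes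
   the Hoelder norm finite also when \<Omega> is unbounded. *)
primrec Holder_closure ::
  "nat \<Rightarrow> real \<Rightarrow> (real^'n) set \<Rightarrow> (real^'n \<Rightarrow> 'b::real_normed_vector) \<Rightarrow> bool" where
  "Holder_closure 0 a \<Omega> f \<longleftrightarrow>
     continuous_on (closure \<Omega>) f \<and> bounded (f ` closure \<Omega>) \<and>
     (\<exists>K. \<forall>x\<in>closure \<Omega>. \<forall>y\<in>closure \<Omega>. norm (f x - f y) \<le> K * norm (x - y) powr a)"
| "Holder_closure (Suc k) a \<Omega> f \<longleftrightarrow>
     continuous_on (closure \<Omega>) f \<and> bounded (f ` closure \<Omega>) \<and>
     (\<forall>x\<in>\<Omega>. f differentiable (at x)) \<and>
     (\<forall>i. \<exists>g. (\<forall>x\<in>\<Omega>. g x = partial i f x) \<and> Holder_closure k a \<Omega> g)"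

definition tensor :: "real^'n \<Rightarrow> real^'n \<Rightarrow> real^'n^'n" where
  "tensor a b = (\<chi> i j. a $ i * b $ j)"

definition sym_grad :: "(real^'n \<Rightarrow> real^'n) \<Rightarrow> real^'n \<Rightarrow> real^'n^'n" where
  "sym_grad w x = (1/2) *\<^sub>R (jacobian w (at x) + transpose (jacobian w (at x)))"

(* Pitfall: Sup is a junk value when S is empty or f is unbounded on S. *)
definition C0_norm :: "'a set \<Rightarrow> ('a \<Rightarrow> 'b::real_normed_vector) \<Rightarrow> real" where
  "C0_norm S f = (SUP x\<in>S. norm (f x))"

(* Pitfall: the integral is 0 when the integrand is not Lebesgue integrable on S. On matrices
   norm is the Frobenius norm. *)
definition Lp_norm ::
  "real \<Rightarrow> 'a::euclidean_space set \<Rightarrow> ('a \<Rightarrow> 'b::real_normed_vector) \<Rightarrow> real" where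
  "Lp_norm p S f = (LINT x:S|lebesgue. norm (f x) powr p) powr (1/p)"

definition deficit ::
  "(real^'n \<Rightarrow> real) \<Rightarrow> (real^'n \<Rightarrow> real^'n) \<Rightarrow> (real^'n \<Rightarrow> real^'n^'n) \<Rightarrow> real^'n \<Rightarrow> real^'n^'n"
where
  "deficit v w A x = tensor (grad v x) (grad v x) + 2 *\<^sub>R sym_grad w x - A x"

end

(* A corrugation a sin(mu xi.x) / mu added to v, together with an explicit correction of w, adds the
   primitive field a^2 xi (x) xi to the left hand side of the equation, up to an error of size 1/mu.
   A deficit shifted by a suitable constant positive definite matrix is a sum of three
   primitive fields, and the shift is undone by a linear w. Three corrugations with increasing
   frequencies thus turn a deficit into one that is K times smaller.

   Only the deficit and the target are smoothed, never v and w: the amplitudes then have derivatives of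
   all the orders needed, and no derivative is lost in the iteration. With deficits d_q = d_0 K^-q and
   frequencies l_q = l_0 Lam^q, the errors are small enough once Lam exceeds a constant times K^(7/2)
   (frequency jumps K^(3/2), K and K), and grad v' is alpha-Hoelder once Lam^alpha < K^(1/2): this is the
   exponent 1/7. Smoothing the beta-Hoelder target at scale 1/l_q costs l_q^-beta, which must not exceed
   d_q: this is the exponent beta/2.

   On the domain, v is first replaced by a function on the plane that is close to it in C^1, an average
   of its Taylor polynomials over a fine lattice. The remaining deficit is Hoelder continuous and
   extends to the plane. *)
theory Submission
  imports Defs
begin

section \<open>Scaled derivative bounds\<close>

text \<open>The first frequency jump carries an additional K^(1/2) because the second derivatives of
  v still reflect the preceding deficit: they have size sqrt(K d) l, whereas the new amplitude has
  size sqrt d. The error sqrt d * sqrt(K d) l / mu is of order d / K only if mu is at least of order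
  K^(3/2) l. From then on the second derivatives are sqrt d times the last frequency, and a jump by
  K is enough.

  The constant must not depend on v, w and A. Therefore K and Lam are fixed by alpha and beta alone,
  and the data enter only through l_0, which influences the Hoelder seminorms but no estimate with
  C. For the same reason the gradient of v stays a pointwise factor in the bounds on w; the L^p
  estimate then follows from a bound in the supremum norm.

  Derivatives are counted in powers of one frequency, so that products and powers stay within one
  calculus. Three derivatives of v are tracked because a stage differentiates its error once and the
  error contains second derivatives of v; of a deficit only one derivative is kept, as smoothing on
  a lattice restores the others.\<close>

lemma has_derivative_partial:
  fixes f :: "real^'n \<Rightarrow> 'b::real_normed_vector"
  assumes "f differentiable (at x)"
  shows "(f has_derivative (\<lambda>h. \<Sum>i\<in>UNIV. (h $ i) *\<^sub>R partial i f x)) (at x)"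
proof -
  let ?D = "frechet_derivative f (at x)"
  have D: "(f has_derivative ?D) (at x)"
    using assms frechet_derivative_works by blast
  then interpret bounded_linear ?D by (rule has_derivative_bounded_linear)
  have "?D h = (\<Sum>i\<in>UNIV. (h $ i) *\<^sub>R partial i f x)" for h
  proof -
    have "?D h = ?D (\<Sum>i\<in>UNIV. (h $ i) *\<^sub>R axis i 1)"
      by (simp add: basis_expansion flip: scalar_mult_eq_scaleR)
    also have "\<dots> = (\<Sum>i\<in>UNIV. (h $ i) *\<^sub>R partial i f x)"
      by (simp add: sum scaleR partial_def)
    finally show ?thesis .
  qed
  then have "?D = (\<lambda>h. \<Sum>i\<in>UNIV. (h $ i) *\<^sub>R partial i f x)" by blast
  with D show ?thesis by simp
qed

lemma partialI:
  assumes "(f has_derivative f') (at x)"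
  shows "partial i f x = f' (axis i 1)"
  using frechet_derivative_at[OF assms] by (simp add: partial_def)

lemma partial_const [simp]: "partial i (\<lambda>x. c) = (\<lambda>x. 0)"
  by (rule ext, subst partialI[OF has_derivative_const]) simp

lemma partial_coord: "partial i (\<lambda>x. x $ j) = (\<lambda>x. if i = j then 1 else 0)"
  by (rule ext, subst partialI[OF bounded_linear_imp_has_derivative[OF bounded_linear_vec_nth]])
     (auto simp: axis_def)

lemma partial_add:
  assumes "f differentiable (at x)" "g differentiable (at x)"
  shows "partial i (\<lambda>x. f x + g x) x = partial i f x + partial i g x"
  using partialI[OF has_derivative_add[OF assms[THEN frechet_derivative_works[THEN iffD1]]]]
  by (simp add: partial_def)

lemma partial_diff:
  assumes "f differentiable (at x)" "g differentiable (at x)"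
  shows "partial i (\<lambda>x. f x - g x) x = partial i f x - partial i g x"
  using partialI[OF has_derivative_diff[OF assms[THEN frechet_derivative_works[THEN iffD1]]]]
  by (simp add: partial_def)

lemma partial_mult:
  fixes f g :: "real^'n \<Rightarrow> real"
  assumes "f differentiable (at x)" "g differentiable (at x)"
  shows "partial i (\<lambda>x. f x * g x) x = f x * partial i g x + partial i f x * g x"
  using partialI[OF has_derivative_mult[OF assms[THEN frechet_derivative_works[THEN iffD1]]]]
  by (simp add: partial_def)

lemma partial_cmult:
  fixes f :: "real^'n \<Rightarrow> real"
  assumes "f differentiable (at x)"
  shows "partial i (\<lambda>x. c * f x) x = c * partial i f x"
  using partial_mult[OF differentiable_const assms, of i c] by simp

lemma partial_compose:
  fixes f :: "real^'n \<Rightarrow> real"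
  assumes "f differentiable (at x)" "(\<phi> has_real_derivative d) (at (f x))"
  shows "partial i (\<lambda>x. \<phi> (f x)) x = d * partial i f x"
proof -
  have "((\<lambda>x. \<phi> (f x)) has_derivative (\<lambda>h. d * frechet_derivative f (at x) h)) (at x)"
    using has_derivative_compose[OF assms(1)[THEN frechet_derivative_works[THEN iffD1]]
        assms(2)[unfolded has_field_derivative_def]] by simp
  from partialI[OF this] show ?thesis by (simp add: partial_def)
qed

lemma differentiable_compose_real:
  fixes f :: "real^'n \<Rightarrow> real"
  assumes "f differentiable (at x)" "(\<phi> has_real_derivative d) (at (f x))"
  shows "(\<lambda>x. \<phi> (f x)) differentiable (at x)"
  using has_derivative_compose[OF assms(1)[THEN frechet_derivative_works[THEN iffD1]]
        assms(2)[unfolded has_field_derivative_def]] 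
  by (auto simp: differentiable_def)

text \<open>Frechet differentiability is required of all iterated partial derivatives of order less
  than n, and nothing at order n: this is what the sum, product and chain rules propagate. Mixed
  derivatives are never assumed to commute.\<close>

primrec sm :: "nat \<Rightarrow> (real^'n \<Rightarrow> real) \<Rightarrow> bool" where
  "sm 0 f \<longleftrightarrow> True"
| "sm (Suc n) f \<longleftrightarrow> (\<forall>x. f differentiable (at x)) \<and> (\<forall>i. sm n (partial i f))"

(* The partial derivatives of order m at x are at most M L^m, for all m up to n. *)
primrec cb :: "nat \<Rightarrow> real \<Rightarrow> real \<Rightarrow> (real^'n \<Rightarrow> real) \<Rightarrow> real^'n \<Rightarrow> bool" where
  "cb 0 M L f x \<longleftrightarrow> \<bar>f x\<bar> \<le> M"
| "cb (Suc n) M L f x \<longleftrightarrow> \<bar>f x\<bar> \<le> M \<and> (\<forall>i. cb n (M * L) L (partial i f) x)"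

lemma sm_diff: "sm n f \<Longrightarrow> 0 < n \<Longrightarrow> f differentiable (at x)"
  by (cases n) auto

lemma sm_partial: "sm (Suc n) f \<Longrightarrow> sm n (partial i f)"
  by auto

lemma sm_lower: "sm (Suc n) f \<Longrightarrow> sm n f"
  by (induction n arbitrary: f) auto

lemma sm_le: "sm n f \<Longrightarrow> m \<le> n \<Longrightarrow> sm m f"
  by (induction n) (auto simp: le_Suc_eq intro: sm_lower simp del: sm.simps(2))

lemma cb_bound: "cb n M L f x \<Longrightarrow> \<bar>f x\<bar> \<le> M"
  by (cases n) auto

lemma cb_nonneg: "cb n M L f x \<Longrightarrow> 0 \<le> M"
  using cb_bound[of n M L f x] by linarith

lemma cb_partial: "cb (Suc n) M L f x \<Longrightarrow> cb n (M * L) L (partial i f) x"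
  by auto

lemma cb_mono: "cb n M L f x \<Longrightarrow> M \<le> M' \<Longrightarrow> 0 \<le> L \<Longrightarrow> L \<le> L' \<Longrightarrow> cb n M' L' f x"
proof (induction n arbitrary: f M M')
  case (Suc n)
  have "0 \<le> M" using Suc.prems(1) by (rule cb_nonneg)
  then have "M * L \<le> M' * L'" using Suc.prems by (intro mult_mono) auto
  then show ?case using Suc.prems Suc.IH[of "M * L"] by auto
qed auto

lemma cb_lower: "cb (Suc n) M L f x \<Longrightarrow> cb n M L f x"
  by (induction n arbitrary: f M) auto

lemma cb_le: "cb n M L f x \<Longrightarrow> m \<le> n \<Longrightarrow> cb m M L f x"
  by (induction n) (auto simp: le_Suc_eq intro: cb_lower simp del: cb.simps(2))

lemma sm_const: "sm n (\<lambda>x. c)"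
  by (induction n arbitrary: c) auto

lemma cb_zero: "0 \<le> M \<Longrightarrow> 0 \<le> L \<Longrightarrow> cb n M L (\<lambda>x. 0) x"
  by (induction n arbitrary: M) auto

lemma cb_const: "\<bar>c\<bar> \<le> M \<Longrightarrow> 0 \<le> L \<Longrightarrow> cb n M L (\<lambda>x. c) x"
  by (cases n) (auto intro!: cb_zero mult_nonneg_nonneg)

lemma sm_coord: "sm n (\<lambda>x. x $ j)"
  by (cases n) (auto simp: partial_coord sm_const bounded_linear_imp_differentiable bounded_linear_vec_nth)

lemma sm_add: "sm n f \<Longrightarrow> sm n g \<Longrightarrow> sm n (\<lambda>x. f x + g x)"
proof (induction n arbitrary: f g)
  case (Suc n)
  then have "partial i (\<lambda>x. f x + g x) = (\<lambda>x. partial i f x + partial i g x)" for i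
    by (intro ext partial_add) auto
  with Suc show ?case by auto
qed auto

lemma cb_add:
  "sm n f \<Longrightarrow> sm n g \<Longrightarrow> cb n M L f x \<Longrightarrow> cb n N L g x \<Longrightarrow> cb n (M + N) L (\<lambda>x. f x + g x) x"
proof (induction n arbitrary: f g M N)
  case (Suc n)
  then have "partial i (\<lambda>x. f x + g x) = (\<lambda>x. partial i f x + partial i g x)" for i
    by (intro ext partial_add) auto
  with Suc show ?case by (auto simp: distrib_right intro: order_trans[OF abs_triangle_ineq])
qed (auto intro: order_trans[OF abs_triangle_ineq])

lemma sm_mult: "sm n f \<Longrightarrow> sm n g \<Longrightarrow> sm n (\<lambda>x. f x * g x)"
proof (induction n arbitrary: f g)
  case (Suc n)
  then have "partial i (\<lambda>x. f x * g x) = (\<lambda>x. f x * partial i g x + partial i f x * g x)" for i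
    by (intro ext partial_mult) auto
  with Suc show ?case using sm_lower[OF Suc.prems(1)] sm_lower[OF Suc.prems(2)]
    by (auto intro!: sm_add)
qed auto

text \<open>Leibniz: every differentiation doubles the number of terms, and as both factors share
  the frequency L, the two new terms have equal bounds. This gives the factor 2 ^ n.\<close>

lemma cb_mult:
  "sm n f \<Longrightarrow> sm n g \<Longrightarrow> cb n M L f x \<Longrightarrow> cb n N L g x \<Longrightarrow>
   cb n (2 ^ n * (M * N)) L (\<lambda>x. f x * g x) x"
proof (induction n arbitrary: f g M N)
  case 0
  then show ?case by (auto simp: abs_mult intro!: mult_mono elim: order_trans[OF abs_ge_zero])
next
  case (Suc n)
  have p: "partial i (\<lambda>x. f x * g x) = (\<lambda>x. f x * partial i g x + partial i f x * g x)" for i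
    using Suc.prems by (intro ext partial_mult) auto
  have MN: "0 \<le> M" "0 \<le> N" using Suc.prems cb_nonneg by blast+
  have 1: "\<bar>f x * g x\<bar> \<le> M * N"
    using Suc.prems MN by (auto simp: abs_mult intro!: mult_mono)
  have "1 * (M * N) \<le> 2 ^ Suc n * (M * N)"
    using MN by (intro mult_right_mono) (auto simp: one_le_power simp del: power_Suc)
  with 1 have 2: "\<bar>f x * g x\<bar> \<le> 2 ^ Suc n * (M * N)" by simp
  have "cb n (2 ^ n * (M * (N * L)) + 2 ^ n * ((M * L) * N)) L
         (\<lambda>x. f x * partial i g x + partial i f x * g x) x" for i
    using Suc.prems sm_lower[OF Suc.prems(1)] sm_lower[OF Suc.prems(2)]
      cb_lower[OF Suc.prems(3)] cb_lower[OF Suc.prems(4)]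
    by (intro cb_add sm_mult Suc.IH) auto
  then show ?case using 2 by (simp add: p algebra_simps)
qed

lemma sm_cmult: "sm n f \<Longrightarrow> sm n (\<lambda>x. c * f x)"
  by (rule sm_mult[OF sm_const])

lemma cb_cmult: "sm n f \<Longrightarrow> cb n M L f x \<Longrightarrow> cb n (\<bar>c\<bar> * M) L (\<lambda>x. c * f x) x"
proof (induction n arbitrary: f M)
  case (Suc n)
  then have "partial i (\<lambda>x. c * f x) = (\<lambda>x. c * partial i f x)" for i
    by (intro ext partial_cmult) auto
  with Suc show ?case by (auto simp: abs_mult mult.assoc intro!: mult_left_mono)
qed (auto simp: abs_mult intro!: mult_left_mono)

lemma sm_minus: "sm n f \<Longrightarrow> sm n (\<lambda>x. - f x)"
  using sm_cmult[of n f "-1"] by simp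

lemma cb_minus: "sm n f \<Longrightarrow> cb n M L f x \<Longrightarrow> cb n M L (\<lambda>x. - f x) x"
  using cb_cmult[of n f M L x "-1"] by simp

lemma sm_sub: "sm n f \<Longrightarrow> sm n g \<Longrightarrow> sm n (\<lambda>x. f x - g x)"
  using sm_add[OF _ sm_minus, of n f g] by simp

lemma cb_sub:
  "sm n f \<Longrightarrow> sm n g \<Longrightarrow> cb n M L f x \<Longrightarrow> cb n N L g x \<Longrightarrow> cb n (M + N) L (\<lambda>x. f x - g x) x"
  using cb_add[OF _ sm_minus _ cb_minus, of n f g M L x N] by simp

lemma cb_SucI: "\<bar>f x\<bar> \<le> M \<Longrightarrow> (\<And>i. cb n (M * L) L (partial i f) x) \<Longrightarrow> cb (Suc n) M L f x"
  by auto

section \<open>Trigonometric functions and real powers\<close>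

lemma differentiable_phase:
  fixes \<xi> :: "real^'n"
  shows "(\<lambda>x. \<mu> * (\<xi> \<bullet> x)) differentiable (at x)"
  by (intro bounded_linear_imp_differentiable bounded_linear_intros bounded_linear_inner_right)

lemma partial_phase:
  fixes \<xi> :: "real^'n"
  shows "partial i (\<lambda>x. \<mu> * (\<xi> \<bullet> x)) x = \<mu> * \<xi> $ i"
  by (subst partialI[OF bounded_linear_imp_has_derivative])
     (auto intro!: bounded_linear_intros simp: inner_axis)

lemma partial_sin:
  fixes \<xi> :: "real^'n"
  shows "partial i (\<lambda>x. sin (\<mu> * (\<xi> \<bullet> x))) = (\<lambda>x. (\<mu> * \<xi> $ i) * cos (\<mu> * (\<xi> \<bullet> x)))"
  by (rule ext, subst partial_compose[OF differentiable_phase DERIV_sin]) (simp add: partial_phase)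

lemma partial_cos:
  fixes \<xi> :: "real^'n"
  shows "partial i (\<lambda>x. cos (\<mu> * (\<xi> \<bullet> x))) = (\<lambda>x. - ((\<mu> * \<xi> $ i) * sin (\<mu> * (\<xi> \<bullet> x))))"
  by (rule ext, subst partial_compose[OF differentiable_phase DERIV_cos]) (simp add: partial_phase)

lemma sm_trig:
  fixes \<xi> :: "real^'n"
  shows "sm n (\<lambda>x. sin (\<mu> * (\<xi> \<bullet> x)))" "sm n (\<lambda>x. cos (\<mu> * (\<xi> \<bullet> x)))"
  by (induction n)
     (auto simp: partial_sin partial_cos
       intro!: sm_minus sm_cmult differentiable_compose_real[OF differentiable_phase DERIV_sin]
         differentiable_compose_real[OF differentiable_phase DERIV_cos] simp del: mult.assoc)

lemma cb_trig:
  fixes \<xi> :: "real^'n"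
  assumes "\<And>i. \<bar>\<xi> $ i\<bar> \<le> 1" "0 \<le> \<mu>"
  shows "cb n 1 \<mu> (\<lambda>x. sin (\<mu> * (\<xi> \<bullet> x))) x \<and> cb n 1 \<mu> (\<lambda>x. cos (\<mu> * (\<xi> \<bullet> x))) x"
proof (induction n)
  case (Suc n)
  have *: "\<bar>\<mu> * \<xi> $ i\<bar> * 1 \<le> 1 * \<mu>" for i
    using mult_left_mono[OF assms(1), of \<mu> i] assms(2) by (simp add: abs_mult)
  have "cb n (1 * \<mu>) \<mu> (\<lambda>x. (\<mu> * \<xi> $ i) * sin (\<mu> * (\<xi> \<bullet> x))) x" for i
    by (rule cb_mono[OF cb_cmult[OF sm_trig(1), where L = \<mu>] *]) (use Suc assms in auto)
  then have "cb n (1 * \<mu>) \<mu> (\<lambda>x. - ((\<mu> * \<xi> $ i) * sin (\<mu> * (\<xi> \<bullet> x)))) x" for i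
    by (rule cb_minus[OF sm_cmult[OF sm_trig(1)]])
  moreover have "cb n (1 * \<mu>) \<mu> (\<lambda>x. (\<mu> * \<xi> $ i) * cos (\<mu> * (\<xi> \<bullet> x))) x" for i
    by (rule cb_mono[OF cb_cmult[OF sm_trig(2), where L = \<mu>] *]) (use Suc assms in auto)
  ultimately show ?case
    unfolding cb.simps partial_sin partial_cos by simp
qed auto

lemma DERIV_powr_pos: "0 < t \<Longrightarrow> ((\<lambda>t. t powr s) has_real_derivative s * t powr (s - 1)) (at t)"
  by (rule has_real_derivative_powr)

lemma partial_powr:
  fixes g :: "real^'n \<Rightarrow> real"
  assumes "g differentiable (at x)" "0 < g x"
  shows "partial i (\<lambda>x. g x powr s) x = s * (g x powr (s - 1) * partial i g x)"
  by (subst partial_compose[OF assms(1) DERIV_powr_pos[OF assms(2)]]) simp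

lemma sm_powr:
  fixes g :: "real^'n \<Rightarrow> real"
  assumes "\<And>x. 0 < g x"
  shows "sm n g \<Longrightarrow> sm n (\<lambda>x. g x powr s)"
proof (induction n arbitrary: s)
  case (Suc n)
  have "partial i (\<lambda>x. g x powr s) = (\<lambda>x. s * (g x powr (s - 1) * partial i g x))" for i
    using Suc.prems assms by (intro ext partial_powr) auto
  then show ?case using Suc.prems Suc.IH sm_lower[OF Suc.prems] assms
    by (auto intro!: sm_cmult sm_mult differentiable_compose_real[OF _ DERIV_powr_pos])
qed auto

text \<open>Scaling: where g is comparable to d and has frequency L, its powers behave like d powr s
  with the same frequency. The constant has to be independent of d and L, because the estimate is
  used at every stage. Differentiation lowers the exponent by one, so the induction runs over all
  exponents at once.\<close>

lemma cb_powr: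
  fixes s c :: real
  assumes c: "1 \<le> c"
  shows "\<exists>C>0. \<forall>d>0. \<forall>L\<ge>0. \<forall>(g :: real^'n \<Rightarrow> real) x. (\<forall>y. 0 < g y) \<longrightarrow> sm n g \<longrightarrow>
     d \<le> g x \<longrightarrow> cb n (c * d) L g x \<longrightarrow> cb n (C * d powr s) L (\<lambda>x. g x powr s) x"
proof (induction n arbitrary: s)
  case 0
  have "\<bar>g powr s\<bar> \<le> (c powr \<bar>s\<bar>) * d powr s" if "0 < d" "d \<le> g" "\<bar>g\<bar> \<le> c * d" for g d :: real
  proof -
    \<comment> \<open>The quotient lies between 1 and c, so its powers are bounded in terms of c and
      s alone, whatever the sign of s.\<close>
    define t where "t = g / d"
    have t: "1 \<le> t" "t \<le> c" "g = t * d" using that by (auto simp: t_def field_simps)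
    have "t powr s \<le> t powr \<bar>s\<bar>" using t by (intro powr_mono) auto
    also have "\<dots> \<le> c powr \<bar>s\<bar>" using t by (intro powr_mono2) auto
    finally show ?thesis using t that by (simp add: powr_mult mult_right_mono)
  qed
  then show ?case using c by (intro exI[of _ "c powr \<bar>s\<bar>"]) auto
next
  case (Suc n)
  from Suc.IH[of s] Suc.IH[of "s - 1"] obtain C0 C1 where
    C0: "C0 > 0" "\<And>d L g x. d>0 \<Longrightarrow> L\<ge>0 \<Longrightarrow> (\<forall>y. 0 < g y) \<Longrightarrow> sm n (g :: real^'n \<Rightarrow> real) \<Longrightarrow>
     d \<le> g x \<Longrightarrow> cb n (c * d) L g x \<Longrightarrow> cb n (C0 * d powr s) L (\<lambda>x. g x powr s) x" and
    C1: "C1 > 0" "\<And>d L g x. d>0 \<Longrightarrow> L\<ge>0 \<Longrightarrow> (\<forall>y. 0 < g y) \<Longrightarrow> sm n (g :: real^'n \<Rightarrow> real) \<Longrightarrow>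
     d \<le> g x \<Longrightarrow> cb n (c * d) L g x \<Longrightarrow> cb n (C1 * d powr (s-1)) L (\<lambda>x. g x powr (s-1)) x"
    by metis
  define C where "C = max C0 (\<bar>s\<bar> * (2 ^ n * (C1 * c)))"
  show ?case
  proof (intro exI[of _ C] conjI allI impI)
    show "C > 0" using C0 by (simp add: C_def)
    fix d L :: real and g :: "real^'n \<Rightarrow> real" and x
    assume d: "d > 0" and L: "0 \<le> L" and g: "\<forall>y. 0 < g y" "sm (Suc n) g" "d \<le> g x"
      and b: "cb (Suc n) (c * d) L g x"
    have p: "partial i (\<lambda>x. g x powr s) = (\<lambda>x. s * (g x powr (s - 1) * partial i g x))" for i
      using g by (intro ext partial_powr) auto
    have "\<bar>g x powr s\<bar> \<le> C0 * d powr s"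
      using C0(2)[OF d L g(1) sm_lower[OF g(2)] g(3) cb_lower[OF b]] by (rule cb_bound)
    also have "\<dots> \<le> C * d powr s" by (intro mult_right_mono) (auto simp: C_def)
    finally have 1: "\<bar>g x powr s\<bar> \<le> C * d powr s" .
    have 2: "cb n (\<bar>s\<bar> * (2 ^ n * ((C1 * d powr (s-1)) * (c * d * L)))) L
          (\<lambda>x. s * (g x powr (s - 1) * partial i g x)) x" for i
      using C1(2)[OF d L g(1) sm_lower[OF g(2)] g(3) cb_lower[OF b]] g sm_lower[OF g(2)] b
      by (intro cb_cmult cb_mult sm_mult sm_powr) auto
    have "d powr (s - 1) * d = d powr s"
      using d powr_add[of d "s-1" 1] by simp
    then have "\<bar>s\<bar> * (2 ^ n * ((C1 * d powr (s-1)) * (c * d * L))) 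
        = (\<bar>s\<bar> * (2 ^ n * (C1 * c))) * (d powr s * L)"
      by (metis (no_types, opaque_lifting) mult.assoc mult.commute)
    also have "\<dots> \<le> C * (d powr s * L)" using L by (intro mult_right_mono) (auto simp: C_def)
    finally have "\<bar>s\<bar> * (2 ^ n * ((C1 * d powr (s-1)) * (c * d * L))) \<le> C * d powr s * L"
      by (simp add: mult.assoc)
    from cb_mono[OF 2 this L order_refl] 1
    show "cb (Suc n) (C * d powr s) L (\<lambda>x. g x powr s) x"
      by (intro cb_SucI) (auto simp: p)
  qed
qed

lemma cb_partial_numeral:
  "cb 3 M L f x \<Longrightarrow> cb 2 (M * L) L (partial i f) x"
  "cb 2 M L f x \<Longrightarrow> cb 1 (M * L) L (partial i f) x"
  unfolding numeral_3_eq_3 numeral_2_eq_2 One_nat_def by (rule cb_partial, assumption)+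

lemma sm_partial_numeral:
  "sm 3 f \<Longrightarrow> sm 2 (partial i f)"
  "sm 2 f \<Longrightarrow> sm 1 (partial i f)"
  unfolding numeral_3_eq_3 numeral_2_eq_2 One_nat_def by (rule sm_partial, assumption)+

lemma cb_numeralI:
  "\<bar>f x\<bar> \<le> M \<Longrightarrow> (\<And>i. cb 2 (M * L) L (partial i f) x) \<Longrightarrow> cb 3 M L f x"
  "\<bar>f x\<bar> \<le> M \<Longrightarrow> (\<And>i. cb 1 (M * L) L (partial i f) x) \<Longrightarrow> cb 2 M L f x"
  "\<bar>f x\<bar> \<le> M \<Longrightarrow> (\<And>i. \<bar>partial i f x\<bar> \<le> M * L) \<Longrightarrow> cb 1 M L f x"
  unfolding numeral_3_eq_3 numeral_2_eq_2 One_nat_def by auto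

section \<open>Quasi-interpolation on a lattice\<close>

definition lattice_vec :: "int \<times> int \<Rightarrow> real^2" where
  "lattice_vec z = vector [of_int (fst z), of_int (snd z)]"

definition near :: "real \<Rightarrow> real^2 \<Rightarrow> (int \<times> int) set" where
  "near e x = {z. \<forall>i. \<bar>((1/e) *\<^sub>R x - lattice_vec z) $ i\<bar> \<le> 2}"

definition supp2 :: "(real^2 \<Rightarrow> real) \<Rightarrow> bool" where
  "supp2 b \<longleftrightarrow> (\<forall>y. b y \<noteq> 0 \<longrightarrow> (\<forall>i. \<bar>y $ i\<bar> \<le> 2))"

text \<open>For b with \<open>supp2\<close> this is the sum over the whole lattice, all other terms
  being zero. Summing over \<open>near\<close> keeps it finite for arbitrary coefficients, at the
  price of an index set that moves with x.\<close>

definition gsum :: "real \<Rightarrow> (real^2 \<Rightarrow> real) \<Rightarrow> (int \<times> int \<Rightarrow> real) \<Rightarrow> real^2 \<Rightarrow> real" where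
  "gsum e b c x = (\<Sum>z\<in>near e x. c z * b ((1/e) *\<^sub>R x - lattice_vec z))"

lemma lattice_vec_nth [simp]: "lattice_vec z $ 1 = of_int (fst z)" "lattice_vec z $ 2 = of_int (snd z)"
  by (auto simp: lattice_vec_def)

lemma lattice_box:
  fixes a b r :: real
  shows "finite {z :: int \<times> int. \<bar>a - of_int (fst z)\<bar> \<le> r \<and> \<bar>b - of_int (snd z)\<bar> \<le> r}" (is "finite ?A")
    and "r = 2 \<Longrightarrow> card {z :: int \<times> int. \<bar>a - of_int (fst z)\<bar> \<le> r \<and> \<bar>b - of_int (snd z)\<bar> \<le> r} \<le> 25"
proof -
  let ?B = "{\<lceil>a - r\<rceil>..\<lfloor>a + r\<rfloor>} \<times> {\<lceil>b - r\<rceil>..\<lfloor>b + r\<rfloor>}"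
  have sub: "?A \<subseteq> ?B" by (auto simp: ceiling_le_iff le_floor_iff abs_le_iff)
  then show "finite ?A" by (rule finite_subset) auto
  have five: "card {\<lceil>t - 2\<rceil>..\<lfloor>t + 2\<rfloor>} \<le> 5" for t :: real
  proof -
    have "\<lfloor>t + 2\<rfloor> - \<lceil>t - 2\<rceil> \<le> 4" by linarith
    then show ?thesis unfolding card_atLeastAtMost_int by linarith
  qed
  show "card ?A \<le> 25" if "r = 2"
  proof -
    have "card ?A \<le> card ?B" by (rule card_mono[OF _ sub]) auto
    also have "\<dots> \<le> 5 * 5" using five[of a] five[of b] that
      by (simp only: card_cartesian_product mult_le_mono)
    finally show ?thesis by simp
  qed
qed

lemma finite_near: "finite (near e x)" and card_near: "card (near e x) \<le> 25"
  using lattice_box(1)[of "x $ 1 / e" 2 "x $ 2 / e"] lattice_box(2)[OF refl, of "x $ 1 / e" "x $ 2 / e"] by (auto simp: near_def forall_2)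

lemma supp2_partial:
  assumes "supp2 b"
  shows "supp2 (partial i b)"
  unfolding supp2_def
proof (intro allI impI)
  fix y j assume ne: "partial i b y \<noteq> 0"
  show "\<bar>y $ j\<bar> \<le> 2"
  proof (rule ccontr)
    assume "\<not> \<bar>y $ j\<bar> \<le> 2"
    then have y: "y \<in> {y. \<bar>y $ j\<bar> > 2}" by auto
    have "open {y::real^2. \<bar>y $ j\<bar> > 2}"
      by (intro open_Collect_less continuous_intros)
    moreover have "b u = 0" if "u \<in> {y. \<bar>y $ j\<bar> > 2}" for u
      using assms that unfolding supp2_def mem_Collect_eq by (meson not_less)
    ultimately have "(b has_derivative (\<lambda>h. 0)) (at y)"
      by (intro has_derivative_transform_within_open[OF has_derivative_const[of 0] _ y]) auto
    from partialI[OF this] ne show False by simp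
  qed
qed

text \<open>Near x the moving index set is replaced by one finite set: if u is within e of x, the
  lattice points near u lie in a box of half-side 3 around x / e, and the additional terms vanish by
  \<open>supp2\<close>. The sum is then differentiated term by term.\<close>

lemma gsum_derivative:
  assumes e: "e > 0" and b: "\<And>y. b differentiable (at y)" and s: "supp2 b"
  shows "gsum e b c differentiable (at x)"
    and "partial i (gsum e b c) x = (1/e) * gsum e (partial i b) c x"
proof -
  define F where "F = {z. \<bar>x $ 1 / e - of_int (fst z)\<bar> \<le> 3 \<and> \<bar>x $ 2 / e - of_int (snd z)\<bar> \<le> 3}"
  have finF: "finite F" unfolding F_def by (rule lattice_box)
  have extend: "gsum e b' c u = (\<Sum>z\<in>F. c z * b' ((1/e) *\<^sub>R u - lattice_vec z))"
    if u: "u \<in> ball x e" and s': "supp2 b'" for u b'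
  proof -
    have "\<bar>u $ i / e - x $ i / e\<bar> \<le> 1" for i
    proof -
      have "\<bar>(u - x) $ i\<bar> \<le> norm (u - x)" by (rule component_le_norm_cart)
      also have "\<dots> \<le> e" using u by (simp add: dist_norm norm_minus_commute)
      finally show ?thesis using e by (simp add: field_simps flip: diff_divide_distrib)
    qed
    from this[of 1] this[of 2] have "near e u \<subseteq> F"
      by (auto simp: near_def F_def forall_2)
    then show ?thesis unfolding gsum_def
      by (rule sum.mono_neutral_left[OF finF]) (use s' in \<open>auto simp: near_def supp2_def\<close>)
  qed
  have d1: "((\<lambda>u. c z * b ((1/e) *\<^sub>R u - lattice_vec z)) has_derivative 
      (\<lambda>h. c z * frechet_derivative b (at ((1/e) *\<^sub>R x - lattice_vec z)) ((1/e) *\<^sub>R h))) (at x)" for z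
    by (auto intro!: derivative_eq_intros has_derivative_compose[OF _ b[THEN frechet_derivative_works[THEN iffD1]]])
  let ?D = "\<lambda>h. \<Sum>z\<in>F. c z * frechet_derivative b (at ((1/e) *\<^sub>R x - lattice_vec z)) ((1/e) *\<^sub>R h)"
  have "((\<lambda>u. \<Sum>z\<in>F. c z * b ((1/e) *\<^sub>R u - lattice_vec z)) has_derivative ?D) (at x)"
    by (intro has_derivative_sum d1)
  from has_derivative_transform_within_open[OF this open_ball, of x e "gsum e b c"]
  have D: "(gsum e b c has_derivative ?D) (at x)" using extend[OF _ s] e by simp
  then show "gsum e b c differentiable (at x)" by (auto simp: differentiable_def)
  have l: "frechet_derivative b (at u) ((1/e) *\<^sub>R h) = (1/e) * frechet_derivative b (at u) h" for u h
    using linear_cmul[OF linear_frechet_derivative[OF b]] by simp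
  show "partial i (gsum e b c) x = (1/e) * gsum e (partial i b) c x"
    using e by (subst partialI[OF D], subst extend[OF _ supp2_partial[OF s]])
       (auto simp: l partial_def sum_distrib_left intro!: sum.cong)
qed

lemma partial_gsum:
  assumes "e > 0" "\<And>y. b differentiable (at y)" "supp2 b"
  shows "partial i (gsum e b c) = (\<lambda>x. (1/e) * gsum e (partial i b) c x)"
  using gsum_derivative(2)[OF assms] by blast

lemma sm_gsum: "e > 0 \<Longrightarrow> sm n b \<Longrightarrow> supp2 b \<Longrightarrow> sm n (gsum e b c)"
proof (induction n arbitrary: b)
  case (Suc n)
  then have "sm n (gsum e (partial i b) c)" for i using supp2_partial by auto
  with Suc.prems show ?case
    by (auto simp: partial_gsum intro: gsum_derivative(1) simp del: times_divide_eq_left intro!: sm_cmult)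
qed auto

lemma gsum_bound:
  assumes c: "\<And>z. z \<in> near e x \<Longrightarrow> \<bar>c z\<bar> \<le> m" and m: "0 \<le> m" and b: "\<And>y. \<bar>b y\<bar> \<le> M"
  shows "\<bar>gsum e b c x\<bar> \<le> 25 * m * M"
proof -
  have M: "0 \<le> M" using b[of 0] by linarith
  have "\<bar>gsum e b c x\<bar> \<le> (\<Sum>z\<in>near e x. m * M)" unfolding gsum_def
    by (intro order_trans[OF sum_abs] sum_mono) (auto simp: abs_mult intro!: mult_mono c b m)
  also have "\<dots> \<le> 25 * (m * M)"
    using card_near[of e x] m M by (simp only: sum_constant) (intro mult_right_mono, auto)
  finally show ?thesis by simp
qed

text \<open>Each derivative falls on b and brings a factor 1/e; at most 25 lattice points
  contribute. Only coefficients near x enter the bound at x, which makes the later error estimates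
  local.\<close>

lemma cb_gsum:
  assumes e: "e > 0" and c: "\<And>z. z \<in> near e x \<Longrightarrow> \<bar>c z\<bar> \<le> m" and m: "0 \<le> m"
  shows "sm n b \<Longrightarrow> supp2 b \<Longrightarrow> (\<And>y. cb n M 1 b y) \<Longrightarrow> cb n (25 * m * M) (1/e) (gsum e b c) x"
proof (induction n arbitrary: b)
  case (0 b)
  then show ?case using gsum_bound[OF c m] by auto
next
  case (Suc n b)
  have "\<bar>gsum e b c x\<bar> \<le> 25 * m * M" by (rule gsum_bound[OF c m cb_bound[OF Suc.prems(3)]])
  moreover have "cb n (25 * m * M * (1/e)) (1/e) (partial i (gsum e b c)) x" for i
  proof -
    have "cb n (25 * m * M) (1/e) (gsum e (partial i b) c) x"
      using Suc.prems supp2_partial by (intro Suc.IH) auto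
    from cb_cmult[OF sm_gsum[OF e, of n "partial i b" c] this, of "1/e"] Suc.prems supp2_partial e
    have "cb n (1/e * (25 * m * M)) (1/e) (\<lambda>x. (1/e) * gsum e (partial i b) c x) x" by simp
    then show ?thesis using Suc.prems e by (subst partial_gsum) (auto simp: mult.commute)
  qed
  ultimately show ?case by (rule cb_SucI)
qed

section \<open>A compactly supported bump of finite smoothness\<close>

lemma DERIV_max_power:
  assumes "2 \<le> k"
  shows "((\<lambda>s::real. max 0 s ^ k) has_real_derivative real k * max 0 s ^ (k - 1)) (at s)"
proof -
  consider "s > 0" | "s < 0" | "s = 0" by linarith
  then show ?thesis
  proof cases
    case 1
    have "((\<lambda>s::real. s ^ k) has_real_derivative real k * max 0 s ^ (k - 1)) (at s)"
      using 1 by (auto intro!: derivative_eq_intros)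
    then show ?thesis
      by (rule has_field_derivative_transform_within_open[of _ _ _ "{0<..}"]) (use 1 in auto)
  next
    case 2
    have "real k * max 0 s ^ (k - 1) = 0" using 2 assms by (simp add: max_absorb1)
    then have "((\<lambda>s::real. 0) has_real_derivative real k * max 0 s ^ (k - 1)) (at s)"
      by (metis DERIV_const)
    then show ?thesis
      by (rule has_field_derivative_transform_within_open[of _ _ _ "{..<0}"]) (use 2 assms in auto)
  next
    case 3
    have "(\<lambda>h::real. max 0 h ^ k / h) \<midarrow>0\<rightarrow> 0"
    proof (rule Lim_null_comparison[where g = "\<lambda>h. \<bar>h\<bar>"])
      have "\<bar>max 0 h ^ k / h\<bar> \<le> \<bar>h\<bar>" if "\<bar>h\<bar> < 1" for h :: real
      proof (cases "h > 0")
        case True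
        have "h ^ k \<le> h ^ 2" using True that assms by (intro power_decreasing) auto
        then show ?thesis using True by (simp add: field_simps power2_eq_square)
      qed (use assms in \<open>auto simp: max_absorb1 power_0_left\<close>)
      then show "\<forall>\<^sub>F h::real in at 0. norm (max 0 h ^ k / h) \<le> \<bar>h\<bar>"
        by (auto simp: eventually_at dist_real_def intro!: exI[of _ 1])
    qed (auto intro!: tendsto_eq_intros)
    then show ?thesis using 3 assms by (simp add: DERIV_def power_0_left)
  qed
qed

text \<open>A truncated power in one coordinate times a monomial. The span of this family is closed
  under differentiation, and each derivative lowers k by at most one, so smoothness and bounds
  follow by induction. The monomial also supplies the linear weights for Taylor polynomials.\<close>

definition rho :: "nat \<Rightarrow> nat \<Rightarrow> 2 \<Rightarrow> real^2 \<Rightarrow> real" where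
  "rho j k i y = (y $ i) ^ j * max 0 (4 - (y $ i)\<^sup>2) ^ k"

lemma rho_derivative:
  assumes "2 \<le> k"
  shows "rho j k i differentiable (at y)"
    and "partial m (rho j k i) y =
      (if m = i then real j * rho (j - 1) k i y - 2 * real k * rho (j + 1) (k - 1) i y else 0)"
proof -
  let ?\<phi> = "\<lambda>t::real. t ^ j * max 0 (4 - t\<^sup>2) ^ k"
  \<comment> \<open>For j = 0 the truncated \<open>j - 1\<close> is harmless, as its term carries
    the factor \<open>real j\<close>.\<close>
  let ?d = "\<lambda>t::real. real j * (t ^ (j - 1) * max 0 (4 - t\<^sup>2) ^ k) 
     - 2 * real k * (t ^ (j + 1) * max 0 (4 - t\<^sup>2) ^ (k - 1))"
  have 0: "((\<lambda>t. max 0 (4 - t\<^sup>2) ^ k) has_real_derivative real k * max 0 (4 - t\<^sup>2) ^ (k - 1) * (- (2 * t))) (at t)" for t :: real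
    by (rule DERIV_chain2[OF DERIV_max_power[OF assms]]) (auto intro!: derivative_eq_intros)
  have D: "(?\<phi> has_real_derivative ?d t) (at t)" for t :: real
    by (rule derivative_eq_intros 0 refl)+ (auto simp: algebra_simps)
  have r: "rho j k i = (\<lambda>y. ?\<phi> (y $ i))" by (auto simp: rho_def)
  have c: "(\<lambda>y::real^2. y $ i) differentiable (at y)"
    by (intro bounded_linear_imp_differentiable bounded_linear_vec_nth)
  show "rho j k i differentiable (at y)"
    unfolding r by (rule differentiable_compose_real[OF c D])
  show "partial m (rho j k i) y =
      (if m = i then real j * rho (j - 1) k i y - 2 * real k * rho (j + 1) (k - 1) i y else 0)"
    unfolding r by (subst partial_compose[OF c D]) (auto simp: partial_coord rho_def)
qed

lemma partial_rho:
  assumes "2 \<le> k"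
  shows "partial m (rho j k i) =
      (if m = i then (\<lambda>y. real j * rho (j - 1) k i y - 2 * real k * rho (j + 1) (k - 1) i y) else (\<lambda>y. 0))"
  by (rule ext) (auto simp: rho_derivative(2)[OF assms])

lemma sm_rho: "n + 1 \<le> k \<Longrightarrow> sm n (rho j k i)"
  by (induction n arbitrary: j k)
     (auto simp: partial_rho rho_derivative(1) sm_const simp del: of_nat_mult intro!: sm_sub sm_cmult)

lemma cb_rho: "n + 1 \<le> k \<Longrightarrow> \<exists>M. \<forall>y. cb n M 1 (rho j k i) y"
proof (induction n arbitrary: j k)
  case (0 j k)
  have "\<bar>rho j k i y\<bar> \<le> 2 ^ j * 4 ^ k" for y
  proof (cases "\<bar>y $ i\<bar> \<le> 2")
    case True
    then show ?thesis unfolding rho_def abs_mult power_abs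
      by (intro mult_mono power_mono) auto
  next
    case False
    then have "4 - (y $ i)\<^sup>2 \<le> 0" using abs_le_square_iff[of "y $ i" 2] by auto
    then show ?thesis using 0 by (auto simp: rho_def max_absorb1 power_0_left)
  qed
  then show ?case by auto
next
  case (Suc n j k)
  obtain M0 where M0: "\<And>y. cb n M0 1 (rho j k i) y" using Suc.IH[of k j] Suc.prems by auto
  obtain M1 where M1: "\<And>y. cb n M1 1 (rho (j - 1) k i) y" using Suc.IH[of k "j-1"] Suc.prems by auto
  obtain M2 where M2: "\<And>y. cb n M2 1 (rho (j + 1) (k-1) i) y" using Suc.IH[of "k-1" "j+1"] Suc.prems by (metis add_le_imp_le_diff add.assoc plus_1_eq_Suc add.commute)
  define M3 where "M3 = \<bar>real j\<bar> * M1 + \<bar>2 * real k\<bar> * M2"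
  have M3: "cb n M3 1 (\<lambda>y. real j * rho (j - 1) k i y - 2 * real k * rho (j + 1) (k - 1) i y) y" for y
    unfolding M3_def using Suc.prems by (intro cb_sub cb_cmult sm_cmult sm_rho M1 M2) auto
  have nn: "0 \<le> M0" "0 \<le> M3" using cb_nonneg[OF M0] cb_nonneg[OF M3] by auto
  have "cb (Suc n) (M0 + M3) 1 (rho j k i) y" for y
  proof (rule cb_SucI)
    show "\<bar>rho j k i y\<bar> \<le> M0 + M3" using cb_bound[OF M0, of y] nn by simp
    show "cb n ((M0 + M3) * 1) 1 (partial m (rho j k i)) y" for m
      using Suc.prems nn cb_mono[OF M3, of "M0 + M3" 1 y] by (auto simp: partial_rho intro: cb_zero)
  qed
  then show ?case by blast
qed

text \<open>\<open>bump 1 0\<close> and \<open>bump 0 1\<close> are \<open>bump 0 0\<close> times a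
  coordinate. The exponent 4 is the least for which \<open>sm_rho\<close> and \<open>cb_rho\<close>
  provide three derivatives.\<close>

definition bump :: "nat \<Rightarrow> nat \<Rightarrow> real^2 \<Rightarrow> real" where
  "bump j k y = rho j 4 1 y * rho k 4 2 y"

lemma sm_bump: "sm 3 (bump j k)"
  unfolding bump_def by (intro sm_mult sm_rho) auto

lemma supp2_bump: "supp2 (bump j k)"
proof -
  have "\<bar>y $ i\<bar> \<le> 2" if "rho j 4 i y \<noteq> 0" for j i y
  proof (rule ccontr)
    assume "\<not> \<bar>y $ i\<bar> \<le> 2"
    then have "4 - (y $ i)\<^sup>2 \<le> 0" using abs_le_square_iff[of "y $ i" 2] by auto
    then show False using that by (auto simp: rho_def max_absorb1)
  qed
  then show ?thesis by (auto simp: supp2_def bump_def forall_2)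
qed

lemma cb_bump: "\<exists>M. \<forall>y. cb 3 M 1 (bump j k) y"
proof -
  obtain M1 where M1: "\<And>y. cb 3 M1 1 (rho j 4 1) y" using cb_rho[of 3 4 j 1] by auto
  obtain M2 where M2: "\<And>y. cb 3 M2 1 (rho k 4 2) y" using cb_rho[of 3 4 k 2] by auto
  have "cb 3 (2 ^ 3 * (M1 * M2)) 1 (bump j k) y" for y
    unfolding bump_def by (intro cb_mult sm_rho M1 M2) auto
  then show ?thesis by blast
qed

section \<open>Lattice averages that reproduce affine functions\<close>

definition weight :: "real \<Rightarrow> real^2 \<Rightarrow> real" where
  "weight e = gsum e (bump 0 0) (\<lambda>_. 1)"

lemma bump_nonneg: "0 \<le> bump 0 0 y"
  by (auto simp: bump_def rho_def)

text \<open>All summands are nonnegative, and the one centred at the rounded point is at least 1: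
  there both coordinates have modulus at most 1, so 4 - t^2 is at least 3. Division by the weight is
  therefore safe.\<close>

lemma weight_ge_1: "1 \<le> weight e x"
proof -
  define z where "z = (round (x $ 1 / e), round (x $ 2 / e))"
  let ?y = "(1/e) *\<^sub>R x - lattice_vec z"
  have y: "\<bar>?y $ i\<bar> \<le> 1" for i
  proof -
    have r: "\<bar>t - of_int (round t)\<bar> \<le> 1" for t :: real
      using of_int_round_abs_le[of t] by linarith
    show ?thesis using r[of "x $ 1 / e"] r[of "x $ 2 / e"] exhaust_2[of i]
      by (auto simp: z_def)
  qed
  have "\<bar>?y $ i\<bar> \<le> 2" for i using y[of i] by linarith
  then have z: "z \<in> near e x" by (auto simp: near_def)
  have "1 \<le> rho 0 4 i ?y" for i
  proof -
    have "(?y $ i)\<^sup>2 \<le> 1" using y[of i] by (simp add: abs_square_le_1)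
    then have "1 \<le> max 0 (4 - (?y $ i)\<^sup>2)" by linarith
    then show ?thesis by (simp add: rho_def one_le_power)
  qed
  from mult_mono[OF this[of 1] this[of 2]] have "1 \<le> bump 0 0 ?y"
    by (simp add: bump_def order_trans[OF zero_le_one \<open>\<And>i. 1 \<le> rho 0 4 i ?y\<close>])
  also have "\<dots> \<le> weight e x" unfolding weight_def gsum_def
    using member_le_sum[OF z, of "\<lambda>z. 1 * bump 0 0 ((1/e) *\<^sub>R x - lattice_vec z)"] bump_nonneg finite_near
    by simp
  finally show ?thesis .
qed

(* A weighted mean of the affine functions with value a z and slope s i z at the lattice point e z. *)
definition quasi_interp ::
  "real \<Rightarrow> (int \<times> int \<Rightarrow> real) \<Rightarrow> (2 \<Rightarrow> int \<times> int \<Rightarrow> real) \<Rightarrow> real^2 \<Rightarrow> real" where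
  "quasi_interp e a s x = (gsum e (bump 0 0) a x + e * gsum e (bump 1 0) (s 1) x
      + e * gsum e (bump 0 1) (s 2) x) * weight e x powr (-1)"

lemma sm_weight: "e > 0 \<Longrightarrow> sm 3 (weight e)"
  unfolding weight_def by (intro sm_gsum sm_bump supp2_bump)

lemma sm_quasi_interp: "e > 0 \<Longrightarrow> sm 3 (quasi_interp e a s)"
  unfolding quasi_interp_def[abs_def]
  using weight_ge_1 by (intro sm_mult sm_add sm_cmult sm_gsum sm_bump supp2_bump sm_powr sm_weight)
    (auto intro: less_le_trans[OF zero_less_one])

text \<open>An affine function passes through the mean unchanged: every local polynomial coincides
  with it and the normalized weights add up to one. Hence the error depends only on the deviation of
  the data from that function.\<close>

lemma quasi_interp_affine:
  assumes e: "e > 0"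
  shows "quasi_interp e a s y - (a0 + (\<Sum>i\<in>UNIV. s0 i * (y $ i - x $ i))) =
    quasi_interp e (\<lambda>z. a z - (a0 + (\<Sum>i\<in>UNIV. s0 i * (e * lattice_vec z $ i - x $ i))))
      (\<lambda>i z. s i z - s0 i) y"
proof -
  define Q where "Q u = a0 + (\<Sum>i\<in>UNIV. s0 i * (u $ i - x $ i))" for u :: "real^2"
  \<comment> \<open>The value at y is the value at any lattice point plus slope times offset, so Q y
    can be subtracted inside every summand.\<close>
  have Q: "Q y = Q (e *\<^sub>R lattice_vec z) + e * (((1/e) *\<^sub>R y - lattice_vec z) $ 1 * s0 1)
      + e * (((1/e) *\<^sub>R y - lattice_vec z) $ 2 * s0 2)" for z
    using e by (simp add: Q_def UNIV_2 field_simps)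
  have b1: "bump 1 0 u = u $ 1 * bump 0 0 u" "bump 0 1 u = u $ 2 * bump 0 0 u" for u
    by (auto simp: bump_def rho_def)
  let ?b = "\<lambda>z. bump 0 0 ((1/e) *\<^sub>R y - lattice_vec z)"
  let ?N = "\<lambda>a s. gsum e (bump 0 0) a y + e * gsum e (bump 1 0) (s 1) y + e * gsum e (bump 0 1) (s (2::2)) y"
  let ?a' = "\<lambda>z. a z - Q (e *\<^sub>R lattice_vec z)" and ?s' = "\<lambda>i z. s i z - s0 i"
  have N: "?N a s = (\<Sum>z\<in>near e y. ?b z * (a z + e * (((1/e) *\<^sub>R y - lattice_vec z) $ 1 * s 1 z)
      + e * (((1/e) *\<^sub>R y - lattice_vec z) $ 2 * s 2 z)))" for a s
    unfolding gsum_def sum_distrib_left sum.distrib[symmetric] b1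
    by (intro sum.cong) (auto simp: algebra_simps)
  have "?N a s - Q y * weight e y = ?N ?a' ?s'"
    unfolding N[of a s] N[of ?a' ?s'] unfolding weight_def gsum_def sum_distrib_left sum_subtractf[symmetric]
  proof (intro sum.cong refl)
    fix z
    show "?b z * (a z + e * (((1/e) *\<^sub>R y - lattice_vec z) $ 1 * s 1 z)
      + e * (((1/e) *\<^sub>R y - lattice_vec z) $ 2 * s 2 z)) - Q y * (1 * ?b z)
      = ?b z * (?a' z + e * (((1/e) *\<^sub>R y - lattice_vec z) $ 1 * ?s' 1 z)
      + e * (((1/e) *\<^sub>R y - lattice_vec z) $ 2 * ?s' 2 z))"
      unfolding Q[of z] by (simp only: algebra_simps)
  qed
  then have "(?N a s - Q y * weight e y) * weight e y powr (-1) = quasi_interp e ?a' ?s' y"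
    by (simp add: quasi_interp_def)
  moreover have "weight e y * weight e y powr (-1) = 1"
    using weight_ge_1[of e y] by (simp add: powr_minus)
  ultimately have "quasi_interp e a s y - Q y = quasi_interp e ?a' ?s' y"
    unfolding quasi_interp_def by (metis (no_types, lifting) left_diff_distrib mult.assoc mult.right_neutral)
  then show ?thesis by (simp add: Q_def)
qed

text \<open>By affine reproduction only the deviation of the data near x from an affine function
  enters. Slopes deviate by m / e, and the factor e in the mean makes all three sums of size m.
  Division by the weight costs a constant, by \<open>cb_powr\<close> with exponent -1.\<close>

lemma cb_quasi_interp:
  "\<exists>C>0. \<forall>e>0. \<forall>a s x m a0 s0. 0 \<le> m \<longrightarrow>
     (\<forall>z\<in>near e x. \<bar>a z - (a0 + (\<Sum>i\<in>UNIV. s0 i * (e * lattice_vec z $ i - x $ i)))\<bar> \<le> m \<and>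
        (\<forall>i. \<bar>s i z - s0 i\<bar> \<le> m / e)) \<longrightarrow>
     cb 3 (C * m) (1/e) (\<lambda>y. quasi_interp e a s y - (a0 + (\<Sum>i\<in>UNIV. s0 i * (y $ i - x $ i)))) x"
proof -
  obtain M0 M1 M2 where M: "\<And>y. cb 3 M0 1 (bump 0 0) y" "\<And>y. cb 3 M1 1 (bump 1 0) y"
    "\<And>y. cb 3 M2 1 (bump 0 1) y" using cb_bump by metis
  have M0: "0 \<le> M0" "0 \<le> M1" "0 \<le> M2" using M cb_nonneg by blast+
  define c where "c = max 1 (25 * M0)"
  obtain C1 where C1: "C1 > 0" "\<And>d L g x. d>0 \<Longrightarrow> L\<ge>0 \<Longrightarrow> (\<forall>y. 0 < g y) \<Longrightarrow> sm 3 (g :: real^2 \<Rightarrow> real) \<Longrightarrow>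
     d \<le> g x \<Longrightarrow> cb 3 (c * d) L g x \<Longrightarrow> cb 3 (C1 * d powr (-1)) L (\<lambda>x. g x powr (-1)) x"
    using cb_powr[of c 3 "-1"] unfolding c_def by (metis max.cobounded1)
  define C where "C = 2 ^ 3 * (25 * (M0 + M1 + M2) * C1)"
  have main: "cb 3 (C * m) (1/e) (quasi_interp e a s) x"
    if e: "e > 0" and m: "0 \<le> m" and a: "\<And>z. z \<in> near e x \<Longrightarrow> \<bar>a z\<bar> \<le> m"
     and s: "\<And>z i. z \<in> near e x \<Longrightarrow> \<bar>s i z\<bar> \<le> m / e" for e a s x m
  proof -
    have w0: "cb 3 (25 * 1 * M0) (1/e) (weight e) x" unfolding weight_def
      by (intro cb_gsum e sm_bump supp2_bump M) auto
    have w: "cb 3 (c * 1) (1/e) (weight e) x"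
      by (rule cb_mono[OF w0]) (use e in \<open>auto simp: c_def\<close>)
    have wp: "cb 3 (C1 * 1 powr (-1)) (1/e) (\<lambda>x. weight e x powr (-1)) x"
      using e weight_ge_1[of e]
      by (intro C1(2) sm_weight w) (auto intro: less_le_trans[OF zero_less_one])
    have "cb 3 (25 * m * M0 + \<bar>e\<bar> * (25 * (m / e) * M1) + \<bar>e\<bar> * (25 * (m / e) * M2)) (1/e) 
      (\<lambda>x. gsum e (bump 0 0) a x + e * gsum e (bump 1 0) (s 1) x + e * gsum e (bump 0 1) (s 2) x) x"
      using e m by (intro cb_add cb_cmult cb_gsum sm_add sm_cmult sm_gsum sm_bump supp2_bump M e a s) auto
    moreover have "25 * m * M0 + \<bar>e\<bar> * (25 * (m / e) * M1) + \<bar>e\<bar> * (25 * (m / e) * M2) = 25 * (M0 + M1 + M2) * m"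
      using e by (simp add: field_simps)
    ultimately have "cb 3 (2 ^ 3 * (25 * (M0 + M1 + M2) * m * (C1 * 1 powr (-1)))) (1/e) (quasi_interp e a s) x"
      unfolding quasi_interp_def[abs_def] using weight_ge_1[of e] e
      by (intro cb_mult[OF _ _ _ wp] sm_add sm_cmult sm_gsum sm_bump supp2_bump sm_powr sm_weight)
        (auto intro: less_le_trans[OF zero_less_one])
    then show ?thesis by (simp add: C_def mult_ac)
  qed
  have "cb 3 (max C 1 * m) (1/e) (\<lambda>y. quasi_interp e a s y - (a0 + (\<Sum>i\<in>UNIV. s0 i * (y $ i - x $ i)))) x"
    if "e > 0" "0 \<le> m" "\<forall>z\<in>near e x. \<bar>a z - (a0 + (\<Sum>i\<in>UNIV. s0 i * (e * lattice_vec z $ i - x $ i)))\<bar> \<le> m \<and>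
        (\<forall>i. \<bar>s i z - s0 i\<bar> \<le> m / e)" for e a s x m a0 s0
    unfolding quasi_interp_affine[OF that(1)]
    by (rule cb_mono[OF main]) (use that in \<open>auto intro!: mult_right_mono\<close>)
  then show ?thesis by (intro exI[of _ "max C 1"]) auto
qed

text \<open>Takes the place of mollification at scale e, using only point values on the
  lattice.\<close>

definition smoothing :: "real \<Rightarrow> (real^2 \<Rightarrow> real) \<Rightarrow> real^2 \<Rightarrow> real" where
  "smoothing e f = quasi_interp e (\<lambda>z. f (e *\<^sub>R lattice_vec z)) (\<lambda>i z. 0)"

lemma norm_near:
  assumes "z \<in> near e x" "e > 0"
  shows "norm (e *\<^sub>R lattice_vec z - x) \<le> 4 * e"
proof -
  have "\<bar>(e *\<^sub>R lattice_vec z - x) $ i\<bar> \<le> 2 * e" for i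
  proof -
    have "\<bar>x $ i / e - lattice_vec z $ i\<bar> \<le> 2" using assms(1) by (auto simp: near_def field_simps)
    then have "e * \<bar>x $ i / e - lattice_vec z $ i\<bar> \<le> e * 2" using assms(2) by (intro mult_left_mono) auto
    moreover have "(e *\<^sub>R lattice_vec z - x) $ i = - (e * (x $ i / e - lattice_vec z $ i))"
      using assms(2) by (simp add: right_diff_distrib)
    then have "\<bar>(e *\<^sub>R lattice_vec z - x) $ i\<bar> = e * \<bar>x $ i / e - lattice_vec z $ i\<bar>"
      using assms(2) by (simp only: abs_minus_cancel abs_mult)
    ultimately show ?thesis by simp
  qed
  from this[of 1] this[of 2] norm_le_l1_cart[of "e *\<^sub>R lattice_vec z - x"] show ?thesis
    unfolding sum_2 by linarith
qed

lemma sm_smoothing: "e > 0 \<Longrightarrow> sm 3 (smoothing e f)"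
  unfolding smoothing_def by (rule sm_quasi_interp)

text \<open>The mean reproduces the constant f x, so the oscillation of f within 4 e of x bounds the
  error and, at frequency 1/e, the derivatives as well. The radius 4 e adds up two coordinates that
  differ by at most 2 e each.\<close>

lemma smoothing_bound:
  "\<exists>C>0. \<forall>e>0. \<forall>f x m. (\<forall>y. norm (y - x) \<le> 4 * e \<longrightarrow> \<bar>f y - f x\<bar> \<le> m) \<longrightarrow>
     \<bar>smoothing e f x - f x\<bar> \<le> C * m \<and> (\<forall>i. cb 2 (C * m / e) (1/e) (partial i (smoothing e f)) x)"
proof -
  obtain C where C: "C > 0" "\<forall>e>0. \<forall>a s x m a0 s0. 0 \<le> m \<longrightarrow>
     (\<forall>z\<in>near e x. \<bar>a z - (a0 + (\<Sum>i\<in>UNIV. s0 i * (e * lattice_vec z $ i - x $ i)))\<bar> \<le> m \<and>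
        (\<forall>i. \<bar>s i z - s0 i\<bar> \<le> m / e)) \<longrightarrow>
     cb 3 (C * m) (1/e) (\<lambda>y. quasi_interp e a s y - (a0 + (\<Sum>i\<in>UNIV. s0 i * (y $ i - x $ i)))) x"
    using cb_quasi_interp by (elim exE conjE)
  show ?thesis
  proof (intro exI[of _ C] conjI C(1) allI impI)
    fix e m :: real and f :: "real^2 \<Rightarrow> real" and x
    assume e: "e > 0" and m: "\<forall>y. norm (y - x) \<le> 4 * e \<longrightarrow> \<bar>f y - f x\<bar> \<le> m"
    have m0: "0 \<le> m" using m[rule_format, of x] e by auto
    have "cb 3 (C * m) (1/e) (\<lambda>y. smoothing e f y - (f x + (\<Sum>i\<in>UNIV. 0 * (y $ i - x $ i)))) x"
      unfolding smoothing_def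
    proof (rule C(2)[rule_format, OF e m0], intro conjI)
      fix z assume "z \<in> near e x"
      from m[rule_format, OF norm_near[OF this e]]
      show "\<bar>f (e *\<^sub>R lattice_vec z) - (f x + (\<Sum>i\<in>UNIV. 0 * (e * lattice_vec z $ i - x $ i)))\<bar> \<le> m" by simp
    qed (use m0 e in auto)
    then have 1: "cb 3 (C * m) (1/e) (\<lambda>y. smoothing e f y - f x) x" by simp
    show "\<bar>smoothing e f x - f x\<bar> \<le> C * m" using cb_bound[OF 1] .
    fix i
    have "partial i (\<lambda>y. smoothing e f y - f x) = partial i (smoothing e f)"
      using sm_diff[OF sm_smoothing[OF e]] by (intro ext) (simp add: partial_diff)
    then show "cb 2 (C * m / e) (1/e) (partial i (smoothing e f)) x"
      using cb_partial_numeral(1)[OF 1, of i] by simp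
  qed
qed

section \<open>A single corrugation\<close>

definition step_v :: "real \<Rightarrow> real^'n \<Rightarrow> (real^'n \<Rightarrow> real) \<Rightarrow> (real^'n \<Rightarrow> real) \<Rightarrow> real^'n \<Rightarrow> real" where
  "step_v \<mu> \<xi> a v x = v x + (sqrt 2 / \<mu>) * (a x * sin (\<mu> * (\<xi> \<bullet> x)))"

text \<open>With \<theta> = \<mu> (\<xi> \<bullet> x), the leading part of the squared corrugation
  gradient is 2 a^2 cos(\<theta>)^2 = a^2 + a^2 cos(2 \<theta>) in the direction \<xi> \<xi>; the
  factor sqrt 2 in \<open>step_v\<close> makes the mean exactly a^2. The first term here cancels the
  products with the gradient of v, the second, a multiple of sin(2 \<theta>), the oscillating
  part.\<close>

definition step_w :: "real \<Rightarrow> real^'n \<Rightarrow> (real^'n \<Rightarrow> real) \<Rightarrow> (real^'n \<Rightarrow> real) \<Rightarrow> 'n \<Rightarrow> real^'n \<Rightarrow> real" where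
  "step_w \<mu> \<xi> a v i x = (- (sqrt 2 / \<mu>)) * (a x * sin (\<mu> * (\<xi> \<bullet> x)) * partial i v x) +
     (- (\<xi> $ i / (2 * \<mu>))) * (a x * a x * (sin (\<mu> * (\<xi> \<bullet> x)) * cos (\<mu> * (\<xi> \<bullet> x))))"

text \<open>What these cancellations leave, with the sign of a new deficit. Every term has a factor
  1/\<mu> and contains a derivative of a or a second derivative of v; both orders of the mixed
  derivative occur, as they are not assumed to agree.\<close>

definition step_err :: "real \<Rightarrow> real^'n \<Rightarrow> (real^'n \<Rightarrow> real) \<Rightarrow> (real^'n \<Rightarrow> real) \<Rightarrow> 'n \<Rightarrow> 'n \<Rightarrow> real^'n \<Rightarrow> real" where
  "step_err \<mu> \<xi> a v i j x =
     (sqrt 2 / \<mu>) * (a x * sin (\<mu> * (\<xi> \<bullet> x)) * (partial j (partial i v) x + partial i (partial j v) x))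
     + (- (1 / \<mu>)) * (sin (\<mu> * (\<xi> \<bullet> x)) * cos (\<mu> * (\<xi> \<bullet> x)) * a x * (\<xi> $ i * partial j a x + \<xi> $ j * partial i a x))
     + (- (2 / \<mu>\<^sup>2)) * (sin (\<mu> * (\<xi> \<bullet> x)) * sin (\<mu> * (\<xi> \<bullet> x)) * (partial i a x * partial j a x))"

lemma sm_step_v: "sm n v \<Longrightarrow> sm n a \<Longrightarrow> sm n (step_v \<mu> \<xi> a v)"
  unfolding step_v_def[abs_def] by (intro sm_add sm_cmult sm_mult sm_trig)

lemma sm_step_w: "sm (Suc n) v \<Longrightarrow> sm n a \<Longrightarrow> sm n (step_w \<mu> \<xi> a v i)"
  unfolding step_w_def[abs_def] by (intro sm_add sm_cmult sm_mult sm_trig sm_partial)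

lemma sm_step_err:
  assumes "sm (Suc (Suc n)) v" "sm (Suc n) a"
  shows "sm n (step_err \<mu> \<xi> a v i j)"
  unfolding step_err_def[abs_def]
  by (intro sm_add sm_cmult sm_mult sm_trig sm_partial assms sm_lower[OF assms(2)] sm_const)

lemma partial_step_v:
  assumes "sm 1 v" "sm 1 a" "\<mu> \<noteq> 0"
  shows "partial i (step_v \<mu> \<xi> a v) x = partial i v x +
    sqrt 2 * (a x * cos (\<mu> * (\<xi> \<bullet> x)) * \<xi> $ i) + (sqrt 2 / \<mu>) * (sin (\<mu> * (\<xi> \<bullet> x)) * partial i a x)"
proof -
  have d: "v differentiable (at x)" "a differentiable (at x)" using assms by auto
  have s: "(\<lambda>x. sin (\<mu> * (\<xi> \<bullet> x))) differentiable (at x)" using sm_diff[OF sm_trig(1)[of 1]] by auto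
  have as: "(\<lambda>x. a x * sin (\<mu> * (\<xi> \<bullet> x))) differentiable (at x)" by (intro differentiable_mult d s)
  show ?thesis
    unfolding step_v_def[abs_def] using assms(3)
    by (simp only: partial_add[OF d(1) differentiable_mult[OF differentiable_const as]]
      partial_cmult[OF as] partial_mult[OF d(2) s] partial_sin) (simp add: field_simps)
qed

lemma partial_step_w:
  assumes "sm 2 v" "sm 1 a" "\<mu> \<noteq> 0"
  shows "partial j (step_w \<mu> \<xi> a v i) x =
    - (sqrt 2 / \<mu>) * (a x * sin (\<mu> * (\<xi> \<bullet> x)) * partial j (partial i v) x +
        (a x * (\<mu> * \<xi> $ j * cos (\<mu> * (\<xi> \<bullet> x))) + partial j a x * sin (\<mu> * (\<xi> \<bullet> x))) * partial i v x)
    - (\<xi> $ i / (2 * \<mu>)) * ((a x * a x) * (\<mu> * \<xi> $ j * ((cos (\<mu> * (\<xi> \<bullet> x)))\<^sup>2 - (sin (\<mu> * (\<xi> \<bullet> x)))\<^sup>2))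
        + 2 * (a x * partial j a x) * (sin (\<mu> * (\<xi> \<bullet> x)) * cos (\<mu> * (\<xi> \<bullet> x))))"
proof -
  have d: "partial i v differentiable (at x)" "a differentiable (at x)"
    using assms by (auto simp: eval_nat_numeral)
  have s: "(\<lambda>x. sin (\<mu> * (\<xi> \<bullet> x))) differentiable (at x)" "(\<lambda>x. cos (\<mu> * (\<xi> \<bullet> x))) differentiable (at x)"
    using sm_diff[OF sm_trig(1)[of 1]] sm_diff[OF sm_trig(2)[of 1]] by auto
  note as = differentiable_mult[OF d(2) s(1)]
  note asv = differentiable_mult[OF as d(1)]
  note aa = differentiable_mult[OF d(2) d(2)]
  note sc = differentiable_mult[OF s]
  note aasc = differentiable_mult[OF aa sc]
  show ?thesis
    unfolding step_w_def[abs_def]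
    by (simp only: partial_add[OF differentiable_mult[OF differentiable_const asv] differentiable_mult[OF differentiable_const aasc]]
      partial_cmult[OF asv] partial_cmult[OF aasc] partial_mult[OF as d(1)] partial_mult[OF d(2) s(1)]
      partial_mult[OF aa sc] partial_mult[OF d(2) d(2)] partial_mult[OF s] partial_sin partial_cos)
      (simp add: algebra_simps power2_eq_square)
qed

lemma step_identity:
  assumes "sm 2 v" "sm 1 a" "\<mu> \<noteq> 0"
  shows "partial i (step_v \<mu> \<xi> a v) x * partial j (step_v \<mu> \<xi> a v) x
      + partial j (step_w \<mu> \<xi> a v i) x + partial i (step_w \<mu> \<xi> a v j) x
    = partial i v x * partial j v x + a x * a x * (\<xi> $ i * \<xi> $ j) - step_err \<mu> \<xi> a v i j x"
proof -
  have v1: "sm 1 v" using assms(1) by (rule sm_le) simp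
  \<comment> \<open>With sin, cos, sqrt 2 and 1/\<mu> as variables, the claim is a polynomial
    identity modulo three relations.\<close>
  define s c where "s = sin (\<mu> * (\<xi> \<bullet> x))" and "c = cos (\<mu> * (\<xi> \<bullet> x))"
  have "c\<^sup>2 = 1 - s\<^sup>2" by (simp add: s_def c_def cos_squared_eq)
  define q where "q = sqrt 2"
  have "q\<^sup>2 = 2" by (simp add: q_def)
  define m where "m = 1 / \<mu>"
  have "\<mu> * m = 1" using assms(3) by (simp add: m_def)
  have e: "sqrt 2 / \<mu> = q * m" "\<xi> $ k / (2 * \<mu>) = \<xi> $ k * m / 2" "2 / \<mu>\<^sup>2 = 2 * m\<^sup>2" "1 / \<mu> = m" for k
    using assms(3) by (auto simp: q_def m_def power2_eq_square)
  show ?thesis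
    unfolding partial_step_v[OF v1 assms(2,3)] partial_step_w[OF assms] step_err_def
    unfolding e unfolding s_def[symmetric] c_def[symmetric] q_def[symmetric]
    using \<open>c\<^sup>2 = 1 - s\<^sup>2\<close> \<open>q\<^sup>2 = 2\<close> \<open>\<mu> * m = 1\<close> by algebra
qed

lemma sqrt2_le: "sqrt 2 \<le> 2"
  by (rule real_le_lsqrt) auto

text \<open>The amplitude has two scales: its first derivative costs only l, the frequency of the
  deficit, and further ones cost the smoothing frequency \<kappa>. The error thus contains A l /
  \<mu> instead of A \<kappa> / \<mu>, which saves a factor K in the frequency jump. The bound on w
  is linear in the pointwise size of the gradient of v.\<close>

lemma step_bounds:
  fixes v a :: "real^'n \<Rightarrow> real"
  assumes v: "sm 3 v" and a: "sm 3 a" and \<xi>: "\<And>i. \<bar>\<xi> $ i\<bar> \<le> 1" and \<mu>: "0 < \<mu>" "0 \<le> \<kappa>" "\<kappa> \<le> \<mu>" "0 \<le> l" "l \<le> \<mu>"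
    and A: "cb 3 A \<kappa> a x" "\<And>i. cb 2 (A * l) \<kappa> (partial i a) x"
    and N: "\<And>i j. cb 1 N \<mu> (partial j (partial i v)) x"
  shows "cb 1 (N + 32 * A * \<mu>) \<mu> (partial j (partial i (step_v \<mu> \<xi> a v))) x"
    and "\<bar>partial i (step_v \<mu> \<xi> a v) x - partial i v x\<bar> \<le> 32 * A"
    and "cb 1 (32 * (A * (\<bar>partial i v x\<bar> + N / \<mu> + A))) \<mu> (partial j (step_w \<mu> \<xi> a v i)) x"
    and "cb 1 (32 * (A * (N / \<mu> + A * l / \<mu>))) \<mu> (step_err \<mu> \<xi> a v i j) x"
proof -
  define S Co where "S = (\<lambda>x. sin (\<mu> * (\<xi> \<bullet> x)))" and "Co = (\<lambda>x. cos (\<mu> * (\<xi> \<bullet> x)))"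
  have S: "sm n S" "cb n 1 \<mu> S x" and Co: "sm n Co" "cb n 1 \<mu> Co x" for n
    unfolding S_def Co_def using sm_trig cb_trig[OF \<xi>, of \<mu>] \<mu> by auto
  have A0: "0 \<le> A" and N0: "0 \<le> N" using cb_nonneg A N by blast+
  have Al: "0 \<le> A * l" using A0 \<mu> by simp
  have a': "cb 3 A \<mu> a x" and a1: "cb 2 (A * l) \<mu> (partial i a) x" for i
    using cb_mono[OF A(1) order_refl, of \<mu>] cb_mono[OF A(2) order_refl, of \<mu>] \<mu> by auto
  have a'': "cb n A \<mu> a x" and sa: "sm n a" and sv: "sm n v" if "n \<le> 3" for n
    using cb_le[OF a'] sm_le[OF a] sm_le[OF v] that by auto
  have sva: "sm n (partial i v)" "sm n (partial i a)" if "n \<le> 2" for n i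
    using sm_partial[OF sv[of "Suc n"]] sm_partial[OF sa[of "Suc n"]] that by auto
  have svv: "sm n (partial j (partial i v))" if "n \<le> 1" for n i j
    using sm_partial[OF sva(1)[of "Suc n"]] that by auto
  have as: "cb n (2 ^ n * (A * 1)) \<mu> (\<lambda>x. a x * S x) x" if "n \<le> 3" for n
    by (intro cb_mult sa a'' S that)
  define u where "u = (\<lambda>x. (sqrt 2 / \<mu>) * (a x * S x))"
  have su: "sm 3 u" unfolding u_def by (intro sm_cmult sm_mult sa S order_refl)
  have u: "cb 3 (\<bar>sqrt 2 / \<mu>\<bar> * (2 ^ 3 * (A * 1))) \<mu> u x" unfolding u_def
    by (intro cb_cmult as sm_mult sa S order_refl)
  have "\<bar>sqrt 2 / \<mu>\<bar> * (2 ^ 3 * (A * 1)) \<le> 2 / \<mu> * (2 ^ 3 * (A * 1))"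
    using \<mu> A0 sqrt2_le by (intro mult_right_mono) (auto simp: divide_right_mono)
  also have "\<dots> \<le> 32 * A / \<mu>" using \<mu> A0 by (simp add: field_simps)
  finally have "\<bar>sqrt 2 / \<mu>\<bar> * (2 ^ 3 * (A * 1)) \<le> 32 * A / \<mu>" .
  then have u3: "cb 3 (32 * A / \<mu>) \<mu> u x" using cb_mono[OF u _ _ order_refl] \<mu> by auto
  have u2: "cb 2 (32 * A / \<mu> * \<mu>) \<mu> (partial i u) x" for i
    by (rule cb_partial_numeral(1)[OF u3])
  have u1: "cb 1 (32 * A / \<mu> * \<mu> * \<mu>) \<mu> (partial j (partial i u)) x" for i j
    by (rule cb_partial_numeral(2)[OF u2])
  have su2: "sm 2 (partial i u)" for i by (rule sm_partial_numeral(1)[OF su])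
  have su1: "sm 1 (partial j (partial i u))" for i j
    by (rule sm_partial_numeral(2)[OF su2])
  have sv_eq: "step_v \<mu> \<xi> a v = (\<lambda>x. v x + u x)" by (auto simp: step_v_def u_def S_def)
  have p1: "partial i (step_v \<mu> \<xi> a v) = (\<lambda>x. partial i v x + partial i u x)" for i
    unfolding sv_eq by (intro ext partial_add sm_diff[OF v] sm_diff[OF su]) auto
  have p2: "partial j (partial i (step_v \<mu> \<xi> a v)) = (\<lambda>x. partial j (partial i v) x + partial j (partial i u) x)" for i j
    unfolding p1 by (intro ext partial_add sm_diff[OF sva(1)[of 2]] sm_diff[OF su2]) auto
  show "cb 1 (N + 32 * A * \<mu>) \<mu> (partial j (partial i (step_v \<mu> \<xi> a v))) x"
    unfolding p2 using cb_add[OF svv su1 N u1, of j i j i] \<mu> by simp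
  show "\<bar>partial i (step_v \<mu> \<xi> a v) x - partial i v x\<bar> \<le> 32 * A"
    unfolding p1 using cb_bound[OF u2[of i]] \<mu> by simp
  \<comment> \<open>The size of \<open>partial i v\<close> at frequency \<mu>: its value at x, and N
    / \<mu> so that Q \<mu> covers the second derivatives.\<close>
  define Q where "Q = \<bar>partial i v x\<bar> + N / \<mu>"
  have Q0: "0 \<le> Q" and QN: "N \<le> Q * \<mu>" using \<mu> N0 by (auto simp: Q_def field_simps)
  have dv: "cb 2 Q \<mu> (partial i v) x"
    using cb_mono[OF N QN _ order_refl] \<mu> N0 by (intro cb_numeralI) (auto simp: Q_def)
  have w: "cb 2 (\<bar>- (sqrt 2 / \<mu>)\<bar> * (2^2 * (2^2 * (A * 1) * Q)) +
       \<bar>- (\<xi> $ i / (2 * \<mu>))\<bar> * (2^2 * (2^2 * (A * A) * (2^2 * (1 * 1))))) \<mu> (step_w \<mu> \<xi> a v i) x"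
  proof -
    have le: "(2::nat) \<le> 3" "(2::nat) \<le> 2" by simp_all
    note s2 = sa[OF le(1)] sva(1)[OF le(2), of i] S(1)[of 2] Co(1)[of 2]
    have eq: "step_w \<mu> \<xi> a v i = (\<lambda>x. (- (sqrt 2 / \<mu>)) * (a x * S x * partial i v x) +
       (- (\<xi> $ i / (2 * \<mu>))) * (a x * a x * (S x * Co x)))"
      by (simp add: fun_eq_iff step_w_def S_def Co_def)
    show ?thesis unfolding eq
      by (rule cb_add[OF sm_cmult[OF sm_mult[OF sm_mult[OF s2(1,3)] s2(2)]] sm_cmult[OF sm_mult[OF sm_mult[OF s2(1,1)] sm_mult[OF s2(3,4)]]]
         cb_cmult[OF sm_mult[OF sm_mult[OF s2(1,3)] s2(2)] cb_mult[OF sm_mult[OF s2(1,3)] s2(2) as[OF le(1)] dv]]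
         cb_cmult[OF sm_mult[OF sm_mult[OF s2(1,1)] sm_mult[OF s2(3,4)]] cb_mult[OF sm_mult[OF s2(1,1)] sm_mult[OF s2(3,4)]
           cb_mult[OF s2(1,1) a''[OF le(1)] a''[OF le(1)]] cb_mult[OF s2(3,4) S(2) Co(2)]]]])
  qed
  have n1: "\<bar>- (sqrt 2 / \<mu>)\<bar> * (2^2 * (2^2 * (A * 1) * Q)) \<le> 2 / \<mu> * (2^2 * (2^2 * (A * 1) * Q))"
    using \<mu> A0 Q0 sqrt2_le by (intro mult_right_mono) (auto simp: divide_right_mono)
  have n2: "\<bar>- (\<xi> $ i / (2 * \<mu>))\<bar> * (2^2 * (2^2 * (A * A) * (2^2 * (1 * 1)))) \<le>
     1 / (2 * \<mu>) * (2^2 * (2^2 * (A * A) * (2^2 * (1 * 1))))"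
    using \<mu> A0 \<xi>[of i] by (intro mult_right_mono) (auto simp: field_simps abs_mult)
  have n3: "2 / \<mu> * (2^2 * (2^2 * (A * 1) * Q)) + 1 / (2 * \<mu>) * (2^2 * (2^2 * (A * A) * (2^2 * (1 * 1)))) = 32 * (A * (Q + A)) / \<mu>"
    using \<mu> by (simp add: field_simps)
  have "\<bar>- (sqrt 2 / \<mu>)\<bar> * (2^2 * (2^2 * (A * 1) * Q)) +
       \<bar>- (\<xi> $ i / (2 * \<mu>))\<bar> * (2^2 * (2^2 * (A * A) * (2^2 * (1 * 1)))) \<le> 32 * (A * (Q + A)) / \<mu>"
    using n1 n2 n3 by linarith
  from cb_mono[OF w this _ order_refl] \<mu> have "cb 2 (32 * (A * (Q + A)) / \<mu>) \<mu> (step_w \<mu> \<xi> a v i) x" by simp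
  then have "cb 1 (32 * (A * (Q + A)) / \<mu> * \<mu>) \<mu> (partial j (step_w \<mu> \<xi> a v i)) x"
    by (rule cb_partial_numeral(2))
  then show "cb 1 (32 * (A * (\<bar>partial i v x\<bar> + N / \<mu> + A))) \<mu> (partial j (step_w \<mu> \<xi> a v i)) x"
    using \<mu> by (simp add: Q_def)
  have a1': "cb 1 (A * l) \<mu> (partial i a) x" for i by (rule cb_le[OF a1]) simp
  have le: "(1::nat) \<le> 3" "(1::nat) \<le> 2" "(1::nat) \<le> 1" by simp_all
  note s1 = sa[OF le(1)] sva(2)[OF le(2)] svv[OF le(3)] S(1)[of 1] Co(1)[of 1]
  have t1: "cb 1 (2^1 * (2^1 * (A * 1) * (N + N))) \<mu> (\<lambda>x. a x * S x * (partial j (partial i v) x + partial i (partial j v) x)) x"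
    by (rule cb_mult[OF sm_mult[OF s1(1,4)] sm_add[OF s1(3) s1(3)] as[OF le(1)] cb_add[OF s1(3) s1(3) N N]])
  have t2: "cb 1 (2^1 * (2^1 * (2^1 * (1 * 1) * A) * (\<bar>\<xi> $ i\<bar> * (A * l) + \<bar>\<xi> $ j\<bar> * (A * l)))) \<mu>
     (\<lambda>x. S x * Co x * a x * (\<xi> $ i * partial j a x + \<xi> $ j * partial i a x)) x"
    by (rule cb_mult[OF sm_mult[OF sm_mult[OF s1(4,5)] s1(1)] sm_add[OF sm_cmult[OF s1(2)] sm_cmult[OF s1(2)]]
         cb_mult[OF sm_mult[OF s1(4,5)] s1(1) cb_mult[OF s1(4,5) S(2) Co(2)] a''[OF le(1)]]
         cb_add[OF sm_cmult[OF s1(2)] sm_cmult[OF s1(2)] cb_cmult[OF s1(2) a1'] cb_cmult[OF s1(2) a1']]])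
  have t3: "cb 1 (2^1 * (2^1 * (1 * 1) * (2^1 * ((A * l) * (A * l))))) \<mu>
     (\<lambda>x. S x * S x * (partial i a x * partial j a x)) x"
    by (rule cb_mult[OF sm_mult[OF s1(4,4)] sm_mult[OF s1(2,2)] cb_mult[OF s1(4,4) S(2) S(2)] cb_mult[OF s1(2,2) a1' a1']])
  have er: "step_err \<mu> \<xi> a v i j = (\<lambda>x. 
     ((sqrt 2 / \<mu>) * (a x * S x * (partial j (partial i v) x + partial i (partial j v) x))
     + (- (1 / \<mu>)) * (S x * Co x * a x * (\<xi> $ i * partial j a x + \<xi> $ j * partial i a x)))
     + (- (2 / \<mu>\<^sup>2)) * (S x * S x * (partial i a x * partial j a x)))"
    by (simp add: fun_eq_iff step_err_def S_def Co_def)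
  have e: "cb 1 (\<bar>sqrt 2 / \<mu>\<bar> * (2^1 * (2^1 * (A * 1) * (N + N)))
     + \<bar>- (1 / \<mu>)\<bar> * (2^1 * (2^1 * (2^1 * (1 * 1) * A) * (\<bar>\<xi> $ i\<bar> * (A * l) + \<bar>\<xi> $ j\<bar> * (A * l))))
     + \<bar>- (2 / \<mu>\<^sup>2)\<bar> * (2^1 * (2^1 * (1 * 1) * (2^1 * ((A * l) * (A * l)))))) \<mu> (step_err \<mu> \<xi> a v i j) x"
    unfolding er
    by (rule cb_add[OF sm_add[OF sm_cmult sm_cmult] sm_cmult cb_add[OF sm_cmult sm_cmult cb_cmult[OF _ t1] cb_cmult[OF _ t2]] cb_cmult[OF _ t3]];
       (rule sm_mult[OF sm_mult[OF s1(1,4)] sm_add[OF s1(3) s1(3)]]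
           sm_mult[OF sm_mult[OF sm_mult[OF s1(4,5)] s1(1)] sm_add[OF sm_cmult[OF s1(2)] sm_cmult[OF s1(2)]]]
           sm_mult[OF sm_mult[OF s1(4,4)] sm_mult[OF s1(2,2)]]))
  have e1: "\<bar>sqrt 2 / \<mu>\<bar> * (2^1 * (2^1 * (A * 1) * (N + N))) \<le> 2 / \<mu> * (2^1 * (2^1 * (A * 1) * (N + N)))"
    using \<mu> A0 N0 sqrt2_le by (intro mult_right_mono) (auto simp: divide_right_mono)
  have e2: "\<bar>- (1 / \<mu>)\<bar> * (2^1 * (2^1 * (2^1 * (1 * 1) * A) * (\<bar>\<xi> $ i\<bar> * (A * l) + \<bar>\<xi> $ j\<bar> * (A * l)))) \<le>
     1 / \<mu> * (2^1 * (2^1 * (2^1 * (1 * 1) * A) * (1 * (A * l) + 1 * (A * l))))"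
    using \<mu> A0 Al \<xi>[of i] \<xi>[of j] by (intro mult_mono add_mono mult_right_mono order_refl) auto
  \<comment> \<open>This term is quadratic in l / \<mu>; one of the two quotients is bounded by
    1.\<close>
  have e3: "\<bar>- (2 / \<mu>\<^sup>2)\<bar> * (2^1 * (2^1 * (1 * 1) * (2^1 * ((A * l) * (A * l))))) \<le> 16 * (A * (A * l / \<mu>))"
  proof -
    have "\<bar>- (2 / \<mu>\<^sup>2)\<bar> * (2^1 * (2^1 * (1 * 1) * (2^1 * ((A * l) * (A * l))))) = 16 * (A * (A * l / \<mu>)) * (l / \<mu>)"
      using \<mu> by (simp add: field_simps power2_eq_square)
    also have "\<dots> \<le> 16 * (A * (A * l / \<mu>)) * 1"
      using \<mu> A0 by (intro mult_left_mono) (auto simp: field_simps)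
    finally show ?thesis by simp
  qed
  have e4: "2 / \<mu> * (2^1 * (2^1 * (A * 1) * (N + N))) + 1 / \<mu> * (2^1 * (2^1 * (2^1 * (1 * 1) * A) * (1 * (A * l) + 1 * (A * l))))
     + 16 * (A * (A * l / \<mu>)) \<le> 32 * (A * (N / \<mu> + A * l / \<mu>))"
    using \<mu> A0 N0 by (simp add: field_simps)
  show "cb 1 (32 * (A * (N / \<mu> + A * l / \<mu>))) \<mu> (step_err \<mu> \<xi> a v i j) x"
    by (rule cb_mono[OF e _ _ order_refl]) (use e1 e2 e3 e4 \<mu> in linarith)+
qed

section \<open>One stage of the iteration\<close>

lemma lipschitz_on_convex:
  fixes f :: "real^2 \<Rightarrow> 'b::real_normed_vector"
  assumes "convex S" "\<And>z. z \<in> S \<Longrightarrow> f differentiable (at z)" "\<And>i z. z \<in> S \<Longrightarrow> norm (partial i f z) \<le> B"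
    and "x \<in> S" "y \<in> S"
  shows "norm (f y - f x) \<le> 2 * B * norm (y - x)"
proof (rule differentiable_bound[OF assms(1) _ _ assms(5,4)])
  fix z assume z: "z \<in> S"
  show "(f has_derivative (\<lambda>h. \<Sum>i\<in>UNIV. (h $ i) *\<^sub>R partial i f z)) (at z within S)"
    by (rule has_derivative_at_withinI[OF has_derivative_partial[OF assms(2)[OF z]]])
  show "onorm (\<lambda>h. \<Sum>i\<in>UNIV. (h $ i) *\<^sub>R partial i f z) \<le> 2 * B"
  proof (rule onorm_le)
    fix h :: "real^2"
    have c: "norm ((h $ i) *\<^sub>R partial i f z) \<le> norm h * B" for i
      unfolding norm_scaleR by (intro mult_mono component_le_norm_cart assms(3)[OF z]) auto
    have "norm (\<Sum>i\<in>UNIV. (h $ i) *\<^sub>R partial i f z) \<le> norm h * B + norm h * B"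
      unfolding sum_2 by (rule order_trans[OF norm_triangle_ineq add_mono[OF c c]])
    then show "norm (\<Sum>i\<in>UNIV. (h $ i) *\<^sub>R partial i f z) \<le> 2 * B * norm h"
      by (simp add: mult_ac)
  qed
qed

lemma cb1_lipschitz:
  fixes f :: "real^2 \<Rightarrow> real"
  assumes "\<And>x. f differentiable (at x)" "\<And>i x. \<bar>partial i f x\<bar> \<le> B"
  shows "\<bar>f y - f x\<bar> \<le> 2 * B * norm (y - x)"
  using lipschitz_on_convex[OF convex_UNIV, of f B x y] assms by simp

text \<open>The amplitude is the square root of a coefficient g comparable to d. Its derivative is
  g^(-1/2) times half the derivative of g, and this product keeps the better cost l of the first
  derivative, while the remaining ones cost \<kappa>.\<close>

lemma amplitude:
  fixes c :: real
  assumes c: "1 \<le> c"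
  shows "\<exists>C\<ge>1. \<forall>d>0. \<forall>l>0. \<forall>\<kappa>. \<forall>g :: real^2 \<Rightarrow> real. c * l \<le> \<kappa> \<longrightarrow> sm 3 g \<longrightarrow>
    (\<forall>x. d \<le> g x \<and> g x \<le> 10 * d) \<longrightarrow> (\<forall>i x. cb 2 (c * d * l) \<kappa> (partial i g) x) \<longrightarrow>
    (\<forall>x. cb 3 (C * sqrt d) \<kappa> (\<lambda>x. g x powr (1/2)) x \<and>
      (\<forall>i. cb 2 (C * sqrt d * l) \<kappa> (partial i (\<lambda>x. g x powr (1/2))) x))"
proof -
  obtain C1 where C1: "C1 > 0" "\<forall>d>0. \<forall>L\<ge>0. \<forall>(g :: real^2 \<Rightarrow> real) x. (\<forall>y. 0 < g y) \<longrightarrow> sm 3 g \<longrightarrow>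
     d \<le> g x \<longrightarrow> cb 3 (10 * d) L g x \<longrightarrow> cb 3 (C1 * d powr (1/2)) L (\<lambda>x. g x powr (1/2)) x"
    using cb_powr[of 10 3 "1/2"] by auto
  obtain C2 where C2: "C2 > 0" "\<forall>d>0. \<forall>L\<ge>0. \<forall>(g :: real^2 \<Rightarrow> real) x. (\<forall>y. 0 < g y) \<longrightarrow> sm 2 g \<longrightarrow>
     d \<le> g x \<longrightarrow> cb 2 (10 * d) L g x \<longrightarrow> cb 2 (C2 * d powr (1/2-1)) L (\<lambda>x. g x powr (1/2-1)) x"
    using cb_powr[of 10 2 "1/2-1"] by auto
  define C where "C = max 1 (max C1 (2 * (C2 * c)))"
  show ?thesis
  proof (intro exI[of _ C] conjI allI impI)
    show "1 \<le> C" by (simp add: C_def)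
    fix d l \<kappa> :: real and g :: "real^2 \<Rightarrow> real" and x :: "real^2" and i :: 2
    assume d: "0 < d" and l: "0 < l" and k: "c * l \<le> \<kappa>" and sg: "sm 3 g" and g: "\<forall>x. d \<le> g x \<and> g x \<le> 10 * d"
      and g': "\<forall>i x. cb 2 (c * d * l) \<kappa> (partial i g) x"
    have pos: "\<forall>y. 0 < g y" using g d by (meson less_le_trans)
    have k0: "0 \<le> \<kappa>" using k c l by (meson order_trans mult_nonneg_nonneg less_imp_le zero_le_one)
    have "c * d * l \<le> 10 * d * \<kappa>"
      using mult_left_mono[OF k, of d] mult_nonneg_nonneg[of d \<kappa>] d k0 by (simp add: mult_ac)
    then have cg: "cb 3 (10 * d) \<kappa> g x"
      using g[rule_format, of x] pos[rule_format, of x] k0 by (intro cb_numeralI(1) cb_mono[OF g'[rule_format]]) auto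
    have sq: "d powr (1/2) = sqrt d" using d by (simp add: powr_half_sqrt)
    have C1d: "C1 * d powr (1/2) \<le> C * sqrt d"
      unfolding sq using d by (intro mult_right_mono) (auto simp: C_def)
    show "cb 3 (C * sqrt d) \<kappa> (\<lambda>x. g x powr (1/2)) x"
      by (rule cb_mono[OF C1(2)[rule_format, OF d k0 pos[rule_format] sg _ cg] C1d k0 order_refl]) (use g in auto)
    have sg2: "sm 2 g" by (rule sm_le[OF sg]) simp
    have p: "partial i (\<lambda>x. g x powr (1/2)) = (\<lambda>x. 1/2 * (g x powr (1/2 - 1) * partial i g x))"
      using pos sm_diff[OF sg] by (intro ext partial_powr) auto
    have cg2: "cb 2 (10 * d) \<kappa> g x" by (rule cb_le[OF cg]) simp
    have h: "cb 2 (C2 * d powr (1/2-1)) \<kappa> (\<lambda>x. g x powr (1/2-1)) x"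
      by (rule C2(2)[rule_format, OF d k0 pos[rule_format] sg2 _ cg2]) (use g in auto)
    have sp: "sm 2 (\<lambda>x. g x powr (1/2-1))" by (rule sm_powr[OF pos[rule_format] sg2])
    have sgi: "sm 2 (partial i g)" by (rule sm_partial_numeral(1)[OF sg])
    have b: "cb 2 (\<bar>1/2\<bar> * (2^2 * (C2 * d powr (1/2-1) * (c * d * l)))) \<kappa> (partial i (\<lambda>x. g x powr (1/2))) x"
      unfolding p by (rule cb_cmult[OF sm_mult[OF sp sgi] cb_mult[OF sp sgi h g'[rule_format]]])
    have "d powr (1/2 - 1) * d = sqrt d"
      using d powr_add[of d "1/2-1" 1] sq by simp
    then have "\<bar>1/2\<bar> * (2^2 * (C2 * d powr (1/2-1) * (c * d * l))) = 2 * (C2 * c) * sqrt d * l"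
      by (simp add: mult_ac)
    also have "\<dots> \<le> C * sqrt d * l"
      using d l by (intro mult_right_mono) (auto simp: C_def)
    finally show "cb 2 (C * sqrt d * l) \<kappa> (partial i (\<lambda>x. g x powr (1/2))) x"
      using cb_mono[OF b _ k0 order_refl] by blast
  qed
qed

lemma step_err_sym: "step_err \<mu> \<xi> a v i j = step_err \<mu> \<xi> a v j i"
  by (rule ext) (simp add: step_err_def algebra_simps)

(* d bounds the deficit G, and D the preceding one, whose corrugations determine the second derivatives of v. *)
definition stage_data :: "real \<Rightarrow> real \<Rightarrow> real \<Rightarrow> real \<Rightarrow> (real^2 \<Rightarrow> real) \<Rightarrow> (2 \<Rightarrow> 2 \<Rightarrow> real^2 \<Rightarrow> real) \<Rightarrow> bool" where
  "stage_data B D d l v G \<longleftrightarrow> sm 3 v \<and> (\<forall>i j x. cb 1 (B * sqrt D * l) l (partial j (partial i v)) x) \<and>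
     (\<forall>i j. sm 1 (G i j) \<and> G i j = G j i \<and> (\<forall>x. cb 1 d l (G i j) x))"

text \<open>G - E is what a stage adds and E the deficit that it leaves. The bound on w retains
  \<open>\<bar>partial i v x\<bar>\<close> at the point, the source of the product with the norm of
  the gradient of v in the theorem.\<close>

definition stage_step where
  "stage_step C d \<mu> v G v' w E \<longleftrightarrow> (\<forall>i. sm 2 (w i)) \<and> (\<forall>i j x.
      cb 1 (C * (sqrt d * \<bar>partial i v x\<bar> + d)) \<mu> (partial j (w i)) x \<and>
      \<bar>partial i v' x - partial i v x\<bar> \<le> C * sqrt d \<and>
      partial i v' x * partial j v' x + partial j (w i) x + partial i (w j) x =
        partial i v x * partial j v x + G i j x - E i j (x :: real^2))"

text \<open>The deficit shrinks by 2 K instead of K: the other half of d / K is reserved for the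
  change of the smoothed target between stages. The additional \<open>sqrt K\<close> in the bound
  for \<open>R1\<close> compensates for second derivatives measured by K * d.\<close>

lemma stage:
  "\<exists>B\<ge>1. \<exists>R0\<ge>1. \<exists>C\<ge>1. \<forall>d>0. \<forall>l>0. \<forall>K\<ge>1. \<forall>R1 R v G. R0 * (K * sqrt K) \<le> R1 \<longrightarrow> R0 * K \<le> R \<longrightarrow>
     stage_data B (K * d) d l v G \<longrightarrow>
     (\<exists>v' w E. stage_step C d (l * R1 * R * R) v G v' w E \<and> stage_data B d (d / (2 * K)) (l * R1 * R * R) v' E)"
proof -
  obtain Cs0 where Cs0: "Cs0 > 0" "\<forall>e>0. \<forall>f x m. (\<forall>y. norm (y - x) \<le> 4 * e \<longrightarrow> \<bar>f y - f x\<bar> \<le> m) \<longrightarrow>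
     \<bar>smoothing e f x - f x\<bar> \<le> Cs0 * m \<and> (\<forall>i. cb 2 (Cs0 * m / e) (1/e) (partial i (smoothing e f)) x)"
    using smoothing_bound by (elim exE conjE)
  define Cs where "Cs = max 1 Cs0"
  have Cs1: "1 \<le> Cs" by (simp add: Cs_def)
  \<comment> \<open>Up to two entries of the smoothed deficit enter a coefficient, each with
    derivatives bounded by 8 Cs d l.\<close>
  define c where "c = 16 * Cs"
  have c1: "1 \<le> c" using Cs1 by (simp add: c_def)
  obtain CA0 where CA0: "1 \<le> CA0" "\<forall>d>0. \<forall>l>0. \<forall>\<kappa>. \<forall>g :: real^2 \<Rightarrow> real. c * l \<le> \<kappa> \<longrightarrow> sm 3 g \<longrightarrow>
    (\<forall>x. d \<le> g x \<and> g x \<le> 10 * d) \<longrightarrow> (\<forall>i x. cb 2 (c * d * l) \<kappa> (partial i g) x) \<longrightarrow>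
    (\<forall>x. cb 3 (CA0 * sqrt d) \<kappa> (\<lambda>x. g x powr (1/2)) x \<and>
      (\<forall>i. cb 2 (CA0 * sqrt d * l) \<kappa> (partial i (\<lambda>x. g x powr (1/2))) x))"
    using amplitude[OF c1] by (elim exE conjE)
  define CA where "CA = max CA0 Cs"
  have CA: "1 \<le> CA" "CA0 \<le> CA" "Cs \<le> CA" using CA0 by (auto simp: CA_def)
  \<comment> \<open>\<open>B\<close> reproduces itself, since N2 + 32 A \<mu>3 is at most (96 + 32)
    A \<mu>3. In \<open>R0\<close>, the 12 makes each of three errors at most d / (12 K), 32 comes
    from \<open>step_bounds\<close>, and 129 = 128 + 1 from N0 and A l.\<close>
  define B where "B = 128 * CA"
  define R0 where "R0 = 12 * 32 * 129 * CA\<^sup>2"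
  have CA2: "CA \<le> CA\<^sup>2" using CA by (simp add: power2_eq_square)
  have R0: "1 \<le> R0" "32 * Cs \<le> R0" "36 * Cs \<le> R0" "4 \<le> R0" using CA2 CA by (auto simp: R0_def)
  \<comment> \<open>96 = 3 * 32 for three corrugations, 161 as in \<open>wb\<close> below, and 5 for
    the linear part of w.\<close>
  define C where "C = 96 * CA + 96 * 161 * CA\<^sup>2 + 5"
  have C: "1 \<le> C" "96 * CA \<le> C" "96 * 161 * CA\<^sup>2 + 5 \<le> C" using CA CA2 by (auto simp: C_def)
  have main: "\<exists>v' w E. stage_step C d (l * R1 * R * R) v G v' w E \<and> stage_data B d (d / (2 * K)) (l * R1 * R * R) v' E"
    if d: "0 < d" and l: "0 < l" and K: "1 \<le> K" and R1: "R0 * (K * sqrt K) \<le> R1" and R: "R0 * K \<le> R"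
      and data: "stage_data B (K * d) d l v G" for d l K R1 R v G
  proof -
    have sv: "sm 3 v" and v2: "\<And>i j x. cb 1 (B * sqrt (K * d) * l) l (partial j (partial i v)) x"
      and G: "\<And>i j. sm 1 (G i j)" "\<And>i j. G i j = G j i" "\<And>i j x. cb 1 d l (G i j) x"
      using data unfolding stage_data_def by blast+
    \<comment> \<open>The Lipschitz constant 2 d l and the radius 4 e give the oscillation 8 d l e;
      this e turns it into a smoothing error of d / (4 K).\<close>
    define e where "e = 1 / (32 * Cs * K * l)"
    define \<kappa> where "\<kappa> = 1 / e"
    have e: "0 < e" using Cs1 K l by (simp add: e_def)
    have \<kappa>: "\<kappa> = 32 * Cs * K * l" using e by (simp add: \<kappa>_def e_def)
    define Ge where "Ge i j = smoothing e (G i j)" for i j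
    have sGe: "sm 3 (Ge i j)" for i j unfolding Ge_def by (rule sm_smoothing[OF e])
    have Gd: "\<bar>G i j y - G i j x\<bar> \<le> 8 * d * l * e" if "norm (y - x) \<le> 4 * e" for i j x y
    proof -
      have "\<bar>G i j y - G i j x\<bar> \<le> 2 * (d * l) * norm (y - x)"
        using G(1,3) by (intro cb1_lipschitz) auto
      also have "\<dots> \<le> 2 * (d * l) * (4 * e)" using that d l by (intro mult_left_mono) auto
      finally show ?thesis by (simp add: mult_ac)
    qed
    have Gs: "\<bar>Ge i j x - G i j x\<bar> \<le> Cs0 * (8 * d * l * e)"
       "cb 2 (Cs0 * (8 * d * l * e) / e) (1/e) (partial m (Ge i j)) x" for i j x m
      using Cs0(2)[rule_format, OF e, of x "G i j", OF Gd] unfolding Ge_def by blast+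
    have "Cs0 * (8 * d * l * e) \<le> Cs * (8 * d * l * e)"
      using d l e by (intro mult_right_mono) (auto simp: Cs_def)
    also have "\<dots> = d / (4 * K)" using Cs1 K l by (simp add: e_def field_simps)
    finally have s1: "Cs0 * (8 * d * l * e) \<le> d / (4 * K)" .
    have s2: "Cs0 * (8 * d * l * e) / e \<le> 8 * Cs * (d * l)"
      using d l e by (simp add: Cs_def field_simps)
    have Ge_near: "\<bar>Ge i j x - G i j x\<bar> \<le> d / (4 * K)" for i j x using Gs(1)[of i j x] s1 by linarith
    have k0: "0 \<le> \<kappa>" using e by (simp add: \<kappa>_def)
    have dGe: "cb 2 (8 * Cs * (d * l)) \<kappa> (partial m (Ge i j)) x" for i j x m
      using cb_mono[OF Gs(2) s2 _ order_refl] e by (simp add: \<kappa>_def)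
    have "d / (4 * K) \<le> d / 4" using K d by (intro divide_left_mono) auto
    then have Ge_b: "\<bar>Ge i j x\<bar> \<le> 2 * d" for i j x
      using Ge_near[of i j x] cb_bound[OF G(3), of i j x] d by linarith

    \<comment> \<open>Decomposition of a symmetric matrix along e1, e2 and e1 + e2. The entries of
      \<open>Ge\<close> are at most 2 d in modulus, so the shifts 6 d, 6 d and 4 d put all
      coefficients between d and 10 d. The total shift has diagonal entries 10 d and off-diagonal
      entries 4 d.\<close>
    define g1 g2 g3 where "g1 = (\<lambda>x. Ge 1 1 x - Ge 1 2 x + 6 * d)"
      and "g2 = (\<lambda>x. Ge 2 2 x - Ge 1 2 x + 6 * d)" and "g3 = (\<lambda>x. Ge 1 2 x + 4 * d)"
    have range: "d \<le> g1 x \<and> g1 x \<le> 10 * d" "d \<le> g2 x \<and> g2 x \<le> 10 * d" "d \<le> g3 x \<and> g3 x \<le> 10 * d" for x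
      using Ge_b[of 1 1 x] Ge_b[of 1 2 x] Ge_b[of 2 2 x] d unfolding g1_def g2_def g3_def by linarith+
    have sg: "sm 3 g1" "sm 3 g2" "sm 3 g3"
      unfolding g1_def g2_def g3_def by (intro sm_add sm_sub sGe sm_const)+
    have dd: "Ge i j differentiable (at x)" for i j x using sm_diff[OF sGe] by simp
    have pg: "partial i g1 = (\<lambda>x. partial i (Ge 1 1) x - partial i (Ge 1 2) x)"
       "partial i g2 = (\<lambda>x. partial i (Ge 2 2) x - partial i (Ge 1 2) x)"
       "partial i g3 = partial i (Ge 1 2)" for i
      unfolding g1_def g2_def g3_def
      by (auto simp: fun_eq_iff partial_add partial_diff dd)
    have sG2: "sm 2 (partial m (Ge i j))" for i j m by (rule sm_partial_numeral(1)[OF sGe])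
    have cc: "c * d * l = 8 * Cs * (d * l) + 8 * Cs * (d * l)" by (simp add: c_def)
    have dg: "cb 2 (c * d * l) \<kappa> (partial i g1) x" "cb 2 (c * d * l) \<kappa> (partial i g2) x"
      "cb 2 (c * d * l) \<kappa> (partial i g3) x" for i x
    proof -
      show "cb 2 (c * d * l) \<kappa> (partial i g1) x" "cb 2 (c * d * l) \<kappa> (partial i g2) x"
        unfolding pg cc by (rule cb_sub[OF sG2 sG2 dGe dGe])+
      show "cb 2 (c * d * l) \<kappa> (partial i g3) x"
        unfolding pg cc using Cs1 d l by (intro cb_mono[OF dGe _ k0 order_refl]) simp
    qed
    have ck: "c * l \<le> \<kappa>" using K Cs1 l unfolding c_def \<kappa> by (simp add: mult_ac)
    define A where "A = CA * sqrt d"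
    have A0: "0 < A" using CA d by (simp add: A_def)
    have AA: "A * A = CA\<^sup>2 * d" using d by (simp add: A_def power2_eq_square)
    define a where "a = (\<lambda>g (x::real^2). g x powr (1/2::real))"
    have a: "sm 3 (a g)" "cb 3 A \<kappa> (a g) x" "cb 2 (A * l) \<kappa> (partial i (a g)) x" "a g x * a g x = g x"
      if "g \<in> {g1, g2, g3}" for g x i
    proof -
      have r: "\<forall>x. d \<le> g x \<and> g x \<le> 10 * d" and sgg: "sm 3 g" and dgg: "\<forall>i x. cb 2 (c * d * l) \<kappa> (partial i g) x"
        using that range sg dg by auto
      have pos: "0 < g y" for y using r d by (meson less_le_trans)
      show "sm 3 (a g)" unfolding a_def by (rule sm_powr[OF pos sgg])
      have le: "CA0 * sqrt d \<le> A" "CA0 * sqrt d * l \<le> A * l"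
        using CA d l by (auto simp: A_def intro!: mult_right_mono)
      note * = CA0(2)[rule_format, OF d l ck sgg r[rule_format] dgg[rule_format], of x]
      show "cb 3 A \<kappa> (a g) x" "cb 2 (A * l) \<kappa> (partial i (a g)) x"
        using cb_mono[OF _ le(1) k0 order_refl] cb_mono[OF _ le(2) k0 order_refl] * unfolding a_def by blast+
      show "a g x * a g x = g x" using pos[of x] by (simp add: a_def powr_half_sqrt)
    qed

    define \<mu>1 \<mu>2 \<mu>3 where "\<mu>1 = l * R1" and "\<mu>2 = l * R1 * R" and "\<mu>3 = l * R1 * R * R"
    have sK: "1 \<le> sqrt K" "sqrt K \<le> K" using K by (auto simp: real_le_rsqrt real_le_lsqrt power2_eq_square)
    have KsK: "K \<le> K * sqrt K" "sqrt K \<le> K * sqrt K" "1 \<le> K * sqrt K"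
      using K sK mult_mono[of 1 K 1 "sqrt K"] by (auto simp: mult_le_cancel_left1)
    have "R0 \<le> R0 * K" using R0 K by simp
    have Rge: "1 \<le> R" using R0(1) \<open>R0 \<le> R0 * K\<close> R by linarith
    have R0KK: "R0 * K \<le> R0 * (K * sqrt K)" "R0 * sqrt K \<le> R0 * (K * sqrt K)"
      using R0 KsK by (auto intro!: mult_left_mono)
    have R1ge: "1 \<le> R1" "R0 * K \<le> R1" "R0 * sqrt K \<le> R1" using \<open>R0 \<le> R0 * K\<close> R0(1) R0KK R1 by linarith+
    have \<mu>1: "l \<le> \<mu>1" "0 < \<mu>1" using l R1ge by (auto simp: \<mu>1_def)
    have \<mu>2: "\<mu>1 \<le> \<mu>2" "0 < \<mu>2" using \<mu>1 Rge mult_left_mono[OF Rge, of \<mu>1] by (auto simp: \<mu>1_def \<mu>2_def)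
    have \<mu>3: "\<mu>2 \<le> \<mu>3" "0 < \<mu>3" using \<mu>2 Rge mult_left_mono[OF Rge, of \<mu>2] by (auto simp: \<mu>3_def \<mu>2_def)
    have "32 * Cs * K * l \<le> R0 * K * l" using R0 K l by (intro mult_right_mono) auto
    also have "\<dots> \<le> R1 * l" using R1ge l by (intro mult_right_mono) auto
    finally have \<kappa>\<mu>: "\<kappa> \<le> \<mu>1" by (simp add: \<kappa> \<mu>1_def mult_ac)
    define \<xi>1 \<xi>2 \<xi>3 :: "real^2" where "\<xi>1 = vector [1, 0]" and "\<xi>2 = vector [0, 1]" and "\<xi>3 = vector [1, 1]"
    have \<xi>: "\<bar>\<xi>1 $ i\<bar> \<le> 1" "\<bar>\<xi>2 $ i\<bar> \<le> 1" "\<bar>\<xi>3 $ i\<bar> \<le> 1" for i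
      using exhaust_2[of i] by (auto simp: \<xi>1_def \<xi>2_def \<xi>3_def)
    define v1 v2 v3 where "v1 = step_v \<mu>1 \<xi>1 (a g1) v" and "v2 = step_v \<mu>2 \<xi>2 (a g2) v1"
      and "v3 = step_v \<mu>3 \<xi>3 (a g3) v2"
    have g123: "g1 \<in> {g1,g2,g3}" "g2 \<in> {g1,g2,g3}" "g3 \<in> {g1,g2,g3}" by auto
    have sv123: "sm 3 v1" "sm 3 v2" "sm 3 v3"
      unfolding v1_def v2_def v3_def by (intro sm_step_v sv a g123)+
    \<comment> \<open>Bounds on the second derivatives before each corrugation; a corrugation adds
      32 A times its frequency.\<close>
    define N0 N1 N2 where "N0 = B * sqrt (K * d) * l" and "N1 = N0 + 32 * A * \<mu>1" and "N2 = N1 + 32 * A * \<mu>2"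
    have N0: "N0 = 128 * A * (sqrt K * l)" by (simp add: N0_def B_def A_def real_sqrt_mult)
    have N00: "0 \<le> N0" unfolding N0 using A0 K l by simp
    have "4 * sqrt K \<le> R0 * sqrt K" using R0 K by (intro mult_right_mono) auto
    then have "4 * sqrt K \<le> R1" using R1ge by linarith
    then have "4 * (sqrt K * l) \<le> \<mu>1" using mult_right_mono[of "4 * sqrt K" R1 l] l by (simp add: \<mu>1_def mult_ac)
    from mult_left_mono[OF this, of "32 * A"] A0 have N0\<mu>: "N0 \<le> 32 * A * \<mu>1" unfolding N0 by simp
    have A\<mu>: "32 * A * \<mu>1 \<le> 32 * A * \<mu>2" "32 * A * \<mu>2 \<le> 32 * A * \<mu>3" using A0 \<mu>2 \<mu>3 by auto
    have N1\<mu>: "N1 \<le> 64 * A * \<mu>1" using N0\<mu> by (simp add: N1_def)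
    have N2\<mu>: "N2 \<le> 96 * A * \<mu>2" using N0\<mu> A\<mu> by (simp add: N1_def N2_def)
    have h0: "cb 1 N0 \<mu>1 (partial j (partial i v)) x" for i j x
      using cb_mono[OF v2 order_refl _ \<mu>1(1)] l by (simp add: N0_def)
    note s1 = step_bounds[OF sv a(1)[OF g123(1)] \<xi>(1) \<mu>1(2) k0 \<kappa>\<mu> less_imp_le[OF l] \<mu>1(1) a(2)[OF g123(1)] a(3)[OF g123(1)] h0, folded v1_def N1_def]
    have h1: "cb 1 N1 \<mu>2 (partial j (partial i v1)) x" for i j x
      using cb_mono[OF s1(1) order_refl _ \<mu>2(1)] \<mu>1 by simp
    have \<kappa>2: "\<kappa> \<le> \<mu>2" "l \<le> \<mu>2" using \<kappa>\<mu> \<mu>1 \<mu>2 by auto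
    note s2 = step_bounds[OF sv123(1) a(1)[OF g123(2)] \<xi>(2) \<mu>2(2) k0 \<kappa>2(1) less_imp_le[OF l] \<kappa>2(2) a(2)[OF g123(2)] a(3)[OF g123(2)] h1, folded v2_def N2_def]
    have h2: "cb 1 N2 \<mu>3 (partial j (partial i v2)) x" for i j x
      using cb_mono[OF s2(1) order_refl _ \<mu>3(1)] \<mu>2 by simp
    have \<kappa>3: "\<kappa> \<le> \<mu>3" "l \<le> \<mu>3" using \<kappa>2 \<mu>3 by auto
    note s3 = step_bounds[OF sv123(2) a(1)[OF g123(3)] \<xi>(3) \<mu>3(2) k0 \<kappa>3(1) less_imp_le[OF l] \<kappa>3(2) a(2)[OF g123(3)] a(3)[OF g123(3)] h2, folded v3_def]

    define w1 w2 w3 where "w1 = step_w \<mu>1 \<xi>1 (a g1) v" and "w2 = step_w \<mu>2 \<xi>2 (a g2) v1" and "w3 = step_w \<mu>3 \<xi>3 (a g3) v2"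
    \<comment> \<open>The rows of -1/2 times the shift matrix, so that twice the symmetric gradient
      of \<open>lin\<close> cancels the shift.\<close>
    define L1 L2 where "L1 i = (if i = (1::2) then - 5 * d else - 2 * d)" and "L2 i = (if i = (1::2) then - 2 * d else - 5 * d)" for i
    define lin where "lin i x = L1 i * x $ 1 + L2 i * x $ 2" for i and x :: "real^2"
    have slin: "sm n (lin i)" for n i unfolding lin_def[abs_def] by (intro sm_add sm_cmult sm_coord)
    have plin: "partial j (lin i) = (\<lambda>x. if j = 1 then L1 i else L2 i)" for i j
    proof
      fix x :: "real^2"
      have dc: "(\<lambda>x::real^2. x $ k) differentiable (at x)" for k
        using sm_diff[OF sm_coord[of 1]] by simp
      show "partial j (lin i) x = (if j = 1 then L1 i else L2 i)"
        unfolding lin_def[abs_def] using exhaust_2[of j]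
        by (auto simp: partial_add partial_cmult partial_coord dc differentiable_mult)
    qed
    define w where "w i x = w1 i x + w2 i x + w3 i x + lin i x" for i x
    have two: "sm (Suc 2) v" "sm (Suc 2) v1" "sm (Suc 2) v2" using sv sv123 by (simp_all add: eval_nat_numeral)
    have a2: "sm 2 (a g)" if "g \<in> {g1,g2,g3}" for g by (rule sm_le[OF a(1)[OF that]]) simp
    have sw: "sm 2 (w1 i)" "sm 2 (w2 i)" "sm 2 (w3 i)" for i
      unfolding w1_def w2_def w3_def by (intro sm_step_w two a2 g123)+
    have sww: "sm 2 (w i)" for i unfolding w_def[abs_def] by (intro sm_add sw slin)
    have dw: "w1 i differentiable (at x)" "w2 i differentiable (at x)" "w3 i differentiable (at x)" "lin i differentiable (at x)" for i x
      using sm_diff[OF sw(1)] sm_diff[OF sw(2)] sm_diff[OF sw(3)] sm_diff[OF slin[of 1]] by auto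
    have pw: "partial j (w i) = (\<lambda>x. partial j (w1 i) x + partial j (w2 i) x + partial j (w3 i) x + partial j (lin i) x)" for i j
      unfolding w_def[abs_def] by (intro ext) (simp add: partial_add dw)
    have sw1: "sm 1 (partial j (w1 i))" "sm 1 (partial j (w2 i))" "sm 1 (partial j (w3 i))" "sm 1 (partial j (lin i))" for i j
      using sm_partial_numeral(2)[OF sw(1)] sm_partial_numeral(2)[OF sw(2)] sm_partial_numeral(2)[OF sw(3)] sm_partial_numeral(2)[OF slin] by auto

    define E1 E2 E3 where "E1 = step_err \<mu>1 \<xi>1 (a g1) v" and "E2 = step_err \<mu>2 \<xi>2 (a g2) v1" and "E3 = step_err \<mu>3 \<xi>3 (a g3) v2"
    \<comment> \<open>The budget is d / (4 K) for the smoothing and d / (12 K) for each corrugation,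
      in all d / (2 K).\<close>
    define E where "E i j x = (G i j x - Ge i j x) + (E1 i j x + E2 i j x + E3 i j x)" for i j x
    have one: "sm (Suc (Suc 1)) v" "sm (Suc (Suc 1)) v1" "sm (Suc (Suc 1)) v2" using sv sv123 by (simp_all add: eval_nat_numeral)
    have a2': "sm (Suc 1) (a g)" if "g \<in> {g1,g2,g3}" for g using a2[OF that] by (simp add: eval_nat_numeral)
    have sE: "sm 1 (E1 i j)" "sm 1 (E2 i j)" "sm 1 (E3 i j)" for i j
      unfolding E1_def E2_def E3_def by (intro sm_step_err one a2' g123)+
    have sGe1: "sm 1 (Ge i j)" for i j by (rule sm_le[OF sGe]) simp
    have sEE: "sm 1 (E i j)" for i j unfolding E_def[abs_def] by (intro sm_add sm_sub sE G(1) sGe1)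
    have symE: "E i j = E j i" for i j
      unfolding E_def[abs_def] E1_def E2_def E3_def Ge_def
      by (subst (1 2 3) step_err_sym, subst (1 2) G(2)) (rule refl)
    have eb0: "cb 1 (d / (4 * K)) \<mu>3 (\<lambda>x. G i j x - Ge i j x) x" for i j x
    proof (rule cb_numeralI(3))
      show "\<bar>G i j x - Ge i j x\<bar> \<le> d / (4 * K)" using Ge_near[of i j x] by (simp add: abs_minus_commute)
      fix m
      have "partial m (\<lambda>x. G i j x - Ge i j x) x = partial m (G i j) x - partial m (Ge i j) x"
        using G(1)[of i j] dd by (intro partial_diff) auto
      moreover have "\<bar>partial m (G i j) x\<bar> \<le> d * l" using G(3)[of i j x] by auto
      moreover have "\<bar>partial m (Ge i j) x\<bar> \<le> 8 * Cs * (d * l)" by (rule cb_bound[OF dGe])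
      moreover have "d * l \<le> Cs * (d * l)" using Cs1 d l by simp
      ultimately have "\<bar>partial m (\<lambda>x. G i j x - Ge i j x) x\<bar> \<le> 9 * Cs * (d * l)" by linarith
      \<comment> \<open>The gradient of the smoothing error is not small in itself, only relative to
        \<mu>3, because the frequency jump exceeds 36 Cs K.\<close>
      also have "9 * Cs * (d * l) = d / (4 * K) * (36 * Cs * K * l)" using K by simp
      also have "\<dots> \<le> d / (4 * K) * \<mu>3"
      proof (intro mult_left_mono)
        have "36 * Cs * K * l \<le> R0 * K * l" using R0 K l by (intro mult_right_mono) auto
        also have "\<dots> \<le> \<mu>1" using R1ge l by (simp add: \<mu>1_def mult_ac)
        finally show "36 * Cs * K * l \<le> \<mu>3" using \<mu>2 \<mu>3 by linarith
      qed (use d K in auto)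
      finally show "\<bar>partial m (\<lambda>x. G i j x - Ge i j x) x\<bar> \<le> d / (4 * K) * \<mu>3" .
    qed
    have small: "32 * (129 * (A * A) * (X / Y)) \<le> d / (12 * K)" if XY: "R0 * K * X \<le> Y" "0 < Y" for X Y
    proof -
      have "32 * (129 * (A * A) * (X / Y)) * (12 * K) = d * (R0 * K * X / Y)"
        unfolding AA R0_def by (simp add: field_simps)
      also have "\<dots> \<le> d * 1" using XY d by (intro mult_left_mono) auto
      finally show ?thesis using K by (simp add: field_simps)
    qed
    have l\<mu>: "l / \<mu>1 \<le> (sqrt K * l) / \<mu>1" "l / \<mu>2 \<le> \<mu>1 / \<mu>2" "l / \<mu>3 \<le> \<mu>2 / \<mu>3"
      using sK l \<mu>1 \<mu>2 \<mu>3 by (auto intro!: divide_right_mono)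
    have n1: "32 * (A * (N0 / \<mu>1 + A * l / \<mu>1)) \<le> d / (12 * K)"
    proof -
      have "A * (N0 / \<mu>1 + A * l / \<mu>1) = 128 * (A * A) * ((sqrt K * l) / \<mu>1) + A * A * (l / \<mu>1)"
        unfolding N0 by (simp add: algebra_simps)
      also have "\<dots> \<le> 129 * (A * A) * ((sqrt K * l) / \<mu>1)"
        using mult_left_mono[OF l\<mu>(1), of "A * A"] A0 by simp
      finally have "32 * (A * (N0 / \<mu>1 + A * l / \<mu>1)) \<le> 32 * (129 * (A * A) * ((sqrt K * l) / \<mu>1))" by simp
      also have "\<dots> \<le> d / (12 * K)"
      proof (rule small)
        show "R0 * K * (sqrt K * l) \<le> \<mu>1" using mult_right_mono[OF R1, of l] l by (simp add: \<mu>1_def mult_ac)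
      qed (rule \<mu>1)
      finally show ?thesis .
    qed
    have R\<mu>: "R0 * K * \<mu>1 \<le> \<mu>2" "R0 * K * \<mu>2 \<le> \<mu>3"
      using mult_right_mono[OF R, of \<mu>1] mult_right_mono[OF R, of \<mu>2] \<mu>1 \<mu>2
      by (auto simp: \<mu>1_def \<mu>2_def \<mu>3_def mult_ac)
    have n23: "32 * (A * (N / Y + A * l / Y)) \<le> d / (12 * K)"
      if "N \<le> 96 * A * X" "R0 * K * X \<le> Y" "0 < Y" "l / Y \<le> X / Y" "0 \<le> X" for N X Y
    proof -
      have "A * (N / Y) \<le> A * (96 * A * X / Y)"
        using that A0 by (intro mult_left_mono divide_right_mono) auto
      then have "A * (N / Y + A * l / Y) \<le> 96 * (A * A) * (X / Y) + A * A * (l / Y)"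
        by (simp add: distrib_left mult_ac)
      also have "\<dots> \<le> 129 * (A * A) * (X / Y)"
      proof -
        have "0 \<le> A * A * (X / Y)" using that A0 by simp
        then show ?thesis using mult_left_mono[OF that(4), of "A * A"] A0 by simp
      qed
      finally have "32 * (A * (N / Y + A * l / Y)) \<le> 32 * (129 * (A * A) * (X / Y))" by simp
      also have "\<dots> \<le> d / (12 * K)" by (rule small[OF that(2,3)])
      finally show ?thesis .
    qed
    have "64 * A * \<mu>1 \<le> 96 * A * \<mu>1" using A0 \<mu>1 by simp
    then have n2: "32 * (A * (N1 / \<mu>2 + A * l / \<mu>2)) \<le> d / (12 * K)"
      using N1\<mu> \<mu>1 by (intro n23[OF _ R\<mu>(1) \<mu>2(2) l\<mu>(2)]) auto
    have n3: "32 * (A * (N2 / \<mu>3 + A * l / \<mu>3)) \<le> d / (12 * K)"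
      using N2\<mu> \<mu>2 by (intro n23[OF _ R\<mu>(2) \<mu>3(2) l\<mu>(3)]) auto
    have \<mu>13: "\<mu>1 \<le> \<mu>3" using \<mu>2 \<mu>3 by linarith
    have eb1: "cb 1 (d / (12 * K)) \<mu>3 (E1 i j) x" for i j x
      unfolding E1_def by (rule cb_mono[OF s1(4) n1 less_imp_le[OF \<mu>1(2)] \<mu>13])
    have eb2: "cb 1 (d / (12 * K)) \<mu>3 (E2 i j) x" for i j x
      unfolding E2_def by (rule cb_mono[OF s2(4) n2 less_imp_le[OF \<mu>2(2)] \<mu>3(1)])
    have eb3: "cb 1 (d / (12 * K)) \<mu>3 (E3 i j) x" for i j x
      unfolding E3_def by (rule cb_mono[OF s3(4) n3 less_imp_le[OF \<mu>3(2)] order_refl])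
    have "cb 1 (d / (4 * K) + (d / (12 * K) + d / (12 * K) + d / (12 * K))) \<mu>3 (E i j) x" for i j x
      unfolding E_def[abs_def] by (intro cb_add eb0 eb1 eb2 eb3 sm_add sm_sub sE G(1) sGe1)
    moreover have "d / (4 * K) + (d / (12 * K) + d / (12 * K) + d / (12 * K)) = d / (2 * K)"
      using K by (simp add: field_simps)
    ultimately have cbE: "cb 1 (d / (2 * K)) \<mu>3 (E i j) x" for i j x by simp

    have cv3: "cb 1 (B * sqrt d * \<mu>3) \<mu>3 (partial j (partial i v3)) x" for i j x
    proof -
      have "N2 + 32 * A * \<mu>3 \<le> 128 * A * \<mu>3" using N2\<mu> A\<mu> by linarith
      then have "N2 + 32 * A * \<mu>3 \<le> B * sqrt d * \<mu>3" by (simp add: B_def A_def)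
      from cb_mono[OF s3(1) this less_imp_le[OF \<mu>3(2)] order_refl] show ?thesis .
    qed
    have data': "stage_data B d (d / (2 * K)) \<mu>3 v3 E"
      unfolding stage_data_def using sv123 cv3 sEE cbE symE by blast

    have v1v: "\<bar>partial i v1 x\<bar> \<le> \<bar>partial i v x\<bar> + 32 * A" and v2v: "\<bar>partial i v2 x\<bar> \<le> \<bar>partial i v x\<bar> + 64 * A"
      and v3v: "\<bar>partial i v3 x - partial i v x\<bar> \<le> 96 * A" for i x
      using s1(2)[of i x] s2(2)[of i x] s3(2)[of i x] by linarith+
    have N\<mu>: "N0 / \<mu>1 \<le> 96 * A" "N1 / \<mu>2 \<le> 96 * A" "N2 / \<mu>3 \<le> 96 * A"
    proof -
      have "0 \<le> A * \<mu>1" "0 \<le> A * \<mu>2" "0 \<le> A * \<mu>3" using A0 \<mu>1(2) \<mu>2(2) \<mu>3(2) by simp_all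
      then have "N0 \<le> 96 * A * \<mu>1" "N1 \<le> 96 * A * \<mu>2" "N2 \<le> 96 * A * \<mu>3"
        using N0\<mu> N1\<mu> N2\<mu> A\<mu> by linarith+
      then show "N0 / \<mu>1 \<le> 96 * A" "N1 / \<mu>2 \<le> 96 * A" "N2 / \<mu>3 \<le> 96 * A"
        using \<mu>1(2) \<mu>2(2) \<mu>3(2) by (simp_all add: pos_divide_le_eq)
    qed
    \<comment> \<open>161 = 64 + 96 + 1: the growth of the gradient under two corrugations, the
      second derivatives divided by the frequency, and the amplitude itself.\<close>
    have wb: "cb 1 (32 * (A * (\<bar>partial i v x\<bar> + 161 * A))) \<mu>3 f x"
      if "cb 1 (32 * (A * (p + n + A))) \<mu> f x" "p \<le> \<bar>partial i v x\<bar> + 64 * A" "n \<le> 96 * A" "0 < \<mu>" "\<mu> \<le> \<mu>3" for i x p n \<mu> f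
    proof (rule cb_mono[OF that(1)])
      show "32 * (A * (p + n + A)) \<le> 32 * (A * (\<bar>partial i v x\<bar> + 161 * A))"
        using that A0 by (intro mult_left_mono) auto
    qed (use that in auto)
    have wb1: "cb 1 (32 * (A * (\<bar>partial i v x\<bar> + 161 * A))) \<mu>3 (partial j (w1 i)) x" for i j x
      unfolding w1_def by (rule wb[OF s1(3) _ N\<mu>(1) \<mu>1(2) \<mu>13]) (use A0 in auto)
    have wb2: "cb 1 (32 * (A * (\<bar>partial i v x\<bar> + 161 * A))) \<mu>3 (partial j (w2 i)) x" for i j x
      unfolding w2_def by (rule wb[OF s2(3) _ N\<mu>(2) \<mu>2(2) \<mu>3(1)]) (use v1v[of i x] A0 in linarith)
    have wb3: "cb 1 (32 * (A * (\<bar>partial i v x\<bar> + 161 * A))) \<mu>3 (partial j (w3 i)) x" for i j x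
      unfolding w3_def by (rule wb[OF s3(3) v2v N\<mu>(3) \<mu>3(2) order_refl])
    have wb4: "cb 1 (5 * d) \<mu>3 (partial j (lin i)) x" for i j x
      unfolding plin by (rule cb_const) (use d \<mu>3 in \<open>auto simp: L1_def L2_def\<close>)
    have cw: "cb 1 (C * (sqrt d * \<bar>partial i v x\<bar> + d)) \<mu>3 (partial j (w i)) x" for i j x
    proof -
      let ?p = "\<bar>partial i v x\<bar>"
      have e1: "cb 1 (32 * (A * (?p + 161 * A)) + 32 * (A * (?p + 161 * A)) + 32 * (A * (?p + 161 * A)) + 5 * d) \<mu>3 (partial j (w i)) x"
        unfolding pw by (intro cb_add sm_add sw1 wb1 wb2 wb3 wb4)
      have e2: "32 * (A * (?p + 161 * A)) + 32 * (A * (?p + 161 * A)) + 32 * (A * (?p + 161 * A)) + 5 * d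
         = (96 * CA) * (sqrt d * ?p) + 96 * 161 * (A * A) + 5 * d"
        unfolding A_def by (simp add: algebra_simps)
      have e3: "96 * 161 * (A * A) + 5 * d = (96 * 161 * CA\<^sup>2 + 5) * d"
        unfolding AA by (simp add: algebra_simps)
      have e4: "(96 * CA) * (sqrt d * ?p) + (96 * 161 * CA\<^sup>2 + 5) * d \<le> C * (sqrt d * ?p) + C * d"
        using C d by (intro add_mono mult_right_mono) auto
      have e5: "C * (sqrt d * ?p + d) = C * (sqrt d * ?p) + C * d" by (rule distrib_left)
      have "32 * (A * (?p + 161 * A)) + 32 * (A * (?p + 161 * A)) + 32 * (A * (?p + 161 * A)) + 5 * d
        \<le> C * (sqrt d * ?p + d)" unfolding e2 e5 using e3 e4 by linarith
      from cb_mono[OF e1 this less_imp_le[OF \<mu>3(2)] order_refl] show ?thesis .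
    qed
    have "96 * A \<le> C * sqrt d" unfolding A_def using mult_right_mono[OF C(2), of "sqrt d"] d by simp
    then have cv: "\<bar>partial i v3 x - partial i v x\<bar> \<le> C * sqrt d" for i x using v3v[of i x] by linarith
    have sm2: "sm 2 v" "sm 2 v1" "sm 2 v2" using sm_le[OF sv] sm_le[OF sv123(1)] sm_le[OF sv123(2)] by auto
    have sm1: "sm 1 (a g)" if "g \<in> {g1,g2,g3}" for g by (rule sm_le[OF a(1)[OF that]]) simp
    have id: "partial i v3 x * partial j v3 x + partial j (w i) x + partial i (w j) x
      = partial i v x * partial j v x + G i j x - E i j x" for i j x
    proof -
      have i1: "partial i v1 x * partial j v1 x + partial j (w1 i) x + partial i (w1 j) x
        = partial i v x * partial j v x + g1 x * (\<xi>1 $ i * \<xi>1 $ j) - E1 i j x"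
        using step_identity[OF sm2(1) sm1[OF g123(1)], of \<mu>1 i \<xi>1 x j] \<mu>1
        unfolding v1_def[symmetric] w1_def[symmetric] E1_def[symmetric] a(4)[OF g123(1)] by simp
      have i2: "partial i v2 x * partial j v2 x + partial j (w2 i) x + partial i (w2 j) x
        = partial i v1 x * partial j v1 x + g2 x * (\<xi>2 $ i * \<xi>2 $ j) - E2 i j x"
        using step_identity[OF sm2(2) sm1[OF g123(2)], of \<mu>2 i \<xi>2 x j] \<mu>2
        unfolding v2_def[symmetric] w2_def[symmetric] E2_def[symmetric] a(4)[OF g123(2)] by simp
      have i3: "partial i v3 x * partial j v3 x + partial j (w3 i) x + partial i (w3 j) x
        = partial i v2 x * partial j v2 x + g3 x * (\<xi>3 $ i * \<xi>3 $ j) - E3 i j x"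
        using step_identity[OF sm2(3) sm1[OF g123(3)], of \<mu>3 i \<xi>3 x j] \<mu>3
        unfolding v3_def[symmetric] w3_def[symmetric] E3_def[symmetric] a(4)[OF g123(3)] by simp
      have i4: "g1 x * (\<xi>1 $ i * \<xi>1 $ j) + g2 x * (\<xi>2 $ i * \<xi>2 $ j) + g3 x * (\<xi>3 $ i * \<xi>3 $ j)
        + partial j (lin i) x + partial i (lin j) x = Ge i j x"
        unfolding plin \<xi>1_def \<xi>2_def \<xi>3_def L1_def L2_def g1_def g2_def g3_def
        using exhaust_2[of i] exhaust_2[of j] G(2)[of 2 1] by (auto simp: Ge_def)
      show ?thesis using i1 i2 i3 i4 unfolding pw E_def by linarith
    qed
    have "stage_step C d \<mu>3 v G v3 w E"
      unfolding stage_step_def using sww cw cv id by blast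
    with data' show ?thesis unfolding \<mu>3_def by blast
  qed
  have B1: "1 \<le> B" using CA by (simp add: B_def)
  show ?thesis
    by (rule exI[of _ B], rule conjI[OF B1], rule exI[of _ R0], rule conjI[OF R0(1)], rule exI[of _ C], rule conjI[OF C(1)])
      (intro allI impI main)
qed

section \<open>Iteration and limit\<close>

lemma geometric_steps:
  fixes a :: "nat \<Rightarrow> real"
  assumes "\<And>q. \<bar>a (Suc q) - a q\<bar> \<le> A * r ^ q" "0 \<le> r" "r < 1" "0 \<le> A"
  shows "convergent a" and "\<And>q. \<bar>a q - a 0\<bar> \<le> A / (1 - r)" and "\<And>q. \<bar>a q - lim a\<bar> \<le> A * r ^ q / (1 - r)"
proof -
  have s: "summable (\<lambda>q. A * r ^ q)" using assms by (intro summable_mult summable_geometric) auto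
  have sh: "\<bar>a (q + n) - a q\<bar> \<le> A * r ^ q / (1 - r)" for q n
  proof -
    have "a (q + n) - a q = (\<Sum>k<n. a (Suc (q + k)) - a (q + k))"
      using sum_lessThan_telescope[of "\<lambda>k. a (q + k)" n] by simp
    also have "\<bar>\<dots>\<bar> \<le> (\<Sum>k<n. A * r ^ (q + k))"
      by (rule order_trans[OF sum_abs sum_mono[OF assms(1)]])
    also have "\<dots> = A * r ^ q * (\<Sum>k<n. r ^ k)" by (simp add: sum_distrib_left power_add mult.assoc)
    also have "(\<Sum>k<n. r ^ k) = (1 - r ^ n) / (1 - r)" using assms by (simp add: sum_gp_strict)
    also have "A * r ^ q * ((1 - r ^ n) / (1 - r)) \<le> A * r ^ q * (1 / (1 - r))"
      using assms by (intro mult_left_mono divide_right_mono) auto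
    finally show ?thesis by simp
  qed
  have "summable (\<lambda>q. a (Suc q) - a q)"
    by (rule summable_comparison_test'[OF s]) (use assms in auto)
  then have "(\<lambda>n. a 0 + (\<Sum>q<n. a (Suc q) - a q)) \<longlonglongrightarrow> a 0 + (\<Sum>q. a (Suc q) - a q)"
    by (intro tendsto_intros summable_LIMSEQ)
  then show c: "convergent a" by (auto simp: sum_lessThan_telescope convergent_def)
  show "\<bar>a q - a 0\<bar> \<le> A / (1 - r)" for q using sh[of 0 q] by simp
  show "\<bar>a q - lim a\<bar> \<le> A * r ^ q / (1 - r)" for q
  proof -
    have "(\<lambda>n. a (n + q)) \<longlonglongrightarrow> lim a"
      using c by (simp add: LIMSEQ_ignore_initial_segment convergent_LIMSEQ_iff)
    then have "(\<lambda>n. \<bar>a (n + q) - a q\<bar>) \<longlonglongrightarrow> \<bar>lim a - a q\<bar>" by (intro tendsto_intros)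
    then have "\<bar>lim a - a q\<bar> \<le> A * r ^ q / (1 - r)"
      by (rule LIMSEQ_le_const2) (use sh[of q] in \<open>auto simp: add.commute\<close>)
    then show ?thesis by (simp add: abs_minus_commute)
  qed
qed

lemma min_le_powr: "0 \<le> t \<Longrightarrow> 0 \<le> a \<Longrightarrow> a \<le> 1 \<Longrightarrow> min 1 t \<le> t powr (a::real)"
proof (cases "t \<le> 1")
  case True
  assume "0 \<le> t" "0 \<le> a" "a \<le> 1"
  then have "t powr 1 \<le> t powr a" using True by (intro powr_mono')
  then show ?thesis using True \<open>0 \<le> t\<close> by simp
qed (auto simp: ge_one_powr_ge_zero)

text \<open>Interpolation: consecutive gradients differ by at most A r^q, and this difference has a
  Lipschitz constant of order A B (r \<Lambda>)^q. Its a-Hoelder seminorm is then of order (r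
  \<Lambda> powr a)^q, which is summable. Only the distance to the initial gradient is estimated, as
  the regularity of \<open>u 0\<close> comes from elsewhere.\<close>

lemma holder_limit:
  fixes u :: "nat \<Rightarrow> real^2 \<Rightarrow> real"
  assumes sm: "\<And>q. sm 2 (u q)"
    and d1: "\<And>q i x. \<bar>partial i (u (Suc q)) x - partial i (u q) x\<bar> \<le> A * r ^ q"
    and d2: "\<And>q i j x. \<bar>partial j (partial i (u (Suc q))) x - partial j (partial i (u q)) x\<bar> \<le> A * r ^ q * (B * \<Lambda> ^ q)"
    and r: "0 < r" "r < 1" and A: "0 \<le> A" and L: "0 < B" "0 < \<Lambda>" and a: "0 < a" "a \<le> 1" and ra: "r * \<Lambda> powr a < 1"
  shows "\<exists>U. (\<forall>x. U differentiable (at x)) \<and> (\<forall>i x. (\<lambda>q. partial i (u q) x) \<longlonglongrightarrow> partial i U x) \<and>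
    (\<exists>Q. \<forall>i x y. \<bar>(partial i U x - partial i (u 0) x) - (partial i U y - partial i (u 0) y)\<bar> \<le> Q * norm (x - y) powr a)"
proof -
  note g = geometric_steps[of "\<lambda>q. partial i (u q) x" A r for i x, OF d1 less_imp_le[OF r(1)] r(2) A]
  define D where "D i x = lim (\<lambda>q. partial i (u q) x)" for i x
  have D: "(\<lambda>q. partial i (u q) x) \<longlonglongrightarrow> D i x" for i x
    unfolding D_def using g(1) by (simp add: convergent_LIMSEQ_iff)
  have Du: "\<bar>partial i (u q) x - D i x\<bar> \<le> A * r ^ q / (1 - r)" for q i x
    unfolding D_def by (rule g(3))
  have du: "u q differentiable (at x)" for q x using sm_diff[OF sm] by simp
  \<comment> \<open>Only the gradients are known to converge. Subtracting the value at 0 makes the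
    functions converge as well and leaves the gradients unchanged.\<close>
  have "\<exists>g. \<forall>x\<in>UNIV. (\<lambda>n. u n x - u n 0) \<longlonglongrightarrow> g x \<and>
      (g has_derivative (\<lambda>h. \<Sum>i\<in>UNIV. (h $ i) *\<^sub>R D i x)) (at x within UNIV)"
  proof (rule has_derivative_sequence[OF convex_UNIV])
    show "((\<lambda>x. u n x - u n 0) has_derivative (\<lambda>h. \<Sum>i\<in>UNIV. (h $ i) *\<^sub>R partial i (u n) x)) (at x within UNIV)" for n x
      using has_derivative_diff[OF has_derivative_partial[OF du] has_derivative_const] by simp
    show "(\<lambda>n. u n 0 - u n 0) \<longlonglongrightarrow> 0" by simp
    fix e :: real assume e: "0 < e"
    have "(\<lambda>n. 2 * (A * r ^ n / (1 - r))) \<longlonglongrightarrow> 2 * (A * 0 / (1 - r))"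
      using r by (intro tendsto_intros LIMSEQ_power_zero) auto
    then have "\<forall>\<^sub>F n in sequentially. 2 * (A * r ^ n / (1 - r)) < e"
      by (rule order_tendstoD) (use e in auto)
    then show "\<forall>\<^sub>F n in sequentially. \<forall>x\<in>UNIV. \<forall>h.
       norm ((\<Sum>i\<in>UNIV. (h $ i) *\<^sub>R partial i (u n) x) - (\<Sum>i\<in>UNIV. (h $ i) *\<^sub>R D i x)) \<le> e * norm h"
    proof eventually_elim
      case (elim n)
      show ?case
      proof (intro ballI allI)
        fix x h :: "real^2"
        have c: "\<bar>h $ i * (partial i (u n) x - D i x)\<bar> \<le> norm h * (A * r ^ n / (1 - r))" for i
          unfolding abs_mult by (intro mult_mono component_le_norm_cart Du) auto
        have "norm ((\<Sum>i\<in>UNIV. (h $ i) *\<^sub>R partial i (u n) x) - (\<Sum>i\<in>UNIV. (h $ i) *\<^sub>R D i x))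
          = \<bar>h $ 1 * (partial 1 (u n) x - D 1 x) + h $ 2 * (partial 2 (u n) x - D 2 x)\<bar>"
          by (simp add: sum_2 algebra_simps)
        also have "\<dots> \<le> norm h * (A * r ^ n / (1 - r)) + norm h * (A * r ^ n / (1 - r))"
          by (rule order_trans[OF abs_triangle_ineq add_mono[OF c c]])
        also have "\<dots> = norm h * (2 * (A * r ^ n / (1 - r)))" by simp
        also have "\<dots> \<le> norm h * e" using elim by (intro mult_left_mono) auto
        finally show "norm ((\<Sum>i\<in>UNIV. (h $ i) *\<^sub>R partial i (u n) x) - (\<Sum>i\<in>UNIV. (h $ i) *\<^sub>R D i x)) \<le> e * norm h"
          by (simp add: mult.commute)
      qed
    qed
  qed auto
  then obtain U where U: "\<And>x. (U has_derivative (\<lambda>h. \<Sum>i\<in>UNIV. (h $ i) *\<^sub>R D i x)) (at x)" by auto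
  have pU: "partial i U x = D i x" for i x
    using exhaust_2[of i] by (subst partialI[OF U]) (auto simp: axis_def sum_2)
  define s where "s = r * \<Lambda> powr a"
  have s: "0 \<le> s" "s < 1" using r ra by (auto simp: s_def)
  define Q where "Q = 2 * A * (2 * B) powr a / (1 - s)"
  have "\<bar>(D i x - partial i (u 0) x) - (D i y - partial i (u 0) y)\<bar> \<le> Q * norm (x - y) powr a" for i x y
  proof -
    define b where "b q = partial i (u q) x - partial i (u q) y" for q
    have bs: "\<bar>b (Suc q) - b q\<bar> \<le> (2 * A * (2 * B * norm (x - y)) powr a) * s ^ q" for q
    proof -
      define f where "f = (\<lambda>x. partial i (u (Suc q)) x - partial i (u q) x)"
      have dd: "partial i (u q) differentiable (at x)" for q x using sm_partial_numeral(2)[OF sm] by simp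
      have pf: "partial j f = (\<lambda>x. partial j (partial i (u (Suc q))) x - partial j (partial i (u q)) x)" for j
        unfolding f_def by (intro ext partial_diff dd)
      have fd: "f differentiable (at x)" for x unfolding f_def by (intro differentiable_diff dd)
      have "\<bar>partial j f x\<bar> \<le> A * r ^ q * (B * \<Lambda> ^ q)" for j x unfolding pf by (rule d2)
      from cb1_lipschitz[OF fd this] have 1: "\<bar>f x - f y\<bar> \<le> 2 * (A * r ^ q * (B * \<Lambda> ^ q)) * norm (x - y)" .
      have 2: "\<bar>f x - f y\<bar> \<le> 2 * (A * r ^ q)"
        using d1[of i q x] d1[of i q y] unfolding f_def by linarith
      define t where "t = 2 * B * norm (x - y) * \<Lambda> ^ q"
      have Ar: "0 \<le> A * r ^ q" using A r by simp
      have t0: "0 \<le> t" using L by (simp add: t_def)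
      \<comment> \<open>The better of the trivial bound and the Lipschitz bound is at most their
        geometric interpolation, by \<open>min_le_powr\<close>.\<close>
      have "\<bar>f x - f y\<bar> \<le> (2 * (A * r ^ q)) * min 1 t"
      proof (cases "1 \<le> t")
        case False
        have "2 * (A * r ^ q * (B * \<Lambda> ^ q)) * norm (x - y) = (A * r ^ q) * t" by (simp add: t_def)
        also have "\<dots> \<le> 2 * (A * r ^ q) * t" using Ar t0 by (intro mult_right_mono) auto
        finally show ?thesis using 1 False by (simp add: min_def)
      qed (use 2 in \<open>simp add: min_def\<close>)
      also have "\<dots> \<le> (2 * (A * r ^ q)) * t powr a"
        using a by (intro mult_left_mono[OF min_le_powr[OF t0]] mult_nonneg_nonneg Ar) auto
      also have "t powr a = (2 * B * norm (x - y)) powr a * (\<Lambda> powr a) ^ q"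
        using L unfolding t_def by (simp add: powr_mult powr_power powr_realpow[symmetric] powr_powr mult.commute)
      finally show ?thesis unfolding b_def f_def s_def by (simp add: power_mult_distrib algebra_simps)
    qed
    have nn: "0 \<le> 2 * A * (2 * B * norm (x - y)) powr a" using A by simp
    have bq: "\<bar>b q - b 0\<bar> \<le> 2 * A * (2 * B * norm (x - y)) powr a / (1 - s)" for q
      by (rule geometric_steps(2)[OF bs s nn])
    have "(\<lambda>q. \<bar>b q - b 0\<bar>) \<longlonglongrightarrow> \<bar>(D i x - D i y) - b 0\<bar>"
      unfolding b_def by (intro tendsto_intros D)
    then have "\<bar>(D i x - D i y) - b 0\<bar> \<le> 2 * A * (2 * B * norm (x - y)) powr a / (1 - s)"
      by (rule LIMSEQ_le_const2) (use bq in auto)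
    also have "\<dots> = Q * norm (x - y) powr a"
      using L by (simp add: Q_def powr_mult)
    finally show ?thesis unfolding b_def by (simp add: algebra_simps)
  qed
  then have "\<exists>Q. \<forall>i x y. \<bar>(partial i U x - partial i (u 0) x) - (partial i U y - partial i (u 0) y)\<bar> \<le> Q * norm (x - y) powr a"
    unfolding pU by blast
  moreover have "\<forall>x. U differentiable (at x)" using U by (auto simp: differentiable_def)
  moreover have "\<forall>i x. (\<lambda>q. partial i (u q) x) \<longlonglongrightarrow> partial i U x" unfolding pU using D by blast
  ultimately show ?thesis by blast
qed

section \<open>Choice of the parameters and the iteration on the plane\<close>

lemma ex_scale:
  fixes a b c :: real
  assumes "0 < a" "0 < b"
  shows "\<exists>K\<ge>c. b \<le> K powr a"
proof (intro exI conjI)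
  let ?K = "max c (b powr (1/a))"
  show "c \<le> ?K" by simp
  have "b = (b powr (1/a)) powr a" using assms by (simp add: powr_powr)
  also have "\<dots> \<le> ?K powr a" using assms by (intro powr_mono2) auto
  finally show "b \<le> ?K powr a" .
qed

text \<open>C has to be uniform in the data, whereas the Hoelder constants Q may depend on
  everything. W is an increment only: the given w is already accounted for in the field H that has
  to be added.\<close>

definition flexible ::
  "real \<Rightarrow> real \<Rightarrow> real \<Rightarrow> (real^2 \<Rightarrow> real) \<Rightarrow> (2 \<Rightarrow> 2 \<Rightarrow> real^2 \<Rightarrow> real) \<Rightarrow> (real^2 \<Rightarrow> real) \<Rightarrow> (2 \<Rightarrow> real^2 \<Rightarrow> real) \<Rightarrow> bool"
where
  "flexible C h \<alpha> v0 H v' W \<longleftrightarrow> (\<forall>x. v' differentiable (at x)) \<and> (\<forall>i x. W i differentiable (at x)) \<and>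
    (\<forall>i j x. partial i v' x * partial j v' x + partial j (W i) x + partial i (W j) x
       = partial i v0 x * partial j v0 x + H i j x) \<and>
    (\<forall>i x. \<bar>partial i v' x - partial i v0 x\<bar> \<le> C * sqrt h) \<and>
    (\<forall>i j x. \<bar>partial j (W i) x\<bar> \<le> C * (sqrt h * \<bar>partial i v0 x\<bar> + h)) \<and>
    (\<exists>Q. \<forall>i x y. \<bar>(partial i v' x - partial i v0 x) - (partial i v' y - partial i v0 y)\<bar> \<le> Q * norm (x - y) powr \<alpha>) \<and>
    (\<exists>Q. \<forall>i j x y. \<bar>partial j (W i) x - partial j (W i) y\<bar> \<le> Q * norm (x - y) powr \<alpha>)"

text \<open>The order of the choices is essential: K, \<Lambda> and C come from \<alpha> and
  \<beta>, and the bounds M, L and S of the data enter only the initial frequency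
  \<open>l0\<close>.\<close>

lemma global_flexibility:
  fixes \<alpha> \<beta> :: real
  assumes \<alpha>: "0 < \<alpha>" "\<alpha> < 1/7" "\<alpha> < \<beta>/2" and \<beta>: "\<beta> < 1"
  shows "\<exists>C>0. \<forall>h>0. \<forall>v0 (H :: 2 \<Rightarrow> 2 \<Rightarrow> real^2 \<Rightarrow> real). sm 3 v0 \<longrightarrow> (\<exists>M L. \<forall>x. cb 3 M L v0 x) \<longrightarrow>
    (\<forall>i j. H i j = H j i) \<longrightarrow> (\<forall>i j x. \<bar>H i j x\<bar> \<le> h) \<longrightarrow>
    (\<exists>S. \<forall>i j x y. \<bar>H i j x - H i j y\<bar> \<le> S * norm (x - y) powr \<beta>) \<longrightarrow>
    (\<exists>v' W. flexible C h \<alpha> v0 H v' W)"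
proof -
  obtain B R0 C0 where B: "1 \<le> B" and R0: "1 \<le> R0" and C0: "1 \<le> C0" and
    stage: "\<forall>d>0. \<forall>l>0. \<forall>K\<ge>1. \<forall>R1 R v G. R0 * (K * sqrt K) \<le> R1 \<longrightarrow> R0 * K \<le> R \<longrightarrow>
     stage_data B (K * d) d l v G \<longrightarrow>
     (\<exists>v' w E. stage_step C0 d (l * R1 * R * R) v G v' w E \<and> stage_data B d (d / (2 * K)) (l * R1 * R * R) v' E)"
    using stage by (elim exE conjE)
  obtain Cs where Cs: "Cs > 0" "\<forall>e>0. \<forall>f x m. (\<forall>y. norm (y - x) \<le> 4 * e \<longrightarrow> \<bar>f y - f x\<bar> \<le> m) \<longrightarrow>
     \<bar>smoothing e f x - f x\<bar> \<le> Cs * m \<and> (\<forall>i. cb 2 (Cs * m / e) (1/e) (partial i (smoothing e f)) x)"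
    using smoothing_bound by (elim exE conjE)
  \<comment> \<open>With \<Lambda> = K powr s three conditions must hold: s > 7/2 leaves room for
    the constant \<open>R0\<close>, s \<beta> \<ge> 1 lets the smoothing of the target keep up with
    the deficits, and s \<alpha> < 1/2 makes the gradients \<alpha>-Hoelder. An exponent strictly
    between \<alpha> and its upper bound yields all three.\<close>
  obtain \<alpha>' where \<alpha>': "\<alpha> < \<alpha>'" "\<alpha>' < 1/7" "\<alpha>' < \<beta>/2"
    using dense[of \<alpha> "min (1/7) (\<beta>/2)"] \<alpha> by auto
  define s where "s = 1 / (2 * \<alpha>')"
  have s72: "7/2 < s" using \<alpha>' \<alpha> by (simp add: s_def field_simps)
  have s\<beta>: "1 \<le> s * \<beta>" using \<alpha>' \<alpha> by (simp add: s_def field_simps)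
  have s\<alpha>: "s * \<alpha> < 1/2" using \<alpha>' \<alpha> by (simp add: s_def field_simps)
  obtain K where K4: "4 \<le> K" and Kp: "R0 ^ 3 \<le> K powr (s - 7/2)"
    using ex_scale[of "s - 7/2" "R0 ^ 3" 4] s72 R0 by auto
  have K: "1 \<le> K" "0 < K" using K4 by auto
  \<comment> \<open>\<open>R1\<close> takes up the slack, so that the total jump R1 R R is exactly
    \<Lambda>.\<close>
  define \<Lambda> R R1 where "\<Lambda> = K powr s" and "R = R0 * K" and "R1 = \<Lambda> / (R * R)"
  have R: "0 < R" using R0 K by (simp add: R_def)
  have \<Lambda>K: "K \<le> \<Lambda>" using powr_mono[of 1 s K] s72 K by (simp add: \<Lambda>_def)
  have \<Lambda>: "1 \<le> \<Lambda>" "0 < \<Lambda>" using \<Lambda>K K by auto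
  have R1: "R0 * (K * sqrt K) \<le> R1"
  proof -
    have "K powr (s - 7/2) * K powr (7/2) = \<Lambda>" by (simp add: \<Lambda>_def flip: powr_add)
    moreover have "K powr (7/2) = K ^ 3 * sqrt K"
      using K powr_add[of K 3 "1/2"] powr_realpow[of K 3] by (simp add: powr_half_sqrt)
    ultimately have "R0 ^ 3 * (K ^ 3 * sqrt K) \<le> \<Lambda>"
      using mult_right_mono[OF Kp, of "K powr (7/2)"] K by simp
    then show ?thesis using R K R0 unfolding R1_def R_def
      by (simp add: field_simps power3_eq_cube)
  qed
  have RRR: "l * R1 * R * R = l * \<Lambda>" for l using R by (simp add: R1_def)
  \<comment> \<open>The ratio of consecutive amplitudes: the square roots of the deficits decay like
    r^q.\<close>
  define r where "r = K powr (-1/2)"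
  have r2: "r * sqrt K = 1" using K by (simp add: r_def powr_minus powr_half_sqrt[symmetric] powr_add[symmetric])
  have sK: "2 \<le> sqrt K" using K4 by (simp add: real_le_rsqrt)
  have r: "0 < r" "r \<le> 1/2" "r < 1"
  proof -
    show "0 < r" using K by (simp add: r_def)
    then have "r * 2 \<le> r * sqrt K" using sK by (intro mult_left_mono) auto
    then show "r \<le> 1/2" using r2 by simp
    then show "r < 1" by simp
  qed
  have r\<Lambda>: "r * \<Lambda> powr \<alpha> < 1"
  proof -
    have "r * \<Lambda> powr \<alpha> = K powr (s * \<alpha> - 1/2)" by (simp add: r_def \<Lambda>_def powr_powr flip: powr_add)
    also have "\<dots> < K powr 0" using s\<alpha> K4 by (intro powr_less_mono) auto
    finally show ?thesis using K by simp
  qed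
  have \<beta>0: "0 < \<beta>" using \<alpha> by simp
  have \<Lambda>\<beta>: "K \<le> \<Lambda> powr \<beta>" using powr_mono[OF s\<beta> K(1)] K by (simp add: \<Lambda>_def powr_powr)
  \<comment> \<open>24 C0^2 is the coefficient of h in the estimate \<open>Wb\<close>; it also
    dominates 4 C0.\<close>
  define C where "C = 24 * C0\<^sup>2"
  have C0sq: "C0 \<le> C0\<^sup>2" using C0 by (simp add: power2_eq_square)
  have C: "0 < C" "4 * C0 \<le> C" using C0 C0sq by (auto simp: C_def)
  have main: "\<exists>v' W. flexible C h \<alpha> v0 H v' W"
    if h: "0 < h" and sv0: "sm 3 v0" and cv0: "\<And>x. cb 3 M L v0 x" and Hsym: "\<And>i j. H i j = H j i"
      and Hb: "\<And>i j x. \<bar>H i j x\<bar> \<le> h" and HS: "\<And>i j x y. \<bar>H i j x - H i j y\<bar> \<le> S0 * norm (x - y) powr \<beta>"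
    for h v0 M L S0 and H :: "2 \<Rightarrow> 2 \<Rightarrow> real^2 \<Rightarrow> real"
  proof -
    define S where "S = max S0 0"
    have S: "\<bar>H i j x - H i j y\<bar> \<le> S * norm (x - y) powr \<beta>" for i j x y
      by (rule order_trans[OF HS mult_right_mono]) (auto simp: S_def)
    have S0: "0 \<le> S" by (simp add: S_def)
    \<comment> \<open>\<open>l0 powr \<beta>\<close> has to exceed \<open>X\<close> for the
      smoothing error at scale 1 / l0 to be at most h / (2 K). The other lower bounds on
      \<open>l0\<close> make v0 admissible for the first stage.\<close>
    define X where "X = max 1 (Cs * S * 4 powr \<beta> * (2 * K / h))"
    obtain l0 where l01: "max (max 1 \<bar>L\<bar>) (M * L\<^sup>2 / (B * sqrt (2 * K * h))) \<le> l0" and l02: "X \<le> l0 powr \<beta>"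
      using ex_scale[OF \<beta>0, of X "max (max 1 \<bar>L\<bar>) (M * L\<^sup>2 / (B * sqrt (2 * K * h)))"]
      unfolding X_def by (meson less_le_trans max.cobounded1 zero_less_one)
    have l0: "1 \<le> l0" "\<bar>L\<bar> \<le> l0" "M * L\<^sup>2 / (B * sqrt (2 * K * h)) \<le> l0" "0 < l0" using l01 by auto
    \<comment> \<open>d 0 = 2 h leaves h for the field H and h for its smoothing error.\<close>
    define d l where "d q = 2 * h / K ^ q" and "l q = l0 * \<Lambda> ^ q" for q
    have d: "0 < d q" "d (Suc q) = d q / K" for q using h K by (auto simp: d_def)
    have dK: "K * d (Suc q) = d q" for q using d(2) K by simp
    have lpos: "0 < l q" and lS: "l (Suc q) = l q * \<Lambda>" for q using l0 \<Lambda> by (auto simp: l_def)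
    have rq: "r\<^sup>2 * K = 1"
      using r2 K by (metis less_imp_le mult.assoc mult.left_commute mult_1 power2_eq_square real_sqrt_pow2)
    have sd: "sqrt (d q) = sqrt (2 * h) * r ^ q" for q
    proof -
      have "d q = 2 * h * (r ^ q)\<^sup>2"
        using arg_cong[OF rq, of "\<lambda>t. t ^ q"] K unfolding d_def by (simp add: field_simps power_mult_distrib flip: power_mult)
      then show ?thesis using r h by (simp add: real_sqrt_mult)
    qed
    define \<eta> where "\<eta> q = Cs * (S * (4 / l q) powr \<beta>)" for q
    define Hq where "Hq q i j = smoothing (1 / l q) (H i j)" for q i j
    have Hosc: "\<bar>H i j y - H i j x\<bar> \<le> S * (4 / l q) powr \<beta>" if "norm (y - x) \<le> 4 * (1 / l q)" for i j x y q
      by (rule order_trans[OF S]) (use that S0 \<beta>0 lpos[of q] in \<open>auto intro!: mult_left_mono powr_mono2\<close>)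
    have ilq: "0 < 1 / l q" for q using lpos by simp
    have Hq: "\<bar>Hq q i j x - H i j x\<bar> \<le> \<eta> q" "cb 2 (\<eta> q * l q) (l q) (partial m (Hq q i j)) x" for q i j x m
      using Cs(2)[rule_format, OF ilq[of q], of x "H i j", OF Hosc] unfolding Hq_def \<eta>_def by auto
    have sHq: "sm 3 (Hq q i j)" for q i j unfolding Hq_def by (rule sm_smoothing[OF ilq])
    have \<eta>0: "0 \<le> \<eta> q" for q using Cs S0 by (simp add: \<eta>_def)
    have \<eta>b: "\<eta> q \<le> h / (2 * K) / K ^ q" for q
    proof -
      have lq: "(4 / l q) powr \<beta> = 4 powr \<beta> / (l0 powr \<beta> * (\<Lambda> powr \<beta>) ^ q)"
        using l0 \<Lambda> unfolding l_def by (simp add: powr_divide powr_mult powr_realpow[symmetric] powr_powr mult.commute)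
      have "(Cs * S * 4 powr \<beta>) * (2 * K / h) \<le> l0 powr \<beta>" using l02 by (simp add: X_def)
      then have 1: "Cs * S * 4 powr \<beta> \<le> h / (2 * K) * l0 powr \<beta>" using h K by (simp add: field_simps)
      have "K ^ q \<le> (\<Lambda> powr \<beta>) ^ q" using \<Lambda>\<beta> K by (intro power_mono) auto
      then have 2: "h / (2 * K) * l0 powr \<beta> * K ^ q \<le> h / (2 * K) * l0 powr \<beta> * (\<Lambda> powr \<beta>) ^ q"
        using h K by (intro mult_left_mono) auto
      have "Cs * S * 4 powr \<beta> * K ^ q \<le> h / (2 * K) * l0 powr \<beta> * K ^ q"
        using 1 K by (intro mult_right_mono) auto
      with 2 have "Cs * S * 4 powr \<beta> * K ^ q \<le> h / (2 * K) * (l0 powr \<beta> * (\<Lambda> powr \<beta>) ^ q)" by (simp add: mult_ac)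
      moreover have "0 < l0 powr \<beta> * (\<Lambda> powr \<beta>) ^ q" using l0 \<Lambda> by simp
      ultimately show ?thesis using K unfolding \<eta>_def lq by (simp add: pos_divide_le_eq pos_le_divide_eq mult_ac)
    qed
    have \<eta>d: "\<eta> q \<le> d q / (4 * K)" for q using \<eta>b[of q] by (simp add: d_def field_simps)
    have "\<eta> 0 \<le> h"
    proof -
      have "h / (2 * K) \<le> h / 1" using h K by (intro divide_left_mono) auto
      then show ?thesis using \<eta>b[of 0] by simp
    qed
    \<comment> \<open>A state consists of v, the accumulated correction W, and the deficit G
      relative to the target smoothed at scale 1 / l q. The last clause pins down the initial state,
      with which the limit is compared.\<close>
    define P where "P q st \<longleftrightarrow> stage_data B (K * d q) (d q) (l q) (fst st) (snd (snd st)) \<and> (\<forall>i. sm 2 (fst (snd st) i)) \<and>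
       (\<forall>i j x. partial i (fst st) x * partial j (fst st) x + partial j (fst (snd st) i) x + partial i (fst (snd st) j) x
         = partial i v0 x * partial j v0 x + Hq q i j x - snd (snd st) i j x) \<and>
       (q = 0 \<longrightarrow> fst st = v0 \<and> fst (snd st) = (\<lambda>i x. 0))"
      for q and st :: "(real^2 \<Rightarrow> real) \<times> (2 \<Rightarrow> real^2 \<Rightarrow> real) \<times> (2 \<Rightarrow> 2 \<Rightarrow> real^2 \<Rightarrow> real)"
    define J where "J q st st' \<longleftrightarrow> (\<exists>w E. stage_step C0 (d q) (l (Suc q)) (fst st) (snd (snd st)) (fst st') w E \<and>
        fst (snd st') = (\<lambda>i x. fst (snd st) i x + w i x))"
      for q and st st' :: "(real^2 \<Rightarrow> real) \<times> (2 \<Rightarrow> real^2 \<Rightarrow> real) \<times> (2 \<Rightarrow> 2 \<Rightarrow> real^2 \<Rightarrow> real)"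
    \<comment> \<open>A stage is only asserted to exist, hence dependent choice; \<open>J\<close>
      records the step from one state to the next.\<close>
    have "\<exists>st. \<forall>q. P q (st q) \<and> J q (st q) (st (Suc q))"
    proof (rule dependent_nat_choice)
      have "cb 1 (B * sqrt (K * d 0) * l 0) (l 0) (partial j (partial i v0)) x" for i j x
      proof -
        have c1: "cb 1 (M * L * L) L (partial j (partial i v0)) x"
          by (rule cb_partial_numeral(2)[OF cb_partial_numeral(1)[OF cv0]])
        \<comment> \<open>L may be negative here, while \<open>cb_mono\<close> wants a nonnegative
          frequency. For negative L the bound M L L is both nonnegative and nonpositive, so the
          derivatives in question vanish.\<close>
        have c1: "cb 1 (M * L * L) \<bar>L\<bar> (partial j (partial i v0)) x"
        proof (cases "0 \<le> L")
          case False
          have nn: "0 \<le> M * L" using cb_nonneg[OF cb_partial_numeral(1)[OF cv0]] .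
          have "M * L * L \<le> 0" using nn False by (intro mult_nonneg_nonpos) auto
          moreover have "0 \<le> M * L * L" using cb_nonneg[OF c1] .
          ultimately have z: "M * L * L = 0" by simp
          then have z0: "partial j (partial i v0) x = 0" "\<And>m. partial m (partial j (partial i v0)) x = 0"
            using c1 by auto
          show ?thesis by (rule cb_numeralI(3)) (use z z0 in auto)
        qed (use c1 in simp)
        have "B * sqrt (2 * K * h) > 0" using B K h by simp
        then have "M * L * L \<le> B * sqrt (2 * K * h) * l0" using l0(3) by (simp add: pos_divide_le_eq power2_eq_square mult_ac)
        also have "\<dots> = B * sqrt (K * d 0) * l 0" by (simp add: d_def l_def mult_ac)
        finally show ?thesis by (rule cb_mono[OF c1]) (use l0 in \<open>auto simp: l_def\<close>)
      qed
      moreover have "cb 1 (d 0) (l 0) (Hq 0 i j) x" for i j x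
      proof (rule cb_numeralI(3))
        show "\<bar>Hq 0 i j x\<bar> \<le> d 0" using Hq(1)[of 0 i j x] Hb[of i j x] \<open>\<eta> 0 \<le> h\<close> by (simp add: d_def)
        fix m
        have "\<bar>partial m (Hq 0 i j) x\<bar> \<le> \<eta> 0 * l 0" by (rule cb_bound[OF Hq(2)])
        also have "\<dots> \<le> d 0 * l 0" using \<open>\<eta> 0 \<le> h\<close> h lpos[of 0] by (intro mult_right_mono) (auto simp: d_def)
        finally show "\<bar>partial m (Hq 0 i j) x\<bar> \<le> d 0 * l 0" .
      qed
      moreover have "sm 1 (Hq 0 i j)" for i j by (rule sm_le[OF sHq]) simp
      moreover have "Hq 0 i j = Hq 0 j i" for i j using Hsym[of i j] by (simp add: Hq_def)
      ultimately have "stage_data B (K * d 0) (d 0) (l 0) v0 (Hq 0)"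
        unfolding stage_data_def using sv0 by blast
      then have "P 0 (v0, (\<lambda>i x. 0), Hq 0)" by (simp add: P_def sm_const del: sm.simps)
      then show "\<exists>st. P 0 st" ..
    next
      fix st q assume Pst: "P q st"
      obtain v Wt G where st: "st = (v, Wt, G)" by (cases st)
      have dat: "stage_data B (K * d q) (d q) (l q) v G" and sW: "\<And>i. sm 2 (Wt i)" and
        ide: "\<And>i j x. partial i v x * partial j v x + partial j (Wt i) x + partial i (Wt j) x
         = partial i v0 x * partial j v0 x + Hq q i j x - G i j x"
        using Pst unfolding P_def st fst_conv snd_conv by blast+
      obtain v' w E where step: "stage_step C0 (d q) (l (Suc q)) v G v' w E"
        and dat': "stage_data B (d q) (d q / (2 * K)) (l (Suc q)) v' E"
        using stage[rule_format, OF d(1) lpos K(1) R1 _ dat, of R] unfolding RRR lS by (auto simp: R_def)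
      define W' where "W' = (\<lambda>i x. Wt i x + w i x)"
      \<comment> \<open>The target changes with the smoothing scale, and this change joins the error
        of the stage. Each contributes d q / (2 K), together d (Suc q).\<close>
      define G' where "G' = (\<lambda>i j x. E i j x + (Hq (Suc q) i j x - Hq q i j x))"
      have sw: "sm 2 (w i)" for i using step unfolding stage_step_def by blast
      have sE: "sm 1 (E i j)" "E i j = E j i" "cb 1 (d q / (2 * K)) (l (Suc q)) (E i j) x" and sv': "sm 3 v'"
        and v'': "cb 1 (B * sqrt (d q) * l (Suc q)) (l (Suc q)) (partial j (partial i v')) x" for i j x
        using dat' unfolding stage_data_def by blast+
      have sH1: "sm 1 (Hq q i j)" for q i j by (rule sm_le[OF sHq]) simp
      have lle: "l q \<le> l (Suc q)" using lpos[of q] \<Lambda> by (simp add: lS)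
      have dS: "d (Suc q) / (4 * K) \<le> d q / (4 * K)" using d(1)[of q] K by (intro divide_right_mono) (auto simp: d(2) field_simps)
      have \<eta>2: "\<eta> (Suc q) + \<eta> q \<le> d q / (2 * K)" using \<eta>d[of q] \<eta>d[of "Suc q"] dS by (simp add: field_simps)
      have HH: "cb 1 (d q / (2 * K)) (l (Suc q)) (\<lambda>x. Hq (Suc q) i j x - Hq q i j x) x" for i j x
      proof (rule cb_numeralI(3))
        show "\<bar>Hq (Suc q) i j x - Hq q i j x\<bar> \<le> d q / (2 * K)"
          using Hq(1)[of "Suc q" i j x] Hq(1)[of q i j x] \<eta>2 by linarith
        fix m
        have "partial m (\<lambda>x. Hq (Suc q) i j x - Hq q i j x) x = partial m (Hq (Suc q) i j) x - partial m (Hq q i j) x"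
          by (intro partial_diff sm_diff[OF sHq]) auto
        moreover have "\<bar>partial m (Hq (Suc q) i j) x\<bar> \<le> \<eta> (Suc q) * l (Suc q)" by (rule cb_bound[OF Hq(2)])
        moreover have "\<bar>partial m (Hq q i j) x\<bar> \<le> \<eta> q * l q" by (rule cb_bound[OF Hq(2)])
        moreover have "\<eta> q * l q \<le> \<eta> q * l (Suc q)" using lle \<eta>0 by (intro mult_left_mono)
        ultimately have "\<bar>partial m (\<lambda>x. Hq (Suc q) i j x - Hq q i j x) x\<bar> \<le> (\<eta> (Suc q) + \<eta> q) * l (Suc q)"
          by (simp add: distrib_right)
        also have "\<dots> \<le> d q / (2 * K) * l (Suc q)" using \<eta>2 lpos[of "Suc q"] by (intro mult_right_mono) auto
        finally show "\<bar>partial m (\<lambda>x. Hq (Suc q) i j x - Hq q i j x) x\<bar> \<le> d q / (2 * K) * l (Suc q)" .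
      qed
      have "cb 1 (d q / (2 * K) + d q / (2 * K)) (l (Suc q)) (G' i j) x" for i j x
        unfolding G'_def by (intro cb_add sE HH sm_sub sH1)
      moreover have "d q / (2 * K) + d q / (2 * K) = d (Suc q)" using K by (simp add: d(2) field_simps)
      ultimately have cG': "cb 1 (d (Suc q)) (l (Suc q)) (G' i j) x" for i j x by simp
      have sG': "sm 1 (G' i j)" for i j unfolding G'_def by (intro sm_add sE sm_sub sH1)
      have "Hq q i j = Hq q j i" for q i j using Hsym[of i j] by (simp add: Hq_def)
      then have symG': "G' i j = G' j i" for i j unfolding G'_def using sE(2)[of i j] by simp
      have "stage_data B (K * d (Suc q)) (d (Suc q)) (l (Suc q)) v' G'"
        unfolding stage_data_def dK using sv' v'' sG' symG' cG' by blast
      moreover have "sm 2 (W' i)" for i unfolding W'_def by (intro sm_add sW sw)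
      moreover have "partial i v' x * partial j v' x + partial j (W' i) x + partial i (W' j) x
         = partial i v0 x * partial j v0 x + Hq (Suc q) i j x - G' i j x" for i j x
      proof -
        have pW: "partial j (W' i) x = partial j (Wt i) x + partial j (w i) x" for i j
          unfolding W'_def by (intro partial_add sm_diff[OF sW] sm_diff[OF sw]) auto
        have "partial i v' x * partial j v' x + partial j (w i) x + partial i (w j) x =
          partial i v x * partial j v x + G i j x - E i j x"
          using step unfolding stage_step_def by blast
        then show ?thesis using ide[of i x j] unfolding pW G'_def by linarith
      qed
      ultimately have "P (Suc q) (v', W', G')" by (simp add: P_def del: sm.simps)
      moreover have "J q st (v', W', G')" unfolding J_def st W'_def using step by auto
      ultimately show "\<exists>st'. P (Suc q) st' \<and> J q st st'" by blast
    qed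
    then obtain st where st: "\<And>q. P q (st q)" "\<And>q. J q (st q) (st (Suc q))" by blast
    define v where "v q = fst (st q)" for q
    define W where "W q = fst (snd (st q))" for q
    define G where "G q = snd (snd (st q))" for q
    have v_0: "v 0 = v0" and W_0: "W 0 = (\<lambda>i x. 0)" using st(1)[of 0] by (auto simp: P_def v_def W_def)
    have dat: "stage_data B (K * d q) (d q) (l q) (v q) (G q)" and sW: "sm 2 (W q i)"
      and ide: "partial i (v q) x * partial j (v q) x + partial j (W q i) x + partial i (W q j) x
         = partial i v0 x * partial j v0 x + Hq q i j x - G q i j x" for q i j x
      using st(1)[of q] unfolding P_def v_def W_def G_def by blast+
    have sv: "sm 3 (v q)" and ddv: "cb 1 (B * sqrt (K * d q) * l q) (l q) (partial j (partial i (v q))) x"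
      and cG: "cb 1 (d q) (l q) (G q i j) x" for q i j x
      using dat[of q] unfolding stage_data_def by blast+
    have sv2: "sm 2 (v q)" for q by (rule sm_le[OF sv]) simp
    have dv: "\<bar>partial i (v (Suc q)) x - partial i (v q) x\<bar> \<le> C0 * sqrt (d q)" for q i x
      using st(2)[of q] unfolding J_def stage_step_def v_def by blast
    have dW: "cb 1 (C0 * (sqrt (d q) * \<bar>partial i (v q) x\<bar> + d q)) (l (Suc q)) (\<lambda>x. partial j (W (Suc q) i) x - partial j (W q i) x) x" for q i j x
    proof -
      obtain w E where step: "stage_step C0 (d q) (l (Suc q)) (v q) (G q) (v (Suc q)) w E" and
        W': "W (Suc q) = (\<lambda>i x. W q i x + w i x)"
        using st(2)[of q] unfolding J_def v_def W_def G_def by blast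
      have sw: "sm 2 (w i)" for i using step unfolding stage_step_def by blast
      have "partial j (\<lambda>x. W q i x + w i x) x = partial j (W q i) x + partial j (w i) x" for x
        by (intro partial_add sm_diff[OF sW] sm_diff[OF sw]) auto
      then have "(\<lambda>x. partial j (W (Suc q) i) x - partial j (W q i) x) = partial j (w i)"
        unfolding W' by auto
      then show ?thesis using step unfolding stage_step_def by auto
    qed
    have sq: "sqrt (2 * h) \<le> 2 * sqrt h"
      using sqrt2_le h by (simp add: real_sqrt_mult mult_right_mono)
    have ir: "1 / (1 - r) \<le> 2" using r by (simp add: field_simps)
    have scale: "X / (1 - r) \<le> 2 * X" if "0 \<le> X" for X using mult_left_mono[OF ir that] by simp
    have sh0: "0 \<le> sqrt h" "0 \<le> sqrt (2 * h)" using h by auto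
    have vb: "\<bar>partial i (v q) x - partial i v0 x\<bar> \<le> 4 * C0 * sqrt h" for q i x
    proof -
      have "\<bar>partial i (v q) x - partial i (v 0) x\<bar> \<le> (C0 * sqrt (2 * h)) / (1 - r)"
      proof (rule geometric_steps(2))
        show "\<bar>partial i (v (Suc q)) x - partial i (v q) x\<bar> \<le> C0 * sqrt (2 * h) * r ^ q" for q
          using dv[of i q x] unfolding sd by (simp add: mult.assoc)
      qed (use r C0 h in auto)
      also have "\<dots> \<le> 2 * (C0 * sqrt (2 * h))" using C0 h by (intro scale) auto
      also have "\<dots> \<le> 2 * (C0 * (2 * sqrt h))" using C0 sq by (intro mult_left_mono) auto
      finally show ?thesis by (simp add: v_0)
    qed
    \<comment> \<open>d q is at most sqrt (d q) times sqrt (2 h), so both terms decay like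
      r^q.\<close>
    have Wstep: "C0 * (sqrt (d q) * p + d q) \<le> C0 * sqrt (2 * h) * (p + sqrt (2 * h)) * r ^ q" for q p
    proof -
      have "d q = sqrt (d q) * sqrt (d q)" using d(1)[of q] by simp
      also have "\<dots> \<le> sqrt (d q) * sqrt (2 * h)"
        using r h unfolding sd by (intro mult_left_mono) (auto simp: mult_left_le power_le_one)
      finally have "sqrt (d q) * p + d q \<le> sqrt (d q) * (p + sqrt (2 * h))" by (simp add: distrib_left)
      from mult_left_mono[OF this, of C0] C0 show ?thesis unfolding sd by (simp add: mult_ac)
    qed
    \<comment> \<open>The gradient of \<open>v q\<close> is compared with that of v0 at the same
      point, which keeps this estimate pointwise.\<close>
    have Wb: "\<bar>partial j (W q i) x\<bar> \<le> C * (sqrt h * \<bar>partial i v0 x\<bar> + h)" for q i j x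
    proof -
      let ?p = "\<bar>partial i v0 x\<bar>"
      let ?A = "C0 * sqrt (2 * h) * (?p + 4 * C0 * sqrt h + sqrt (2 * h))"
      have A: "0 \<le> ?A" using C0 h by simp
      have "\<bar>partial j (W q i) x - partial j (W 0 i) x\<bar> \<le> ?A / (1 - r)"
      proof (rule geometric_steps(2))
        fix q
        have "\<bar>partial j (W (Suc q) i) x - partial j (W q i) x\<bar> \<le> C0 * (sqrt (d q) * \<bar>partial i (v q) x\<bar> + d q)"
          by (rule cb_bound[OF dW])
        also have "\<dots> \<le> C0 * (sqrt (d q) * (?p + 4 * C0 * sqrt h) + d q)"
          using vb[of i q x] C0 d(1)[of q] by (intro mult_left_mono add_right_mono) auto
        also have "\<dots> \<le> ?A * r ^ q" by (rule Wstep)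
        finally show "\<bar>partial j (W (Suc q) i) x - partial j (W q i) x\<bar> \<le> ?A * r ^ q" .
      qed (use r A in auto)
      also have "\<dots> \<le> 2 * ?A" by (rule scale[OF A])
      also have "\<dots> \<le> 2 * (C0 * (2 * sqrt h) * (?p + 6 * C0 * sqrt h))"
      proof (intro mult_left_mono mult_mono)
        have "2 * sqrt h \<le> 2 * C0 * sqrt h" using C0 sh0 by (simp add: mult_right_mono)
        then show "?p + 4 * C0 * sqrt h + sqrt (2 * h) \<le> ?p + 6 * C0 * sqrt h" using sq by linarith
      qed (use C0 sq h in auto)
      also have "\<dots> = 4 * C0 * (sqrt h * ?p) + 24 * C0\<^sup>2 * (sqrt h * sqrt h)" by (simp add: algebra_simps power2_eq_square)
      also have "\<dots> \<le> C * (sqrt h * ?p) + C * h"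
        using C h by (intro add_mono mult_right_mono) (auto simp: C_def)
      finally show ?thesis by (simp add: W_0 distrib_left)
    qed
    have gradb: "\<bar>partial i v0 x\<bar> \<le> M * L" for i x by (rule cb_bound[OF cb_partial_numeral(1)[OF cv0]])
    have grad0: "0 \<le> M * L" using gradb[of 1 0] by linarith
    define V where "V = M * L + 4 * C0 * sqrt h"
    have V: "\<bar>partial i (v q) x\<bar> \<le> V" for i q x using vb[of i q x] gradb[of i x] unfolding V_def by linarith
    have V0: "0 \<le> V" using grad0 C0 h by (simp add: V_def)
    \<comment> \<open>Step q works at frequency l (Suc q), hence the additional \<Lambda> in the
      constant l0 \<Lambda>.\<close>
    have lq: "l (Suc q) = (l0 * \<Lambda>) * \<Lambda> ^ q" for q by (simp add: l_def mult_ac)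
    have sd0: "0 \<le> sqrt (d q)" for q using d(1)[of q] by simp
    have "\<exists>U. (\<forall>x. U differentiable (at x)) \<and> (\<forall>i x. (\<lambda>q. partial i (v q) x) \<longlonglongrightarrow> partial i U x) \<and>
      (\<exists>Q. \<forall>i x y. \<bar>(partial i U x - partial i (v 0) x) - (partial i U y - partial i (v 0) y)\<bar> \<le> Q * norm (x - y) powr \<alpha>)"
    \<comment> \<open>In the constant, C0 accounts for the gradients and 2 B for the second
      derivatives of the two functions.\<close>
    proof (rule holder_limit[where A = "(C0 + 2 * B) * sqrt (2 * h)" and r = r and B = "l0 * \<Lambda>" and \<Lambda> = \<Lambda>])
      fix q i j x
      have "C0 * sqrt (d q) \<le> (C0 + 2 * B) * sqrt (d q)" using B sd0 by (intro mult_right_mono) auto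
      then show "\<bar>partial i (v (Suc q)) x - partial i (v q) x\<bar> \<le> (C0 + 2 * B) * sqrt (2 * h) * r ^ q"
        using dv[of i q x] unfolding sd by (simp add: mult.assoc)
      have "\<bar>partial j (partial i (v (Suc q))) x\<bar> \<le> B * sqrt (d q) * l (Suc q)"
        using cb_bound[OF ddv, of j i "Suc q" x] by (simp only: dK)
      moreover have "\<bar>partial j (partial i (v q)) x\<bar> \<le> B * sqrt (K * d q) * l q" by (rule cb_bound[OF ddv])
      moreover have "B * sqrt (K * d q) * l q \<le> B * sqrt (d q) * l (Suc q)"
      proof -
        have "sqrt K \<le> K" using K by (simp add: real_le_lsqrt power2_eq_square)
        then have "sqrt K \<le> \<Lambda>" using \<Lambda>K by linarith
        then have "B * sqrt (d q) * (sqrt K * l q) \<le> B * sqrt (d q) * (\<Lambda> * l q)"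
          using B sd0 lpos[of q] by (intro mult_left_mono mult_right_mono) auto
        then show ?thesis by (simp add: real_sqrt_mult lS mult_ac)
      qed
      ultimately have "\<bar>partial j (partial i (v (Suc q))) x - partial j (partial i (v q)) x\<bar> \<le> 2 * B * sqrt (d q) * l (Suc q)"
        by linarith
      also have "\<dots> \<le> (C0 + 2 * B) * sqrt (d q) * l (Suc q)"
        using C0 sd0[of q] lpos[of "Suc q"] by (intro mult_right_mono) auto
      finally show "\<bar>partial j (partial i (v (Suc q))) x - partial j (partial i (v q)) x\<bar> \<le> (C0 + 2 * B) * sqrt (2 * h) * r ^ q * (l0 * \<Lambda> * \<Lambda> ^ q)"
        unfolding sd lq by (simp add: mult.assoc)
    qed (use sv2 r B C0 h l0 \<Lambda> \<alpha> r\<Lambda> in auto)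
    then obtain v' Qv where v': "\<And>x. v' differentiable (at x)" "\<And>i x. (\<lambda>q. partial i (v q) x) \<longlonglongrightarrow> partial i v' x"
      "\<And>i x y. \<bar>(partial i v' x - partial i (v 0) x) - (partial i v' y - partial i (v 0) y)\<bar> \<le> Qv * norm (x - y) powr \<alpha>"
      by blast
    have "\<forall>i. \<exists>U. (\<forall>x. U differentiable (at x)) \<and> (\<forall>j x. (\<lambda>q. partial j (W q i) x) \<longlonglongrightarrow> partial j U x) \<and>
      (\<exists>Q. \<forall>j x y. \<bar>(partial j U x - partial j (W 0 i) x) - (partial j U y - partial j (W 0 i) y)\<bar> \<le> Q * norm (x - y) powr \<alpha>)"
    proof (intro allI holder_limit[where A = "C0 * sqrt (2 * h) * (V + sqrt (2 * h))" and r = r and B = "l0 * \<Lambda>" and \<Lambda> = \<Lambda>])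
      fix q i j m x
      have le: "C0 * (sqrt (d q) * \<bar>partial i (v q) x\<bar> + d q) \<le> C0 * sqrt (2 * h) * (V + sqrt (2 * h)) * r ^ q"
      proof -
        have "C0 * (sqrt (d q) * \<bar>partial i (v q) x\<bar> + d q) \<le> C0 * (sqrt (d q) * V + d q)"
          using V C0 sd0 by (intro mult_left_mono add_right_mono) auto
        also note Wstep
        finally show ?thesis .
      qed
      have c: "cb 1 (C0 * sqrt (2 * h) * (V + sqrt (2 * h)) * r ^ q) (l (Suc q)) (\<lambda>x. partial j (W (Suc q) i) x - partial j (W q i) x) x" for j
        by (rule cb_mono[OF dW le]) (use lpos[of "Suc q"] in auto)
      show "\<bar>partial j (W (Suc q) i) x - partial j (W q i) x\<bar> \<le> C0 * sqrt (2 * h) * (V + sqrt (2 * h)) * r ^ q"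
        by (rule cb_bound[OF c])
      have "partial m (\<lambda>x. partial j (W (Suc q) i) x - partial j (W q i) x) x =
         partial m (partial j (W (Suc q) i)) x - partial m (partial j (W q i)) x"
        using sm_partial_numeral(2)[OF sW] by (intro partial_diff) auto
      then show "\<bar>partial m (partial j (W (Suc q) i)) x - partial m (partial j (W q i)) x\<bar> \<le>
         C0 * sqrt (2 * h) * (V + sqrt (2 * h)) * r ^ q * (l0 * \<Lambda> * \<Lambda> ^ q)"
        using c[of j] unfolding lq[symmetric] One_nat_def cb.simps by metis
    qed (use sW r C0 h l0 \<Lambda> \<alpha> r\<Lambda> V0 in auto)
    from choice[OF this] obtain W' where W'': "\<forall>i. (\<forall>x. W' i differentiable (at x)) \<and> (\<forall>j x. (\<lambda>q. partial j (W q i) x) \<longlonglongrightarrow> partial j (W' i) x) \<and>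
      (\<exists>Q. \<forall>j x y. \<bar>(partial j (W' i) x - partial j (W 0 i) x) - (partial j (W' i) y - partial j (W 0 i) y)\<bar> \<le> Q * norm (x - y) powr \<alpha>)" ..
    have W': "W' i differentiable (at x)" "(\<lambda>q. partial j (W q i) x) \<longlonglongrightarrow> partial j (W' i) x"
      "\<forall>i. \<exists>Q. \<forall>j x y. \<bar>(partial j (W' i) x - partial j (W 0 i) x) - (partial j (W' i) y - partial j (W 0 i) y)\<bar> \<le> Q * norm (x - y) powr \<alpha>" for i j x
      using W'' by blast+
    from choice[OF W'(3)] obtain Qw where Qw: "\<And>i j x y. \<bar>partial j (W' i) x - partial j (W' i) y\<bar> \<le> Qw i * norm (x - y) powr \<alpha>"
      unfolding W_0 by auto
    have Qw': "\<bar>partial j (W' i) x - partial j (W' i) y\<bar> \<le> max (Qw 1) (Qw 2) * norm (x - y) powr \<alpha>" for i j x y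
      by (rule order_trans[OF Qw mult_right_mono]) (use exhaust_2[of i] in auto)
    have id: "partial i v' x * partial j v' x + partial j (W' i) x + partial i (W' j) x
         = partial i v0 x * partial j v0 x + H i j x" for i j x
    \<comment> \<open>The smoothed targets tend to H and the deficits to 0, both at the rate d
      q.\<close>
    proof (rule LIMSEQ_unique)
      show "(\<lambda>q. partial i (v q) x * partial j (v q) x + partial j (W q i) x + partial i (W q j) x)
        \<longlonglongrightarrow> partial i v' x * partial j v' x + partial j (W' i) x + partial i (W' j) x"
        by (intro tendsto_intros v' W')
      have "(\<lambda>q. Hq q i j x - H i j x - G q i j x) \<longlonglongrightarrow> 0"
      proof (rule Lim_null_comparison)
        have "\<bar>Hq q i j x - H i j x - G q i j x\<bar> \<le> 2 * d q" for q
        proof -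
          have "d q / (4 * K) \<le> d q / 1" using d(1)[of q] K by (intro divide_left_mono) auto
          then show ?thesis using Hq(1)[of q i j x] \<eta>d[of q] cb_bound[OF cG, of q i j x] by linarith
        qed
        then show "\<forall>\<^sub>F q in sequentially. norm (Hq q i j x - H i j x - G q i j x) \<le> 2 * d q" by simp
        have "(\<lambda>q. 2 * (2 * h) * (1 / K) ^ q) \<longlonglongrightarrow> 2 * (2 * h) * 0"
          using K4 by (intro tendsto_intros LIMSEQ_power_zero) auto
        then show "(\<lambda>q. 2 * d q) \<longlonglongrightarrow> 0" by (simp add: d_def power_divide)
      qed
      then have "(\<lambda>q. partial i v0 x * partial j v0 x + H i j x + (Hq q i j x - H i j x - G q i j x)) \<longlonglongrightarrow> partial i v0 x * partial j v0 x + H i j x + 0"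
        by (intro tendsto_intros)
      then show "(\<lambda>q. partial i (v q) x * partial j (v q) x + partial j (W q i) x + partial i (W q j) x)
        \<longlonglongrightarrow> partial i v0 x * partial j v0 x + H i j x"
        unfolding ide by (simp add: algebra_simps)
    qed
    have limv: "\<bar>partial i v' x - partial i v0 x\<bar> \<le> C * sqrt h" for i x
    proof -
      have "(\<lambda>q. \<bar>partial i (v q) x - partial i v0 x\<bar>) \<longlonglongrightarrow> \<bar>partial i v' x - partial i v0 x\<bar>"
        by (intro tendsto_intros v')
      then have "\<bar>partial i v' x - partial i v0 x\<bar> \<le> 4 * C0 * sqrt h"
        by (rule LIMSEQ_le_const2) (use vb in auto)
      also have "\<dots> \<le> C * sqrt h" using C h by (intro mult_right_mono) auto
      finally show ?thesis .
    qed
    have limW: "\<bar>partial j (W' i) x\<bar> \<le> C * (sqrt h * \<bar>partial i v0 x\<bar> + h)" for i j x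
    proof -
      have "(\<lambda>q. \<bar>partial j (W q i) x\<bar>) \<longlonglongrightarrow> \<bar>partial j (W' i) x\<bar>"
        by (intro tendsto_intros W')
      then show ?thesis by (rule LIMSEQ_le_const2) (use Wb in auto)
    qed
    have q1: "\<exists>Q. \<forall>i x y. \<bar>(partial i v' x - partial i v0 x) - (partial i v' y - partial i v0 y)\<bar> \<le> Q * norm (x - y) powr \<alpha>"
      using v'(3) unfolding v_0 by blast
    have q2: "\<exists>Q. \<forall>i j x y. \<bar>partial j (W' i) x - partial j (W' i) y\<bar> \<le> Q * norm (x - y) powr \<alpha>"
      using Qw' by blast
    show ?thesis
      unfolding flexible_def
      by (intro exI[of _ v'] exI[of _ W'] conjI q1 q2) (intro allI v'(1) W'(1) id limv limW)+
  qed
  show ?thesis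
  proof (intro exI[of _ C] conjI[OF C(1)] allI impI)
    fix h and v0 :: "real^2 \<Rightarrow> real" and H :: "2 \<Rightarrow> 2 \<Rightarrow> real^2 \<Rightarrow> real"
    assume h: "0 < h" and v0: "sm 3 v0" "\<exists>M L. \<forall>x. cb 3 M L v0 x" and H: "\<forall>i j. H i j = H j i" "\<forall>i j x. \<bar>H i j x\<bar> \<le> h"
      "\<exists>S. \<forall>i j x y. \<bar>H i j x - H i j y\<bar> \<le> S * norm (x - y) powr \<beta>"
    obtain M L S where "\<And>x. cb 3 M L v0 x" "\<And>i j x y. \<bar>H i j x - H i j y\<bar> \<le> S * norm (x - y) powr \<beta>"
      using v0(2) H(3) by blast
    from main[OF h v0(1) this(1) H(1)[rule_format] H(2)[rule_format] this(2)]
    show "\<exists>v' W. flexible C h \<alpha> v0 H v' W" .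
  qed
qed

section \<open>Functions that are twice continuously differentiable up to the boundary\<close>

text \<open>A path of three segments in S whose corners stay within L times the distance of its
  endpoints from x. It carries mean value inequalities up to the boundary, where the straight
  segment from x to y may leave the domain.\<close>

definition chain :: "(real^2) set \<Rightarrow> real \<Rightarrow> real^2 \<Rightarrow> real^2 \<Rightarrow> bool" where
  "chain S L x y \<longleftrightarrow> (\<exists>a b. closed_segment x a \<subseteq> S \<and> closed_segment a b \<subseteq> S \<and> closed_segment b y \<subseteq> S \<and>
     norm (a - x) \<le> L * norm (y - x) \<and> norm (b - x) \<le> L * norm (y - x))"

lemma chain_mono: "chain S L x y \<Longrightarrow> L \<le> L' \<Longrightarrow> chain S L' x y"
  unfolding chain_def by (meson mult_right_mono norm_ge_zero order_trans)

lemma smooth_real_lipschitz: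
  assumes "smooth_real \<gamma>"
  shows "\<exists>M\<ge>0. \<forall>s\<in>{a..b}. \<forall>t\<in>{a..b}. \<bar>\<gamma> s - \<gamma> t\<bar> \<le> M * \<bar>s - t\<bar>"
proof -
  have "(deriv ^^ 0) \<gamma> differentiable_on UNIV" "(deriv ^^ 1) \<gamma> differentiable_on UNIV"
    using assms unfolding smooth_real_def by blast+
  then have g: "\<gamma> differentiable_on UNIV" and c: "continuous_on {a..b} (deriv \<gamma>)"
    by (auto intro: continuous_on_subset differentiable_imp_continuous_on)
  have "bounded (deriv \<gamma> ` {a..b})"
    by (intro compact_imp_bounded compact_continuous_image c) auto
  then obtain M where M: "\<And>t. t \<in> {a..b} \<Longrightarrow> norm (deriv \<gamma> t) \<le> M"
    unfolding bounded_iff by (metis imageI)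
  have D: "(\<gamma> has_real_derivative deriv \<gamma> t) (at t within {a..b})" for t
  proof -
    have "\<gamma> differentiable (at t)" using g by (simp add: differentiable_on_def)
    then show ?thesis by (rule has_field_derivative_at_within[OF DERIV_deriv_iff_real_differentiable[THEN iffD2]])
  qed
  have "norm (\<gamma> s - \<gamma> t) \<le> max M 0 * norm (s - t)" if "s \<in> {a..b}" "t \<in> {a..b}" for s t
    by (rule field_differentiable_bound[of "{a..b}" \<gamma> "deriv \<gamma>"]) (use that D M in \<open>auto intro: max.coboundedI1\<close>)
  then show ?thesis by (intro exI[of _ "max M 0"]) auto
qed

text \<open>Above a graph with Lipschitz constant M the path goes up by (M + 1) times the distance,
  across, and down. At this height the whole horizontal segment clears the graph: \<gamma> varies by
  at most M times the distance and the second coordinate by at most the distance.\<close>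

lemma boundary_chain:
  assumes sb: "smooth_boundary \<Omega>" and x0: "x0 \<in> frontier \<Omega>"
  shows "\<exists>r>0. \<exists>L. \<forall>x \<in> \<Omega> \<inter> ball x0 r. \<forall>y \<in> \<Omega> \<inter> ball x0 r. chain \<Omega> L x y"
proof -
  obtain r0 \<gamma> and T :: "real^2 \<Rightarrow> real^2" where r0: "r0 > 0" and T: "orthogonal_transformation T" and \<gamma>: "smooth_real \<gamma>"
    and \<Omega>: "\<Omega> \<inter> ball x0 r0 = {x \<in> ball x0 r0. \<gamma> (T x $ 1) < T x $ 2}"
    using sb x0 unfolding smooth_boundary_def by blast
  have lin: "linear T" using T by (rule orthogonal_transformation_linear)
  have nT: "norm (T x) = norm x" for x using T by (simp add: orthogonal_transformation)
  \<comment> \<open>The vertical direction of the rotated coordinates.\<close>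
  obtain e where e: "T e = axis 2 1"
    using orthogonal_transformation_surj[OF T] by (metis surj_def)
  have ne: "norm e = 1" using nT[of e] by (simp add: e)
  have Te: "T (x + h *\<^sub>R e) = T x + h *\<^sub>R axis 2 1" for x h
    by (simp add: linear_add[OF lin] linear_scale[OF lin] e)
  define c where "c = T x0 $ 1"
  obtain M where M: "M \<ge> 0" "\<And>s t. s \<in> {c - r0..c + r0} \<Longrightarrow> t \<in> {c - r0..c + r0} \<Longrightarrow> \<bar>\<gamma> s - \<gamma> t\<bar> \<le> M * \<bar>s - t\<bar>"
    using smooth_real_lipschitz[OF \<gamma>, of "c - r0" "c + r0"] by blast
  have T1: "\<bar>T x $ i - T y $ i\<bar> \<le> norm (x - y)" for x y i
    using component_le_norm_cart[of "T (x - y)" i] unfolding nT by (simp add: linear_diff[OF lin])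
  have inI: "T x $ 1 \<in> {c - r0..c + r0}" if "x \<in> ball x0 r0" for x
    using T1[of x 1 x0] that by (auto simp: c_def dist_norm norm_minus_commute)
  \<comment> \<open>Small enough for points of the ball of radius r to stay within radius r0 after
    moving up by h, which is at most (M + 1) * 2 r.\<close>
  define r where "r = r0 / (2 * M + 4)"
  have r: "0 < r" using r0 M by (simp add: r_def)
  have rr: "r + (M + 1) * (2 * r) < r0" 
  proof -
    have "r * (2 * M + 4) = r0" using M by (simp add: r_def)
    then show ?thesis using r by (simp add: algebra_simps)
  qed
  have "chain \<Omega> (M + 2) x y" if x: "x \<in> \<Omega> \<inter> ball x0 r" and y: "y \<in> \<Omega> \<inter> ball x0 r" for x y
  proof -
    define D where "D = norm (y - x)"
    define h where "h = (M + 1) * D"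
    have D0: "0 \<le> D" by (simp add: D_def)
    have h0: "0 \<le> h" using M by (simp add: h_def D_def)
    have "D \<le> dist x0 x + dist x0 y" unfolding D_def by (metis dist_commute dist_norm dist_triangle2 add.commute)
    then have D2: "D \<le> 2 * r" using x y by auto
    have h2: "h \<le> (M + 1) * (2 * r)" unfolding h_def using D2 M by (intro mult_left_mono) auto
    have "r \<le> r + (M + 1) * (2 * r)" using r M by simp
    then have rr0: "r < r0" using rr by linarith
    have xb: "x \<in> ball x0 r0" "y \<in> ball x0 r0" using x y rr0 by auto
    have xO: "\<gamma> (T x $ 1) < T x $ 2" "\<gamma> (T y $ 1) < T y $ 2"
      using x y xb \<Omega> by blast+
    have up: "p + t *\<^sub>R e \<in> ball x0 r0" if "p \<in> ball x0 r" "0 \<le> t" "t \<le> h" for p t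
    proof -
      have "dist x0 (p + t *\<^sub>R e) \<le> dist x0 p + t"
        using dist_triangle[of x0 "p + t *\<^sub>R e" p] that ne by (simp add: dist_norm)
      also have "\<dots> < r + h" using that by simp
      finally show ?thesis using h2 rr by simp
    qed
    have inO: "p \<in> \<Omega>" if "p \<in> ball x0 r0" "\<gamma> (T p $ 1) < T p $ 2" for p
      using \<Omega> that by blast
    have vert: "closed_segment p (p + h *\<^sub>R e) \<subseteq> \<Omega>" if p: "p \<in> \<Omega> \<inter> ball x0 r" for p
    proof
      fix q assume "q \<in> closed_segment p (p + h *\<^sub>R e)"
      then obtain t where t: "0 \<le> t" "t \<le> 1" "q = (1 - t) *\<^sub>R p + t *\<^sub>R (p + h *\<^sub>R e)" by (auto simp: in_segment)
      then have q: "q = p + (t * h) *\<^sub>R e" by (simp add: algebra_simps)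
      have th: "0 \<le> t * h" "t * h \<le> h" using t h0 by (auto simp: mult_left_le_one_le)
      have "p \<in> ball x0 r0" using p rr0 by auto
      then have "\<gamma> (T p $ 1) < T p $ 2" using p \<Omega> by blast
      then show "q \<in> \<Omega>" using up[of p "t * h"] p th
        by (intro inO) (auto simp: q Te axis_def)
    qed
    have horiz: "closed_segment (x + h *\<^sub>R e) (y + h *\<^sub>R e) \<subseteq> \<Omega>"
    proof
      fix q assume "q \<in> closed_segment (x + h *\<^sub>R e) (y + h *\<^sub>R e)"
      then obtain t where t: "0 \<le> t" "t \<le> 1" "q = (1 - t) *\<^sub>R (x + h *\<^sub>R e) + t *\<^sub>R (y + h *\<^sub>R e)" by (auto simp: in_segment)
      define p where "p = (1 - t) *\<^sub>R x + t *\<^sub>R y"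
      have q: "q = p + h *\<^sub>R e" by (simp add: t p_def algebra_simps)
      have pb: "p \<in> ball x0 r" using x y t convexD[OF convex_ball, of x x0 r y "1-t" t] by (simp add: p_def)
      have "p - x = t *\<^sub>R (y - x)" by (simp add: p_def algebra_simps)
      then have pD: "norm (p - x) \<le> D" using t by (simp add: D_def mult_left_le_one_le)
      have pb0: "p \<in> ball x0 r0" using pb rr0 by auto
      have "\<gamma> (T p $ 1) \<le> \<gamma> (T x $ 1) + M * \<bar>T p $ 1 - T x $ 1\<bar>"
        using M(2)[OF inI[OF pb0] inI[OF xb(1)]] by linarith
      also have "M * \<bar>T p $ 1 - T x $ 1\<bar> \<le> M * D" using T1[of p 1 x] pD M by (intro mult_left_mono) auto
      also have "\<gamma> (T x $ 1) + M * D < T x $ 2 + M * D" using xO by simp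
      also have "\<dots> \<le> T p $ 2 + h" using T1[of p 2 x] pD by (simp add: h_def distrib_right)
      finally have "\<gamma> (T p $ 1) < T p $ 2 + h" by simp
      then show "q \<in> \<Omega>" using up[OF pb h0 order_refl] by (intro inO) (auto simp: q Te axis_def)
    qed
    show ?thesis unfolding chain_def
    proof (rule exI[of _ "x + h *\<^sub>R e"], rule exI[of _ "y + h *\<^sub>R e"], intro conjI)
      show "closed_segment (y + h *\<^sub>R e) y \<subseteq> \<Omega>" using vert[OF y] by (simp add: closed_segment_commute)
      show "norm ((x + h *\<^sub>R e) - x) \<le> (M + 2) * norm (y - x)"
        using h0 ne D0 by (simp add: h_def D_def[symmetric] distrib_right)
      have "norm ((y + h *\<^sub>R e) - x) \<le> D + h"
        using norm_triangle_ineq[of "y - x" "h *\<^sub>R e"] h0 ne by (simp add: D_def algebra_simps)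
      then show "norm ((y + h *\<^sub>R e) - x) \<le> (M + 2) * norm (y - x)"
        by (simp add: h_def D_def[symmetric] algebra_simps)
    qed (use vert[OF x] horiz in auto)
  qed
  then show ?thesis using r by blast
qed

text \<open>A Lebesgue number argument: the closure is covered by balls of half the admissible
  radius, so two points closer than the least half-radius lie in one full ball.\<close>

lemma uniform_chain:
  assumes "open \<Omega>" "bounded \<Omega>" "smooth_boundary \<Omega>"
  shows "\<exists>\<delta>>0. \<exists>L\<ge>1. \<forall>x\<in>\<Omega>. \<forall>y\<in>\<Omega>. norm (y - x) < \<delta> \<longrightarrow> chain \<Omega> L x y"
proof -
  have loc: "\<exists>r>0. \<exists>L. \<forall>x \<in> \<Omega> \<inter> ball x0 r. \<forall>y \<in> \<Omega> \<inter> ball x0 r. chain \<Omega> L x y" if x0: "x0 \<in> closure \<Omega>" for x0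
  proof (cases "x0 \<in> \<Omega>")
    case True
    then obtain r where r: "r > 0" "ball x0 r \<subseteq> \<Omega>" using assms(1) open_contains_ball by blast
    have "chain \<Omega> 1 x y" if "x \<in> ball x0 r" "y \<in> ball x0 r" for x y
    proof -
      have "closed_segment x y \<subseteq> \<Omega>"
        using r that closed_segment_subset[OF _ _ convex_ball] by blast
      then show ?thesis unfolding chain_def
        by - (rule exI[of _ x], rule exI[of _ y], use that r in auto)
    qed
    then show ?thesis using r by blast
  next
    case False
    then have "x0 \<in> frontier \<Omega>" using x0 assms(1) by (simp add: frontier_def interior_open)
    then show ?thesis by (rule boundary_chain[OF assms(3)])
  qed
  then obtain r L where r: "\<And>x0. x0 \<in> closure \<Omega> \<Longrightarrow> 0 < r x0"
    and L: "\<And>x0 x y. x0 \<in> closure \<Omega> \<Longrightarrow> x \<in> \<Omega> \<inter> ball x0 (r x0) \<Longrightarrow> y \<in> \<Omega> \<inter> ball x0 (r x0) \<Longrightarrow> chain \<Omega> (L x0) x y"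
    by metis
  have cpt: "compact (closure \<Omega>)" using assms(2) by (simp add: compact_closure)
  have cover: "closure \<Omega> \<subseteq> (\<Union>x0\<in>closure \<Omega>. ball x0 (r x0 / 2))"
    using r by (force simp: centre_in_ball)
  obtain F where F: "F \<subseteq> closure \<Omega>" "finite F" "closure \<Omega> \<subseteq> (\<Union>x0\<in>F. ball x0 (r x0 / 2))"
    by (rule compactE_image[OF cpt _ cover]) auto
  define \<delta> where "\<delta> = Min (insert 1 ((\<lambda>x0. r x0 / 2) ` F))"
  define Lm where "Lm = Max (insert 1 (L ` F))"
  have \<delta>: "0 < \<delta>" unfolding \<delta>_def by (subst Min_gr_iff) (use F r in auto)
  have \<delta>F: "\<delta> \<le> r x0 / 2" if "x0 \<in> F" for x0
    unfolding \<delta>_def by (rule Min_le) (use F that in auto)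
  have Lm: "1 \<le> Lm" "\<And>x0. x0 \<in> F \<Longrightarrow> L x0 \<le> Lm" using F by (auto simp: Lm_def)
  have "chain \<Omega> Lm x y" if "x \<in> \<Omega>" "y \<in> \<Omega>" "norm (y - x) < \<delta>" for x y
  proof -
    have "x \<in> closure \<Omega>" using that closure_subset by blast
    then obtain x0 where x0: "x0 \<in> F" "dist x0 x < r x0 / 2" using F by auto
    have "dist x0 y \<le> dist x0 x + norm (y - x)" using dist_triangle[of x0 y x] by (simp add: dist_norm norm_minus_commute)
    then have d: "dist x0 y < r x0" "dist x0 x < r x0" using x0 \<delta>F[OF x0(1)] that(3) zero_le_dist[of x0 x] by linarith+
    have x0c: "x0 \<in> closure \<Omega>" using x0(1) F(1) by blast
    have "chain \<Omega> (L x0) x y" by (rule L[OF x0c]) (use that(1,2) d in simp_all)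
    then show ?thesis using Lm(2)[OF x0(1)] by (rule chain_mono)
  qed
  then show ?thesis using \<delta> Lm(1) by blast
qed

text \<open>The derivative bound is asked only near x, so that the lemma applies to a Taylor
  remainder, whose derivative is small there. The constant 10 is 2 from
  \<open>lipschitz_on_convex\<close> times 5: the corners bound the length of the path by 5 L times
  the distance.\<close>

lemma chain_lipschitz:
  fixes f :: "real^2 \<Rightarrow> 'b::real_normed_vector"
  assumes ch: "chain \<Omega> L x y" and L: "1 \<le> L" and f: "\<And>z. z \<in> \<Omega> \<Longrightarrow> f differentiable (at z)"
    and B: "\<And>i z. z \<in> \<Omega> \<Longrightarrow> norm (z - x) \<le> L * norm (y - x) \<Longrightarrow> norm (partial i f z) \<le> B"
  shows "norm (f y - f x) \<le> 10 * L * B * norm (y - x)"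
proof -
  obtain a b where ab: "closed_segment x a \<subseteq> \<Omega>" "closed_segment a b \<subseteq> \<Omega>" "closed_segment b y \<subseteq> \<Omega>"
    "norm (a - x) \<le> L * norm (y - x)" "norm (b - x) \<le> L * norm (y - x)" using ch unfolding chain_def by blast
  define D where "D = norm (y - x)"
  have D: "0 \<le> D" "D \<le> L * D" using L by (auto simp: D_def mult_le_cancel_right1)
  have LD: "0 \<le> L * D" using D by linarith
  have near: "{x, a, b, y} \<subseteq> cball x (L * D)" using ab D LD by (auto simp: dist_norm norm_minus_commute D_def)
  have x: "x \<in> \<Omega>" using ab by auto
  have B0: "0 \<le> B" by (rule order_trans[OF norm_ge_zero B[OF x, of 1]]) (use LD in \<open>simp add: D_def\<close>)
  have seg: "norm (f q - f p) \<le> 2 * B * norm (q - p)" if "closed_segment p q \<subseteq> \<Omega>" "p \<in> {x,a,b,y}" "q \<in> {x,a,b,y}" for p q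
  proof (rule lipschitz_on_convex[of "closed_segment p q"])
    fix i z assume z: "z \<in> closed_segment p q"
    have "closed_segment p q \<subseteq> cball x (L * D)" using that near by (intro closed_segment_subset) auto
    then show "norm (partial i f z) \<le> B" using z that by (intro B) (auto simp: dist_norm norm_minus_commute D_def)
  qed (use that f in auto)
  have "norm (b - a) \<le> 2 * (L * D)" using norm_triangle_ineq4[of "b - x" "a - x"] ab by (simp add: D_def)
  moreover have "norm (y - b) \<le> 2 * (L * D)" using norm_triangle_ineq4[of "y - x" "b - x"] ab D by (simp add: D_def)
  ultimately have len: "norm (a - x) + norm (b - a) + norm (y - b) \<le> 5 * (L * D)" using ab by (simp add: D_def)
  have "f y - f x = (f a - f x) + (f b - f a) + (f y - f b)" by simp
  then have "norm (f y - f x) \<le> norm (f a - f x) + norm (f b - f a) + norm (f y - f b)"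
    using norm_triangle_ineq[of "f a - f x + (f b - f a)" "f y - f b"] norm_triangle_ineq[of "f a - f x" "f b - f a"] by simp
  also have "\<dots> \<le> 2 * B * norm (a - x) + 2 * B * norm (b - a) + 2 * B * norm (y - b)"
    using ab by (intro add_mono seg) auto
  also have "\<dots> = 2 * B * (norm (a - x) + norm (b - a) + norm (y - b))" by (simp add: algebra_simps)
  also have "\<dots> \<le> 2 * B * (5 * (L * D))" using len B0 by (intro mult_left_mono) auto
  finally show ?thesis by (simp add: D_def mult_ac)
qed

section \<open>Lipschitz and Taylor estimates up to the boundary\<close>

lemma bounded_on_closure:
  fixes g :: "'a::euclidean_space \<Rightarrow> 'b::real_normed_vector"
  assumes "bounded \<Omega>" "continuous_on (closure \<Omega>) g"
  shows "\<exists>B\<ge>0. \<forall>x\<in>closure \<Omega>. norm (g x) \<le> B"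
proof -
  have "bounded (g ` closure \<Omega>)"
    using assms by (intro compact_imp_bounded compact_continuous_image) (auto simp: compact_closure)
  then obtain B where "\<forall>x\<in>closure \<Omega>. norm (g x) \<le> B" unfolding bounded_iff by blast
  then show ?thesis by (intro exI[of _ "max B 0"]) (auto intro: max.coboundedI1)
qed

text \<open>Close pairs of points are joined by a chain; for pairs at distance at least \<delta> the
  trivial bounds suffice after division by powers of \<delta>. The Taylor estimate comes from the
  Lipschitz estimate for the gradient.\<close>

lemma C2_estimates:
  fixes f :: "real^2 \<Rightarrow> 'b::real_normed_vector"
  assumes \<Omega>: "open \<Omega>" "bounded \<Omega>" "smooth_boundary \<Omega>" and f: "Ck_closure 2 \<Omega> f"
  shows "\<exists>K\<ge>0. (\<forall>x\<in>\<Omega>. f differentiable (at x) \<and> norm (f x) \<le> K) \<and>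
    (\<forall>i. \<forall>x\<in>\<Omega>. norm (partial i f x) \<le> K) \<and>
    (\<forall>i. \<forall>x\<in>\<Omega>. \<forall>y\<in>\<Omega>. norm (partial i f y - partial i f x) \<le> K * norm (y - x)) \<and>
    (\<forall>x\<in>\<Omega>. \<forall>y\<in>\<Omega>. norm (f y - f x - (\<Sum>i\<in>UNIV. (y - x) $ i *\<^sub>R partial i f x)) \<le> K * (norm (y - x))\<^sup>2)"
proof -
  obtain \<delta> L where \<delta>: "\<delta> > 0" and L: "1 \<le> L" and ch: "\<And>x y. x \<in> \<Omega> \<Longrightarrow> y \<in> \<Omega> \<Longrightarrow> norm (y - x) < \<delta> \<Longrightarrow> chain \<Omega> L x y"
    using uniform_chain[OF \<Omega>] by blast
  have cf: "continuous_on (closure \<Omega>) f" and df: "\<And>x. x \<in> \<Omega> \<Longrightarrow> f differentiable (at x)"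
    and "\<forall>i. \<exists>g. (\<forall>x\<in>\<Omega>. g x = partial i f x) \<and> Ck_closure 1 \<Omega> g"
    using f by (auto simp: numeral_2_eq_2)
  then obtain g where g: "\<And>i x. x \<in> \<Omega> \<Longrightarrow> g i x = partial i f x" "\<And>i. Ck_closure 1 \<Omega> (g i)" by metis
  have cg: "continuous_on (closure \<Omega>) (g i)" and dg: "\<And>x. x \<in> \<Omega> \<Longrightarrow> g i differentiable (at x)"
    and "\<forall>j. \<exists>h. (\<forall>x\<in>\<Omega>. h x = partial j (g i) x) \<and> continuous_on (closure \<Omega>) h" for i
    using g(2)[of i] by auto
  then obtain h where h: "\<And>i j x. x \<in> \<Omega> \<Longrightarrow> h i j x = partial j (g i) x" "\<And>i j. continuous_on (closure \<Omega>) (h i j)" by metis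
  have sub: "\<Omega> \<subseteq> closure \<Omega>" by (rule closure_subset)
  obtain Bf where Bf: "0 \<le> Bf" "\<And>x. x \<in> \<Omega> \<Longrightarrow> norm (f x) \<le> Bf" using bounded_on_closure[OF \<Omega>(2) cf] sub by blast
  obtain Bg where Bg: "\<And>i. 0 \<le> Bg i" "\<And>i x. x \<in> \<Omega> \<Longrightarrow> norm (g i x) \<le> Bg i" using bounded_on_closure[OF \<Omega>(2) cg] sub by (metis subsetD)
  obtain Bh where Bh: "\<And>i j. 0 \<le> Bh i j" "\<And>i j x. x \<in> \<Omega> \<Longrightarrow> norm (h i j x) \<le> Bh i j" using bounded_on_closure[OF \<Omega>(2) h(2)] sub by (metis subsetD)
  define B where "B = Bf + (\<Sum>i\<in>UNIV. Bg i) + (\<Sum>i\<in>UNIV. \<Sum>j\<in>UNIV. Bh i j)"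
  have sB: "Bg i \<le> (\<Sum>i\<in>UNIV. Bg i)" "Bh i j \<le> (\<Sum>i\<in>UNIV. \<Sum>j\<in>UNIV. Bh i j)" for i j
  proof -
    show "Bg i \<le> (\<Sum>i\<in>UNIV. Bg i)" using Bg(1) by (intro member_le_sum) auto
    have "Bh i j \<le> (\<Sum>j\<in>UNIV. Bh i j)" using Bh(1) by (intro member_le_sum) auto
    also have "\<dots> \<le> (\<Sum>i\<in>UNIV. \<Sum>j\<in>UNIV. Bh i j)" using Bh(1) by (intro member_le_sum sum_nonneg) auto
    finally show "Bh i j \<le> (\<Sum>i\<in>UNIV. \<Sum>j\<in>UNIV. Bh i j)" .
  qed
  have s0: "0 \<le> (\<Sum>i\<in>UNIV. Bg i)" "0 \<le> (\<Sum>i\<in>UNIV. \<Sum>j\<in>UNIV. Bh i j)" using Bg(1) Bh(1) by (auto intro!: sum_nonneg)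
  have B0: "0 \<le> B" using Bf s0 by (simp add: B_def)
  have fB: "norm (f x) \<le> B" and gB: "norm (partial i f x) \<le> B" and hB: "norm (partial j (g i) x) \<le> B" if "x \<in> \<Omega>" for x i j
    using Bf(2)[OF that] Bg(2)[OF that, of i] Bh(2)[OF that, of i j] sB(1)[of i] sB(2)[of i j] s0 Bf(1)
    unfolding B_def g(1)[OF that] h(1)[OF that] by linarith+
  define K1 where "K1 = 10 * L * B + 2 * B / \<delta>"
  have K10: "0 \<le> K1" using B0 L \<delta> by (simp add: K1_def)
  have K1: "norm (partial i f y - partial i f x) \<le> K1 * norm (y - x)" if x: "x \<in> \<Omega>" and y: "y \<in> \<Omega>" for i x y
  proof (cases "norm (y - x) < \<delta>")
    case True
    have "norm (g i y - g i x) \<le> 10 * L * B * norm (y - x)"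
      by (rule chain_lipschitz[OF ch[OF x y True] L dg hB])
    also have "\<dots> \<le> K1 * norm (y - x)" using B0 \<delta> by (intro mult_right_mono) (auto simp: K1_def)
    finally show ?thesis by (simp add: g x y)
  next
    case False
    have "norm (partial i f y - partial i f x) \<le> B + B"
      by (rule order_trans[OF norm_triangle_ineq4 add_mono[OF gB[OF y] gB[OF x]]])
    also have "\<dots> = 2 * B / \<delta> * \<delta>" using \<delta> by simp
    also have "\<dots> \<le> K1 * norm (y - x)"
      using False B0 \<delta> L by (intro mult_mono) (auto simp: K1_def)
    finally show ?thesis .
  qed
  define K2 where "K2 = 10 * L * (K1 * L) + (2 * B / \<delta>\<^sup>2 + 2 * B / \<delta>)"
  have K20: "0 \<le> K2" using B0 L \<delta> K10 by (simp add: K2_def)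
  have K2: "norm (f y - f x - (\<Sum>i\<in>UNIV. (y - x) $ i *\<^sub>R partial i f x)) \<le> K2 * (norm (y - x))\<^sup>2"
    if x: "x \<in> \<Omega>" and y: "y \<in> \<Omega>" for x y
  proof (cases "norm (y - x) < \<delta>")
    case True
    \<comment> \<open>f minus its linear part at x. Its gradient is the increment of the gradient of
      f, at most K1 L times the distance along the chain.\<close>
    define u where "u z = f z - (\<Sum>i\<in>UNIV. (z - x) $ i *\<^sub>R partial i f x)" for z
    have Du: "(u has_derivative (\<lambda>h. (\<Sum>i\<in>UNIV. (h $ i) *\<^sub>R partial i f z) - (\<Sum>i\<in>UNIV. h $ i *\<^sub>R partial i f x))) (at z)" if "z \<in> \<Omega>" for z
      unfolding u_def[abs_def]
      by (rule has_derivative_diff[OF has_derivative_partial[OF df[OF that]]])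
        (auto intro!: derivative_eq_intros bounded_linear_imp_has_derivative[OF bounded_linear_vec_nth])
    have pu: "partial i u z = partial i f z - partial i f x" if "z \<in> \<Omega>" for i z
      using exhaust_2[of i] by (subst partialI[OF Du[OF that]]) (auto simp: sum_2 axis_def)
    have "norm (u y - u x) \<le> 10 * L * (K1 * (L * norm (y - x))) * norm (y - x)"
    proof (rule chain_lipschitz[OF ch[OF x y True] L])
      show "u differentiable (at z)" if "z \<in> \<Omega>" for z using Du[OF that] by (auto simp: differentiable_def)
      show "norm (partial i u z) \<le> K1 * (L * norm (y - x))" if "z \<in> \<Omega>" "norm (z - x) \<le> L * norm (y - x)" for i z
        unfolding pu[OF that(1)] using K1[OF x that(1), of i] mult_left_mono[OF that(2) K10] by linarith
    qed
    also have "\<dots> = 10 * L * (K1 * L) * (norm (y - x))\<^sup>2" by (simp add: power2_eq_square)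
    also have "\<dots> \<le> K2 * (norm (y - x))\<^sup>2" using B0 \<delta> by (intro mult_right_mono) (auto simp: K2_def)
    finally show ?thesis by (simp add: u_def algebra_simps)
  next
    case False
    define D where "D = norm (y - x)"
    have D: "\<delta> \<le> D" using False by (simp add: D_def)
    have c: "norm ((y - x) $ i *\<^sub>R partial i f x) \<le> D * B" for i
      unfolding norm_scaleR real_norm_def D_def using B0 by (intro mult_mono component_le_norm_cart gB[OF x]) auto
    have "norm (\<Sum>i\<in>UNIV. (y - x) $ i *\<^sub>R partial i f x) \<le> D * B + D * B"
      unfolding sum_2 by (rule order_trans[OF norm_triangle_ineq add_mono[OF c c]])
    moreover have "norm (f y - f x) \<le> B + B"
      by (rule order_trans[OF norm_triangle_ineq4 add_mono[OF fB[OF y] fB[OF x]]])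
    ultimately have "norm (f y - f x - (\<Sum>i\<in>UNIV. (y - x) $ i *\<^sub>R partial i f x)) \<le> (B + B) + (D * B + D * B)"
      using norm_triangle_ineq4[of "f y - f x" "\<Sum>i\<in>UNIV. (y - x) $ i *\<^sub>R partial i f x"] by linarith
    also have "\<dots> = 2 * B / \<delta>\<^sup>2 * \<delta>\<^sup>2 + 2 * B / \<delta> * (\<delta> * D)" using \<delta> by simp
    also have "\<dots> \<le> 2 * B / \<delta>\<^sup>2 * D\<^sup>2 + 2 * B / \<delta> * (D * D)"
      using D \<delta> B0 by (intro add_mono mult_left_mono power_mono mult_right_mono) auto
    also have "\<dots> = (2 * B / \<delta>\<^sup>2 + 2 * B / \<delta>) * D\<^sup>2" by (simp add: power2_eq_square distrib_right)
    also have "\<dots> \<le> K2 * D\<^sup>2" using L K10 by (intro mult_right_mono) (auto simp: K2_def)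
    finally show ?thesis by (simp add: D_def)
  qed
  define K where "K = B + K1 + K2"
  have K: "0 \<le> K" "B \<le> K" "K1 \<le> K" "K2 \<le> K" using B0 K10 K20 by (auto simp: K_def)
  show ?thesis
  proof (intro exI[of _ K] conjI ballI allI K(1) df)
    fix x y i assume x: "x \<in> \<Omega>"
    show "norm (f x) \<le> K" "norm (partial i f x) \<le> K" using fB[OF x] gB[OF x, of i] K by linarith+
    assume y: "y \<in> \<Omega>"
    show "norm (partial i f y - partial i f x) \<le> K * norm (y - x)"
      by (rule order_trans[OF K1[OF x y] mult_right_mono[OF K(3)]]) simp
    show "norm (f y - f x - (\<Sum>i\<in>UNIV. (y - x) $ i *\<^sub>R partial i f x)) \<le> K * (norm (y - x))\<^sup>2"
      by (rule order_trans[OF K2[OF x y] mult_right_mono[OF K(4)]]) simp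
  qed
qed

section \<open>The main theorem\<close>

lemma powr_subadditive:
  fixes s t a :: real
  assumes "0 \<le> s" "0 \<le> t" "0 \<le> a" "a \<le> 1"
  shows "(s + t) powr a \<le> s powr a + t powr a"
proof (cases "s + t = 0")
  case False
  then have st: "0 < s + t" using assms by linarith
  define u where "u = s / (s + t)"
  have u: "0 \<le> u" "u \<le> 1" "t / (s + t) = 1 - u" using st assms by (auto simp: u_def field_simps)
  have "u \<le> u powr a" "1 - u \<le> (1 - u) powr a"
    using min_le_powr[of u a] min_le_powr[of "1 - u" a] u assms by auto
  then have "1 \<le> u powr a + (1 - u) powr a" by linarith
  then have "(s + t) powr a * 1 \<le> (s + t) powr a * (u powr a + (1 - u) powr a)"
    by (intro mult_left_mono) auto
  also have "\<dots> = ((s + t) * u) powr a + ((s + t) * (1 - u)) powr a"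
    using st u by (simp add: distrib_left powr_mult)
  also have "(s + t) * u = s" using st by (simp add: u_def)
  also have "(s + t) * (1 - u) = t" using st by (simp flip: u(3))
  finally show ?thesis by simp
qed auto

(* McShane's extension, truncated at the given bound. *)
lemma holder_extension:
  fixes f :: "'a::real_normed_vector \<Rightarrow> real"
  assumes S: "S \<noteq> {}" and a: "0 < a" "a \<le> 1" and K: "0 \<le> K"
    and f: "\<And>x y. x \<in> S \<Longrightarrow> y \<in> S \<Longrightarrow> \<bar>f x - f y\<bar> \<le> K * norm (x - y) powr a"
    and h: "\<And>x. x \<in> S \<Longrightarrow> \<bar>f x\<bar> \<le> h"
  shows "\<exists>F. (\<forall>x\<in>S. F x = f x) \<and> (\<forall>x. \<bar>F x\<bar> \<le> h) \<and> (\<forall>x y. \<bar>F x - F y\<bar> \<le> K * norm (x - y) powr a)"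
proof -
  define E where "E x = (INF y\<in>S. f y + K * norm (x - y) powr a)" for x
  have bdd: "bdd_below ((\<lambda>y. f y + K * norm (x - y) powr a) ` S)" for x
  proof (rule bdd_belowI2)
    show "- h \<le> f y + K * norm (x - y) powr a" if "y \<in> S" for y
    proof -
      have "0 \<le> K * norm (x - y) powr a" using K by simp
      then show ?thesis using h[OF that] by linarith
    qed
  qed
  have le: "E x \<le> E z + K * norm (x - z) powr a" for x z
  proof -
    have "E x - K * norm (x - z) powr a \<le> E z"
      unfolding E_def[of z]
    proof (rule cINF_greatest[OF S])
      fix y assume y: "y \<in> S"
      have "norm (x - y) powr a \<le> (norm (x - z) + norm (z - y)) powr a"
        using norm_triangle_ineq[of "x - z" "z - y"] a by (intro powr_mono2) auto
      also have "\<dots> \<le> norm (x - z) powr a + norm (z - y) powr a"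
        using a by (intro powr_subadditive) auto
      finally have "K * norm (x - y) powr a \<le> K * norm (x - z) powr a + K * norm (z - y) powr a"
        using mult_left_mono[OF _ K] by (simp flip: distrib_left)
      moreover have "E x \<le> f y + K * norm (x - y) powr a"
        unfolding E_def by (rule cINF_lower[OF bdd y])
      ultimately show "E x - K * norm (x - z) powr a \<le> f y + K * norm (z - y) powr a" by linarith
    qed
    then show ?thesis by linarith
  qed
  have Ef: "E x = f x" if x: "x \<in> S" for x
  proof (rule antisym)
    show "E x \<le> f x" using cINF_lower[OF bdd[of x] x] by (simp add: E_def)
    show "f x \<le> E x" unfolding E_def
    proof (rule cINF_greatest[OF S])
      show "f x \<le> f y + K * norm (x - y) powr a" if "y \<in> S" for y using f[OF x that] by linarith
    qed
  qed
  have h0: "0 \<le> h" using S h by fastforce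
  have EE: "\<bar>E x - E z\<bar> \<le> K * norm (x - z) powr a" for x z
    using le[of x z] le[of z x] by (simp add: norm_minus_commute abs_le_iff)
  have "\<bar>max (- h) (min h (E x)) - max (- h) (min h (E z))\<bar> \<le> K * norm (x - z) powr a" for x z
    using EE[of x z] by linarith
  moreover have "max (- h) (min h (E x)) = f x" if "x \<in> S" for x
    using h[OF that] Ef[OF that] by auto
  ultimately show ?thesis using h0 by (intro exI[of _ "\<lambda>x. max (- h) (min h (E x))"]) auto
qed

lemma lipschitz_holder:
  fixes S :: "'a::real_normed_vector set"
  assumes "bounded S" "0 < a" "a \<le> 1"
  shows "\<exists>c\<ge>0. \<forall>x\<in>S. \<forall>y\<in>S. norm (x - y) \<le> c * norm (x - y) powr a"
proof -
  obtain R where R: "\<And>x. x \<in> S \<Longrightarrow> norm x \<le> R" using assms(1) unfolding bounded_iff by blast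
  define c where "c = max (2 * R) 0 powr (1 - a)"
  have "norm (x - y) \<le> c * norm (x - y) powr a" if "x \<in> S" "y \<in> S" for x y
  proof (cases "x = y")
    case False
    have "norm (x - y) \<le> 2 * R" using norm_triangle_ineq4[of x y] R[OF that(1)] R[OF that(2)] by linarith
    then have "norm (x - y) powr (1 - a) \<le> c" unfolding c_def using assms by (intro powr_mono2) auto
    then have "norm (x - y) powr (1 - a) * norm (x - y) powr a \<le> c * norm (x - y) powr a"
      by (intro mult_right_mono) auto
    then show ?thesis using False by (simp flip: powr_add)
  qed simp
  then show ?thesis by (intro exI[of _ c]) (auto simp: c_def)
qed

text \<open>The Hoelder estimate makes the derivative uniformly continuous, hence extendable to the
  closure; the inequality follows there by continuity in the pair of points, on the closure of the
  product of \<Omega> with itself.\<close>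

lemma Holder_closure_1I:
  fixes f :: "real^'n \<Rightarrow> 'b::banach"
  assumes a: "0 < a" and b: "bounded \<Omega>" and f: "continuous_on (closure \<Omega>) f" "\<And>x. x \<in> \<Omega> \<Longrightarrow> f differentiable (at x)"
    and Q: "\<And>i x y. x \<in> \<Omega> \<Longrightarrow> y \<in> \<Omega> \<Longrightarrow> norm (partial i f x - partial i f y) \<le> Q * norm (x - y) powr a"
  shows "Holder_closure 1 a \<Omega> f"
proof -
  have cpt: "compact (closure \<Omega>)" using b by (simp add: compact_closure)
  have "\<exists>g. (\<forall>x\<in>\<Omega>. g x = partial i f x) \<and> Holder_closure 0 a \<Omega> g" for i
  proof -
    have "uniformly_continuous_on \<Omega> (partial i f)"
      unfolding uniformly_continuous_on_def
    proof (intro allI impI)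
      fix e :: real assume e: "0 < e"
      \<comment> \<open>Q may be zero or negative, and the radius d needs a positive
        divisor.\<close>
      define Q' where "Q' = max Q 1"
      have Q': "0 < Q'" "Q \<le> Q'" by (auto simp: Q'_def)
      define d where "d = (e / Q') powr (1 / a)"
      have d: "0 < d" using e Q' by (simp add: d_def)
      show "\<exists>d>0. \<forall>x\<in>\<Omega>. \<forall>x'\<in>\<Omega>. dist x' x < d \<longrightarrow> dist (partial i f x') (partial i f x) < e"
      proof (intro exI[of _ d] conjI d ballI impI)
        fix x x' assume x: "x \<in> \<Omega>" "x' \<in> \<Omega>" "dist x' x < d"
        have "dist (partial i f x') (partial i f x) \<le> Q * norm (x' - x) powr a"
          using Q[OF x(2,1)] by (simp add: dist_norm)
        also have "\<dots> \<le> Q' * norm (x' - x) powr a" using Q' by (intro mult_right_mono) auto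
        also have "\<dots> < Q' * d powr a"
          using x(3) a Q' by (intro mult_strict_left_mono powr_less_mono2) (auto simp: dist_norm)
        also have "\<dots> = e" using a e Q' by (simp add: d_def powr_powr)
        finally show "dist (partial i f x') (partial i f x) < e" .
      qed
    qed
    then obtain g where g: "uniformly_continuous_on (closure \<Omega>) g" "\<And>x. x \<in> \<Omega> \<Longrightarrow> partial i f x = g x"
      by (rule uniformly_continuous_on_extension_on_closure) blast
    have cg: "continuous_on (closure \<Omega>) g" using g(1) by (rule uniformly_continuous_imp_continuous)
    have "norm (g x - g y) \<le> Q * norm (x - y) powr a" if "x \<in> closure \<Omega>" "y \<in> closure \<Omega>" for x y
    proof -
      let ?\<phi> = "\<lambda>p. Q * norm (fst p - snd p) powr a - norm (g (fst p) - g (snd p))"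
      have "continuous_on (closure (\<Omega> \<times> \<Omega>)) ?\<phi>"
        unfolding closure_Times
        by (intro continuous_intros continuous_on_powr' continuous_on_compose2[OF cg]) (use a in auto)
      moreover have "(x, y) \<in> closure (\<Omega> \<times> \<Omega>)" using that by (simp add: closure_Times)
      moreover have "0 \<le> ?\<phi> p" if "p \<in> \<Omega> \<times> \<Omega>" for p
        using Q[of "fst p" "snd p" i] that g(2) by auto
      ultimately have "0 \<le> ?\<phi> (x, y)" by (rule continuous_ge_on_closure)
      then show ?thesis by simp
    qed
    then show ?thesis using g(2) cg compact_imp_bounded[OF compact_continuous_image[OF cg cpt]]
      by (intro exI[of _ g]) (auto intro!: exI[of _ Q])
  qed
  then show ?thesis
    using f compact_imp_bounded[OF compact_continuous_image[OF f(1) cpt]] by simp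
qed

text \<open>Some lattice points near the boundary lie outside the domain. There the Taylor
  polynomial at a nearby point of the domain is used, so v needs no extension. Its deviation from
  the Taylor polynomial at x has order K e^2, hence the gradients differ by order K e.\<close>

lemma C1_approximation:
  fixes v :: "real^2 \<Rightarrow> real"
  assumes K: "0 \<le> K" and vK: "\<And>x. x \<in> \<Omega> \<Longrightarrow> \<bar>v x\<bar> \<le> K" "\<And>i x. x \<in> \<Omega> \<Longrightarrow> \<bar>partial i v x\<bar> \<le> K"
    "\<And>i x y. x \<in> \<Omega> \<Longrightarrow> y \<in> \<Omega> \<Longrightarrow> \<bar>partial i v y - partial i v x\<bar> \<le> K * norm (y - x)"
    "\<And>x y. x \<in> \<Omega> \<Longrightarrow> y \<in> \<Omega> \<Longrightarrow> \<bar>v y - v x - (\<Sum>i\<in>UNIV. (y - x) $ i *\<^sub>R partial i v x)\<bar> \<le> K * (norm (y - x))\<^sup>2"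
    and \<epsilon>: "0 < \<epsilon>"
  shows "\<exists>v0. sm 3 v0 \<and> (\<exists>M L. \<forall>x. cb 3 M L v0 x) \<and> (\<forall>i. \<forall>x\<in>\<Omega>. \<bar>partial i v0 x - partial i v x\<bar> \<le> \<epsilon>)"
proof -
  obtain C where C: "C > 0" and qi: "\<forall>e>0. \<forall>a s x m a0 s0. 0 \<le> m \<longrightarrow>
     (\<forall>z\<in>near e x. \<bar>a z - (a0 + (\<Sum>i\<in>UNIV. s0 i * (e * lattice_vec z $ i - x $ i)))\<bar> \<le> m \<and>
        (\<forall>i. \<bar>s i z - s0 i\<bar> \<le> m / e)) \<longrightarrow>
     cb 3 (C * m) (1/e) (\<lambda>y. quasi_interp e a s y - (a0 + (\<Sum>i\<in>UNIV. s0 i * (y $ i - x $ i)))) x"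
    using cb_quasi_interp by (elim exE conjE)
  \<comment> \<open>The final error is 128 C K e; the summand 1 covers K = 0.\<close>
  define e where "e = \<epsilon> / (128 * C * K + 1)"
  have den: "0 < 128 * C * K + 1" using C K by (simp add: add_nonneg_pos)
  have e: "0 < e" using \<epsilon> den by (simp add: e_def)
  have "128 * C * K * e \<le> (128 * C * K + 1) * e" using e by (intro mult_right_mono) auto
  also have "\<dots> = \<epsilon>" using den by (simp add: e_def)
  finally have e\<epsilon>: "128 * C * K * e \<le> \<epsilon>" .
  define q where "q z = e *\<^sub>R lattice_vec z" for z
  \<comment> \<open>All lattice points near a point of the domain are good. The others carry zero
    data, which keeps v0 and its derivatives bounded on the plane.\<close>
  define good where "good z \<longleftrightarrow> (\<exists>p\<in>\<Omega>. norm (q z - p) \<le> 4 * e)" for z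
  define p where "p z = (SOME p. p \<in> \<Omega> \<and> norm (q z - p) \<le> 4 * e)" for z
  have p: "p z \<in> \<Omega>" "norm (q z - p z) \<le> 4 * e" if "good z" for z
  proof -
    have "\<exists>p. p \<in> \<Omega> \<and> norm (q z - p) \<le> 4 * e" using that unfolding good_def by blast
    from someI_ex[OF this] show "p z \<in> \<Omega>" "norm (q z - p z) \<le> 4 * e" unfolding p_def by blast+
  qed
  define s where "s i z = (if good z then partial i v (p z) else 0)" for i z
  define a where "a z = (if good z then v (p z) + (\<Sum>i\<in>UNIV. (q z - p z) $ i * partial i v (p z)) else 0)" for z
  define v0 where "v0 = quasi_interp e a s"
  have sv0: "sm 3 v0" unfolding v0_def by (rule sm_quasi_interp[OF e])
  have prod: "\<bar>x $ i * t\<bar> \<le> A * B" if "norm x \<le> A" "\<bar>t\<bar> \<le> B" for x :: "real^2" and i t A B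
  proof -
    have "\<bar>x $ i\<bar> \<le> A" using component_le_norm_cart[of x i] that by linarith
    then show ?thesis unfolding abs_mult using that by (intro mult_mono) auto
  qed
  have "cb 3 (C * (K + 8 * e * K + K * e)) (1/e) v0 x" for x
  proof -
    define m where "m = K + 8 * e * K + K * e"
    have m: "0 \<le> m" using K e by (simp add: m_def)
    have az: "\<bar>a z\<bar> \<le> m" and sz: "\<bar>s i z\<bar> \<le> m / e" for z i
    proof -
      have "\<bar>a z\<bar> \<le> K + (4 * e * K + 4 * e * K)"
      proof (cases "good z")
        case True
        have c: "\<bar>(q z - p z) $ i * partial i v (p z)\<bar> \<le> 4 * e * K" for i
          by (rule prod[OF p(2)[OF True] vK(2)[OF p(1)[OF True]]])
        have "a z = v (p z) + ((q z - p z) $ 1 * partial 1 v (p z) + (q z - p z) $ 2 * partial 2 v (p z))"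
          using True by (simp add: a_def sum_2)
        then show ?thesis
          by (simp only:) (rule order_trans[OF abs_triangle_ineq add_mono[OF vK(1)[OF p(1)[OF True]]
              order_trans[OF abs_triangle_ineq add_mono[OF c c]]]])
      qed (use K e in \<open>simp add: a_def\<close>)
      moreover have "0 \<le> K * e" using K e by simp
      ultimately show "\<bar>a z\<bar> \<le> m" unfolding m_def by linarith
      have "\<bar>s i z\<bar> \<le> K" using vK(2)[OF p(1)] K by (auto simp: s_def)
      also have "K = K * e / e" using e by simp
      also have "\<dots> \<le> m / e" using K e by (intro divide_right_mono) (auto simp: m_def)
      finally show "\<bar>s i z\<bar> \<le> m / e" .
    qed
    have "cb 3 (C * m) (1/e) (\<lambda>y. quasi_interp e a s y - (0 + (\<Sum>i\<in>UNIV. 0 * (y $ i - x $ i)))) x"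
      by (rule qi[rule_format, OF e m]) (use az sz in auto)
    then show ?thesis by (simp add: v0_def m_def)
  qed
  moreover have "\<bar>partial i v0 x - partial i v x\<bar> \<le> \<epsilon>" if x: "x \<in> \<Omega>" for i x
  proof -
    \<comment> \<open>64 K e^2 from the Taylor remainder at distance 8 e, and twice 32 K e^2 from an
      offset of 4 e with slopes that differ by 8 K e.\<close>
    define m where "m = 128 * K * e\<^sup>2"
    have m: "0 \<le> m" using K by (simp add: m_def)
    have me: "m / e = 128 * (K * e)" using e by (simp add: m_def power2_eq_square)
    have "cb 3 (C * m) (1/e) (\<lambda>y. quasi_interp e a s y - (v x + (\<Sum>i\<in>UNIV. partial i v x * (y $ i - x $ i)))) x"
    proof (rule qi[rule_format, OF e m], intro conjI allI)
      fix z assume z: "z \<in> near e x"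
      have zx: "norm (q z - x) \<le> 4 * e" unfolding q_def by (rule norm_near[OF z e])
      then have g: "good z" using x unfolding good_def by blast
      note pz = p[OF g]
      have px: "norm (p z - x) \<le> 8 * e"
        using norm_triangle_ineq4[of "q z - x" "q z - p z"] zx pz(2) by simp
      have dK: "\<bar>partial i v (p z) - partial i v x\<bar> \<le> K * (8 * e)" for i
        by (rule order_trans[OF vK(3)[OF x pz(1)] mult_left_mono[OF px K]])
      show "\<bar>s i z - partial i v x\<bar> \<le> m / e" for i
      proof -
        have "0 \<le> K * e" using K e by simp
        then show ?thesis using dK[of i] g unfolding me s_def by (simp add: mult.left_commute)
      qed
      have "a z - (v x + (\<Sum>i\<in>UNIV. partial i v x * (e * lattice_vec z $ i - x $ i))) =
        (v (p z) - v x - (\<Sum>i\<in>UNIV. (p z - x) $ i *\<^sub>R partial i v x))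
        + ((q z - p z) $ 1 * (partial 1 v (p z) - partial 1 v x) + (q z - p z) $ 2 * (partial 2 v (p z) - partial 2 v x))"
        using g by (simp add: a_def sum_2 q_def algebra_simps)
      also have "\<bar>\<dots>\<bar> \<le> K * (8 * e)\<^sup>2 + (4 * e * (K * (8 * e)) + 4 * e * (K * (8 * e)))"
      proof (intro order_trans[OF abs_triangle_ineq add_mono[OF _ order_trans[OF abs_triangle_ineq add_mono[OF prod[OF pz(2) dK] prod[OF pz(2) dK]]]]])
        have "\<bar>v (p z) - v x - (\<Sum>i\<in>UNIV. (p z - x) $ i *\<^sub>R partial i v x)\<bar> \<le> K * (norm (p z - x))\<^sup>2"
          by (rule vK(4)[OF x pz(1)])
        also have "\<dots> \<le> K * (8 * e)\<^sup>2" using px K by (intro mult_left_mono power_mono) auto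
        finally show "\<bar>v (p z) - v x - (\<Sum>i\<in>UNIV. (p z - x) $ i *\<^sub>R partial i v x)\<bar> \<le> K * (8 * e)\<^sup>2" .
      qed
      also have "\<dots> = m" by (simp add: m_def power2_eq_square)
      finally show "\<bar>a z - (v x + (\<Sum>i\<in>UNIV. partial i v x * (e * lattice_vec z $ i - x $ i)))\<bar> \<le> m" .
    qed
    from cb_bound[OF cb_partial_numeral(1)[OF this, of i]]
    have 1: "\<bar>partial i (\<lambda>y. v0 y - (v x + (\<Sum>i\<in>UNIV. partial i v x * (y $ i - x $ i)))) x\<bar> \<le> C * m * (1/e)"
      by (simp add: v0_def)
    have lin: "((\<lambda>y. v x + (\<Sum>i\<in>UNIV. partial i v x * (y $ i - x $ i))) has_derivative (\<lambda>h. \<Sum>i\<in>UNIV. partial i v x * h $ i)) (at x)"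
      by (auto intro!: derivative_eq_intros bounded_linear_imp_has_derivative[OF bounded_linear_vec_nth])
    have "partial i (\<lambda>y. v0 y - (v x + (\<Sum>i\<in>UNIV. partial i v x * (y $ i - x $ i)))) x = partial i v0 x - partial i v x"
    proof (subst partial_diff)
      show "v0 differentiable (at x)" using sm_diff[OF sv0] by simp
      show "(\<lambda>y. v x + (\<Sum>i\<in>UNIV. partial i v x * (y $ i - x $ i))) differentiable (at x)"
        using lin by (auto simp: differentiable_def)
      show "partial i v0 x - partial i (\<lambda>y. v x + (\<Sum>i\<in>UNIV. partial i v x * (y $ i - x $ i))) x = partial i v0 x - partial i v x"
        using exhaust_2[of i] by (subst partialI[OF lin]) (auto simp: sum_2 axis_def)
    qed
    moreover have "C * m * (1/e) = 128 * C * K * e" using e by (simp add: m_def power2_eq_square)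
    ultimately show ?thesis using 1 e\<epsilon> by linarith
  qed
  ultimately show ?thesis using sv0 by blast
qed

section \<open>Entries and norms of vector and matrix fields\<close>

lemma jacobian_nth: "jacobian w (at x) $ i $ j = partial j w x $ i"
  by (simp add: jacobian_def matrix_def partial_def)

lemma sym_grad_nth: "(2 *\<^sub>R sym_grad w x) $ i $ j = partial j w x $ i + partial i w x $ j"
  by (simp add: sym_grad_def jacobian_nth transpose_def)

lemma deficit_nth:
  "deficit v w A x $ i $ j = partial i v x * partial j v x + (partial j w x $ i + partial i w x $ j) - A x $ i $ j"
  using sym_grad_nth[of w x i j] by (simp add: deficit_def tensor_def grad_def)

lemma matrix_nth_le_norm: "\<bar>M $ i $ j\<bar> \<le> norm (M :: real^2^2)"
  using component_le_norm_cart[of "M $ i" j] Finite_Cartesian_Product.norm_nth_le[of M i] by linarith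

lemma norm_matrix_le: 
  assumes "\<And>i j. \<bar>(M :: real^2^2) $ i $ j\<bar> \<le> B"
  shows "norm M \<le> 4 * B"
proof -
  have row: "norm (M $ i) \<le> B + B" for i
    using norm_le_l1_cart[of "M $ i"] assms[of i 1] assms[of i 2] unfolding sum_2 by linarith
  have "norm M \<le> norm (M $ 1) + norm (M $ 2)"
    unfolding norm_vec_def using L2_set_le_sum[of UNIV "\<lambda>i. norm (M $ i)"] by (simp add: sum_2 norm_vec_def)
  then show ?thesis using row[of 1] row[of 2] by linarith
qed

lemma norm_vec2_le: 
  assumes "\<And>i. \<bar>(u :: real^2) $ i\<bar> \<le> B"
  shows "norm u \<le> 2 * B"
  using norm_le_l1_cart[of u] assms[of 1] assms[of 2] unfolding sum_2 by linarith

text \<open>B serves only to certify that the supremum is a genuine one.\<close>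

lemma C0_norm_upper:
  assumes "\<And>x. x \<in> S \<Longrightarrow> norm (f x) \<le> B" "x \<in> S"
  shows "norm (f x) \<le> C0_norm S f"
  unfolding C0_norm_def by (rule cSUP_upper[OF assms(2)]) (rule bdd_aboveI2[OF assms(1)])

lemma C0_norm_least: "S \<noteq> {} \<Longrightarrow> (\<And>x. x \<in> S \<Longrightarrow> norm (f x) \<le> B) \<Longrightarrow> C0_norm S f \<le> B"
  unfolding C0_norm_def by (rule cSUP_least)

lemma Lp_norm_le:
  fixes S :: "'a::euclidean_space set"
  assumes S: "open S" "bounded S" and p: "0 < p" and B: "0 \<le> B" "\<And>x. x \<in> S \<Longrightarrow> norm (f x) \<le> B"
  shows "Lp_norm p S f \<le> measure lebesgue S powr (1/p) * B"
proof -
  have fin: "S \<in> lmeasurable" using S by (simp add: lmeasurable_open)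
  have "(LINT x:S|lebesgue. norm (f x) powr p) \<le> (LINT x|lebesgue. indicator S x * B powr p)"
    unfolding set_lebesgue_integral_def
  \<comment> \<open>This rule asks for integrability of the larger function alone; an integrand that
    is not integrable has integral 0, which also lies below the nonnegative right-hand side.\<close>
  proof (rule integral_mono')
    show "integrable lebesgue (\<lambda>x. indicator S x * B powr p)"
      using fin by (intro integrable_mult_left integrable_real_indicator) (auto simp: fmeasurable_def)
    show "indicator S x *\<^sub>R norm (f x) powr p \<le> indicator S x * B powr p" for x
      using B p by (auto simp: indicator_def intro!: powr_mono2)
  qed (use B in auto)
  also have "\<dots> = measure lebesgue S * B powr p"
    using fin by simp
  finally have le: "(LINT x:S|lebesgue. norm (f x) powr p) \<le> measure lebesgue S * B powr p" .
  have "0 \<le> (LINT x:S|lebesgue. norm (f x) powr p)"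
    unfolding set_lebesgue_integral_def by (intro integral_nonneg_AE) auto
  then have "Lp_norm p S f \<le> (measure lebesgue S * B powr p) powr (1/p)"
    unfolding Lp_norm_def using le p by (intro powr_mono2) auto
  also have "\<dots> = measure lebesgue S powr (1/p) * B"
    using B p by (simp add: powr_mult powr_powr)
  finally show ?thesis .
qed

theorem theorem1p1:
  fixes \<Omega> :: "(real^2) set" and p \<beta> \<alpha> :: real
  assumes "open \<Omega>" and "connected \<Omega>" and "\<Omega> \<noteq> {}"
    and "bounded \<Omega>" and "simply_connected \<Omega>" and "smooth_boundary \<Omega>"
    and "2 \<le> p" and "0 < \<beta>" and "\<beta> < 1"
    and "0 < \<alpha>" and "\<alpha> < min (1/7) (\<beta>/2)"
  shows "\<exists>C > 0. \<forall>(v :: real^2 \<Rightarrow> real) (w :: real^2 \<Rightarrow> real^2) (A :: real^2 \<Rightarrow> real^2^2).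
    Ck_closure 2 \<Omega> v \<and> Ck_closure 2 \<Omega> w \<and>
    Holder_closure 0 \<beta> \<Omega> A \<and> (\<forall>x\<in>closure \<Omega>. transpose (A x) = A x) \<longrightarrow>
    (\<exists>(v' :: real^2 \<Rightarrow> real) (w' :: real^2 \<Rightarrow> real^2).
       Holder_closure 1 \<alpha> \<Omega> v' \<and> Holder_closure 1 \<alpha> \<Omega> w' \<and>
       (\<forall>x\<in>\<Omega>. 2 *\<^sub>R sym_grad w' x + tensor (grad v' x) (grad v' x) = A x) \<and>
       C0_norm \<Omega> (\<lambda>x. grad v' x - grad v x) \<le> C * sqrt (C0_norm \<Omega> (deficit v w A)) \<and>
       Lp_norm p \<Omega> (\<lambda>x. jacobian w' (at x) - jacobian w (at x)) \<le>
         C * (C0_norm \<Omega> (grad v) * sqrt (C0_norm \<Omega> (deficit v w A))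
              + C0_norm \<Omega> (deficit v w A)))"
proof -
  note \<Omega> = assms(1) assms(4) assms(6)
  have \<alpha>: "0 < \<alpha>" "\<alpha> < 1/7" "\<alpha> < \<beta>/2" "\<alpha> \<le> 1" using assms(9-11) by auto
  obtain Cg where Cg: "Cg > 0" and flex: "\<forall>h>0. \<forall>v0 (H :: 2 \<Rightarrow> 2 \<Rightarrow> real^2 \<Rightarrow> real). sm 3 v0 \<longrightarrow> (\<exists>M L. \<forall>x. cb 3 M L v0 x) \<longrightarrow>
    (\<forall>i j. H i j = H j i) \<longrightarrow> (\<forall>i j x. \<bar>H i j x\<bar> \<le> h) \<longrightarrow>
    (\<exists>S. \<forall>i j x y. \<bar>H i j x - H i j y\<bar> \<le> S * norm (x - y) powr \<beta>) \<longrightarrow>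
    (\<exists>v' W. flexible Cg h \<alpha> v0 H v' W)"
    using global_flexibility[OF \<alpha>(1-3) assms(9)] by (elim exE conjE)
  define \<mu> where "\<mu> = measure lebesgue \<Omega> powr (1/p)"
  have \<mu>: "0 \<le> \<mu>" by (simp add: \<mu>_def)
  \<comment> \<open>First part: 2 from \<open>norm_vec2_le\<close>, 2 Cg from sqrt (2 D) \<le> 2
    sqrt D, and 1 from replacing v by v0. Second part: 4 from \<open>norm_matrix_le\<close> times 4
    Cg from the entries of the Jacobian.\<close>
  define C where "C = 2 * (2 * Cg + 1) + 16 * Cg * \<mu>"
  have C: "0 < C" "2 * (2 * Cg + 1) \<le> C" "16 * Cg * \<mu> \<le> C" using Cg \<mu> by (auto simp: C_def add_pos_nonneg)
  obtain ca where ca: "0 \<le> ca" "\<And>x y. x \<in> \<Omega> \<Longrightarrow> y \<in> \<Omega> \<Longrightarrow> norm (x - y) \<le> ca * norm (x - y) powr \<alpha>"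
    using lipschitz_holder[OF assms(4) \<alpha>(1,4)] by blast
  obtain ch where ch: "0 \<le> ch" "\<And>x y. x \<in> \<Omega> \<Longrightarrow> y \<in> \<Omega> \<Longrightarrow> norm (x - y) \<le> ch * norm (x - y) powr \<beta>"
    using lipschitz_holder[OF assms(4,8)] assms(9) by auto
  have main: "\<exists>(v' :: real^2 \<Rightarrow> real) (w' :: real^2 \<Rightarrow> real^2).
       Holder_closure 1 \<alpha> \<Omega> v' \<and> Holder_closure 1 \<alpha> \<Omega> w' \<and>
       (\<forall>x\<in>\<Omega>. 2 *\<^sub>R sym_grad w' x + tensor (grad v' x) (grad v' x) = A x) \<and>
       C0_norm \<Omega> (\<lambda>x. grad v' x - grad v x) \<le> C * sqrt (C0_norm \<Omega> (deficit v w A)) \<and>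
       Lp_norm p \<Omega> (\<lambda>x. jacobian w' (at x) - jacobian w (at x)) \<le>
         C * (C0_norm \<Omega> (grad v) * sqrt (C0_norm \<Omega> (deficit v w A))
              + C0_norm \<Omega> (deficit v w A))"
    if v: "Ck_closure 2 \<Omega> v" and w: "Ck_closure 2 \<Omega> w" and A: "Holder_closure 0 \<beta> \<Omega> A"
      and symA: "\<forall>x\<in>closure \<Omega>. transpose (A x) = A x"
    for v :: "real^2 \<Rightarrow> real" and w :: "real^2 \<Rightarrow> real^2" and A :: "real^2 \<Rightarrow> real^2^2"
  proof -
    obtain K where K: "0 \<le> K" and dv: "\<And>x. x \<in> \<Omega> \<Longrightarrow> v differentiable (at x)"
      and vK: "\<And>x. x \<in> \<Omega> \<Longrightarrow> \<bar>v x\<bar> \<le> K" "\<And>i x. x \<in> \<Omega> \<Longrightarrow> \<bar>partial i v x\<bar> \<le> K"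
      "\<And>i x y. x \<in> \<Omega> \<Longrightarrow> y \<in> \<Omega> \<Longrightarrow> \<bar>partial i v y - partial i v x\<bar> \<le> K * norm (y - x)"
      "\<And>x y. x \<in> \<Omega> \<Longrightarrow> y \<in> \<Omega> \<Longrightarrow> \<bar>v y - v x - (\<Sum>i\<in>UNIV. (y - x) $ i *\<^sub>R partial i v x)\<bar> \<le> K * (norm (y - x))\<^sup>2"
      using C2_estimates[OF \<Omega> v] unfolding real_norm_def by blast
    obtain Kw where Kw: "0 \<le> Kw" and dw: "\<And>x. x \<in> \<Omega> \<Longrightarrow> w differentiable (at x)"
      and wK: "\<And>i x. x \<in> \<Omega> \<Longrightarrow> norm (partial i w x) \<le> Kw"
      "\<And>i x y. x \<in> \<Omega> \<Longrightarrow> y \<in> \<Omega> \<Longrightarrow> norm (partial i w y - partial i w x) \<le> Kw * norm (y - x)"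
      using C2_estimates[OF \<Omega> w] by blast
    obtain KA where KA: "\<And>x y. x \<in> \<Omega> \<Longrightarrow> y \<in> \<Omega> \<Longrightarrow> norm (A x - A y) \<le> KA * norm (x - y) powr \<beta>"
      using A closure_subset[of \<Omega>] by (simp add: subset_iff) blast
    obtain BA where BA: "\<And>x. x \<in> \<Omega> \<Longrightarrow> norm (A x) \<le> BA"
      using A closure_subset[of \<Omega>] unfolding Holder_closure.simps bounded_iff by (metis imageI subsetD)
    have cont: "continuous_on (closure \<Omega>) v" "continuous_on (closure \<Omega>) w"
      using v w by (auto simp: numeral_2_eq_2)
    define D where "D = C0_norm \<Omega> (deficit v w A)"
    have Aij: "\<bar>A x $ i $ j\<bar> \<le> BA" if "x \<in> \<Omega>" for x i j
      using matrix_nth_le_norm[of "A x" i j] BA[OF that] by linarith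
    have wij: "\<bar>partial j w x $ i\<bar> \<le> Kw" if "x \<in> \<Omega>" for x i j
      using component_le_norm_cart[of "partial j w x" i] wK(1)[OF that, of j] by linarith
    \<comment> \<open>An explicit bound, needed because the supremum of an unbounded function would
      be a junk value that dominates nothing.\<close>
    have defb: "norm (deficit v w A x) \<le> 4 * (K * K + 2 * Kw + BA)" if x: "x \<in> \<Omega>" for x
    proof (rule norm_matrix_le)
      fix i j
      have "\<bar>partial i v x * partial j v x\<bar> \<le> K * K" unfolding abs_mult using vK(2)[OF x] K by (intro mult_mono) auto
      then show "\<bar>deficit v w A x $ i $ j\<bar> \<le> K * K + 2 * Kw + BA"
        using Aij[OF x, of i j] wij[OF x, of j i] wij[OF x, of i j] unfolding deficit_nth by linarith
    qed
    have defD: "norm (deficit v w A x) \<le> D" if "x \<in> \<Omega>" for x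
      unfolding D_def by (rule C0_norm_upper[OF defb that])
    have gradK: "norm (grad v x) \<le> 2 * K" if "x \<in> \<Omega>" for x
      by (rule norm_vec2_le) (simp add: grad_def vK(2)[OF that])
    define N where "N = C0_norm \<Omega> (grad v)"
    have gradN: "norm (grad v x) \<le> N" if "x \<in> \<Omega>" for x
      unfolding N_def by (rule C0_norm_upper[OF gradK that])
    have pN: "\<bar>partial i v x\<bar> \<le> N" if "x \<in> \<Omega>" for i x
      using component_le_norm_cart[of "grad v x" i] gradN[OF that] by (simp add: grad_def)
    obtain x1 where x1: "x1 \<in> \<Omega>" using assms(3) by blast
    have D0: "0 \<le> D" and N0: "0 \<le> N" using defD[OF x1] gradN[OF x1] norm_ge_zero order_trans by blast+
    have v\<alpha>: "norm (partial i v x - partial i v y) \<le> K * ca * norm (x - y) powr \<alpha>" if "x \<in> \<Omega>" "y \<in> \<Omega>" for i x y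
      using order_trans[OF vK(3)[OF that(2,1)] mult_left_mono[OF ca(2)[OF that] K]] by (simp add: mult.assoc)
    have w\<alpha>: "norm (partial i w x - partial i w y) \<le> Kw * ca * norm (x - y) powr \<alpha>" if "x \<in> \<Omega>" "y \<in> \<Omega>" for i x y
      using order_trans[OF wK(2)[OF that(2,1)] mult_left_mono[OF ca(2)[OF that] Kw]] by (simp add: mult.assoc)
    show ?thesis
    \<comment> \<open>\<open>flex\<close> asks for a positive h. If D = 0, then v and w already
      solve the equation and have the required regularity.\<close>
    proof (cases "D = 0")
      case True
      have eq: "2 *\<^sub>R sym_grad w x + tensor (grad v x) (grad v x) = A x" if "x \<in> \<Omega>" for x
        using defD[OF that] True by (simp add: deficit_def algebra_simps)
      have z: "C0_norm \<Omega> (\<lambda>x. grad v x - grad v x) \<le> C * sqrt D"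
        by (rule C0_norm_least[OF assms(3)]) (simp add: True)
      have "Lp_norm p \<Omega> (\<lambda>x. jacobian w (at x) - jacobian w (at x)) \<le> measure lebesgue \<Omega> powr (1/p) * 0"
        using assms(7) by (intro Lp_norm_le \<Omega>) auto
      then have z2: "Lp_norm p \<Omega> (\<lambda>x. jacobian w (at x) - jacobian w (at x)) \<le> C * (N * sqrt D + D)"
        by (simp add: True)
      show ?thesis unfolding D_def[symmetric] N_def[symmetric]
        by (rule exI[of _ v], rule exI[of _ w], intro conjI ballI eq z z2)
          (rule Holder_closure_1I[OF \<alpha>(1) assms(4) cont(1) dv v\<alpha>] Holder_closure_1I[OF \<alpha>(1) assms(4) cont(2) dw w\<alpha>]; assumption)+
    next
      case False
      then have D: "0 < D" using D0 by simp
      \<comment> \<open>1 bounds the partial derivatives of v0 by K + 1, D / (2 K + 1) keeps the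
        entries of the new deficit below 2 D, and sqrt D fits the gradient estimate.\<close>
      define \<epsilon> where "\<epsilon> = min 1 (min (D / (2 * K + 1)) (sqrt D))"
      have \<epsilon>: "0 < \<epsilon>" "\<epsilon> \<le> 1" "\<epsilon> \<le> D / (2 * K + 1)" "\<epsilon> \<le> sqrt D" using D K by (auto simp: \<epsilon>_def)
      have "\<exists>v0. sm 3 v0 \<and> (\<exists>M L. \<forall>x. cb 3 M L v0 x) \<and> (\<forall>i. \<forall>x\<in>\<Omega>. \<bar>partial i v0 x - partial i v x\<bar> \<le> \<epsilon>)"
        by (rule C1_approximation[OF K _ _ _ _ \<epsilon>(1)]; rule vK; assumption)
      then obtain v0 where v01: "sm 3 v0" and bnd: "\<exists>M L. \<forall>x. cb 3 M L v0 x"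
        and v03: "\<forall>i. \<forall>x\<in>\<Omega>. \<bar>partial i v0 x - partial i v x\<bar> \<le> \<epsilon>"
        by blast
      obtain M L where v02: "\<And>x. cb 3 M L v0 x" using bnd by blast
      note v0 = v01 v02 v03[rule_format]
      \<comment> \<open>The field that v0 and w still lack. The first derivatives of w are merely
        part of a Hoelder field, so w can be kept as it is.\<close>
      define H0 where "H0 i j x = A x $ i $ j - partial i v0 x * partial j v0 x - (partial j w x $ i + partial i w x $ j)" for i j x
      have v0K: "\<bar>partial i v0 x\<bar> \<le> K + 1" if "x \<in> \<Omega>" for i x
        using v0(3)[OF that, of i] vK(2)[OF that, of i] \<epsilon>(2) by linarith
      have H0b: "\<bar>H0 i j x\<bar> \<le> 2 * D" if x: "x \<in> \<Omega>" for i j x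
      proof -
        have "H0 i j x = - deficit v w A x $ i $ j - (partial i v0 x * (partial j v0 x - partial j v x) + (partial i v0 x - partial i v x) * partial j v x)"
          unfolding H0_def deficit_nth by (simp add: algebra_simps)
        moreover have "\<bar>deficit v w A x $ i $ j\<bar> \<le> D"
          using matrix_nth_le_norm[of "deficit v w A x" i j] defD[OF x] by linarith
        moreover have "\<bar>partial i v0 x * (partial j v0 x - partial j v x)\<bar> \<le> (K + 1) * \<epsilon>"
          unfolding abs_mult using v0K[OF x] v0(3)[OF x] K by (intro mult_mono) auto
        moreover have "\<bar>(partial i v0 x - partial i v x) * partial j v x\<bar> \<le> \<epsilon> * K"
          unfolding abs_mult using v0(3)[OF x] vK(2)[OF x] \<epsilon> by (intro mult_mono) auto
        moreover have "(K + 1) * \<epsilon> + \<epsilon> * K \<le> D"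
          using \<epsilon>(3) K by (simp add: pos_le_divide_eq algebra_simps)
        ultimately show ?thesis by linarith
      qed
      define G where "G = 2 * (M * L * L)"
      have dv0: "\<bar>partial i v0 x\<bar> \<le> M * L" "\<bar>partial j (partial i v0) x\<bar> \<le> M * L * L" for i j x
        using cb_bound[OF cb_partial_numeral(1)[OF v0(2)]] cb_bound[OF cb_partial_numeral(2)[OF cb_partial_numeral(1)[OF v0(2)]]] by auto
      have G0: "0 \<le> G" using dv0(2)[of 1 1 0] by (simp add: G_def)
      have v0l: "\<bar>partial i v0 x - partial i v0 y\<bar> \<le> G * norm (x - y)" for i x y
        unfolding G_def using sm_diff[OF sm_partial_numeral(1)[OF v0(1)]] by (intro cb1_lipschitz dv0) auto
      define S where "S = max KA 0 + (2 * (K + 1) * G + 2 * Kw) * ch"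
      have S: "0 \<le> S" using K G0 Kw ch by (simp add: S_def)
      have H0h: "\<bar>H0 i j x - H0 i j y\<bar> \<le> S * norm (x - y) powr \<beta>" if x: "x \<in> \<Omega>" and y: "y \<in> \<Omega>" for i j x y
      proof -
        let ?r = "norm (x - y)"
        have "H0 i j x - H0 i j y = (A x - A y) $ i $ j
          - (partial i v0 x * (partial j v0 x - partial j v0 y) + (partial i v0 x - partial i v0 y) * partial j v0 y)
          - ((partial j w x - partial j w y) $ i + (partial i w x - partial i w y) $ j)"
          unfolding H0_def by (simp add: algebra_simps)
        moreover have "\<bar>(A x - A y) $ i $ j\<bar> \<le> max KA 0 * ?r powr \<beta>"
          by (rule order_trans[OF matrix_nth_le_norm order_trans[OF KA[OF x y] mult_right_mono]]) auto
        moreover have "\<bar>partial i v0 x * (partial j v0 x - partial j v0 y)\<bar> \<le> (K + 1) * (G * ?r)"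
          unfolding abs_mult using v0K[OF x] v0l K by (intro mult_mono) auto
        moreover have "\<bar>(partial i v0 x - partial i v0 y) * partial j v0 y\<bar> \<le> (G * ?r) * (K + 1)"
          unfolding abs_mult using v0K[OF y] v0l G0 by (intro mult_mono) auto
        moreover have "\<bar>(partial j w x - partial j w y) $ i\<bar> \<le> Kw * ?r" for i j
          by (rule order_trans[OF component_le_norm_cart wK(2)[OF y x]])
        ultimately have "\<bar>H0 i j x - H0 i j y\<bar> \<le> max KA 0 * ?r powr \<beta> + ((K + 1) * (G * ?r) + (G * ?r) * (K + 1)) + (Kw * ?r + Kw * ?r)"
          by (smt (verit))
        also have "\<dots> = max KA 0 * ?r powr \<beta> + (2 * (K + 1) * G + 2 * Kw) * ?r" by (simp add: algebra_simps)
        also have "\<dots> \<le> max KA 0 * ?r powr \<beta> + (2 * (K + 1) * G + 2 * Kw) * (ch * ?r powr \<beta>)"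
          using K G0 Kw by (intro add_left_mono mult_left_mono ch(2)[OF x y]) auto
        also have "\<dots> = S * ?r powr \<beta>" by (simp add: S_def algebra_simps)
        finally show ?thesis .
      qed
      have "\<exists>F. (\<forall>x\<in>\<Omega>. F x = H0 i j x) \<and> (\<forall>x. \<bar>F x\<bar> \<le> 2 * D) \<and> (\<forall>x y. \<bar>F x - F y\<bar> \<le> S * norm (x - y) powr \<beta>)" for i j
        using assms(9) by (intro holder_extension[OF assms(3,8) _ S H0h H0b]) auto
      then obtain F where F: "\<And>i j x. x \<in> \<Omega> \<Longrightarrow> F i j x = H0 i j x" "\<And>i j x. \<bar>F i j x\<bar> \<le> 2 * D"
        "\<And>i j x y. \<bar>F i j x - F i j y\<bar> \<le> S * norm (x - y) powr \<beta>" by metis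
      \<comment> \<open>The entries were extended one by one, so symmetry off the domain has to be
        restored; averaging preserves both bounds.\<close>
      define H where "H i j x = (F i j x + F j i x) / 2" for i j x
      have Hs: "H i j = H j i" for i j by (auto simp: H_def fun_eq_iff)
      have Hb: "\<bar>H i j x\<bar> \<le> 2 * D" for i j x using F(2)[of i j x] F(2)[of j i x] by (auto simp: H_def abs_le_iff)
      have Hh: "\<bar>H i j x - H i j y\<bar> \<le> S * norm (x - y) powr \<beta>" for i j x y
        using F(3)[of i j x y] F(3)[of j i x y] by (auto simp: H_def abs_le_iff field_simps)
      have HO: "H i j x = H0 i j x" if x: "x \<in> \<Omega>" for i j x
      proof -
        have "transpose (A x) = A x" using symA x closure_subset by blast
        then have "transpose (A x) $ i $ j = A x $ i $ j" by (rule arg_cong)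
        then have "A x $ i $ j = A x $ j $ i" by (simp add: transpose_def)
        then show ?thesis using F(1)[OF x] unfolding H_def H0_def by (simp add: mult.commute add.commute)
      qed
      have D2: "0 < 2 * D" using D by simp
      have hold: "\<exists>S. \<forall>i j x y. \<bar>H i j x - H i j y\<bar> \<le> S * norm (x - y) powr \<beta>" using Hh by blast
      have Hs': "\<forall>i j. H i j = H j i" and Hb': "\<forall>i j x. \<bar>H i j x\<bar> \<le> 2 * D" using Hs Hb by blast+
      from flex[THEN spec[of _ "2 * D"], THEN mp, OF D2, THEN spec[of _ v0], THEN spec[of _ H],
          THEN mp, OF v01, THEN mp, OF bnd, THEN mp, OF Hs', THEN mp, OF Hb', THEN mp, OF hold]
      obtain v' W where flex': "flexible Cg (2 * D) \<alpha> v0 H v' W"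
        by (elim exE)
      then obtain Qv Qw where Qv: "\<And>i x y. \<bar>(partial i v' x - partial i v0 x) - (partial i v' y - partial i v0 y)\<bar> \<le> Qv * norm (x - y) powr \<alpha>"
        and Qw: "\<And>i j x y. \<bar>partial j (W i) x - partial j (W i) y\<bar> \<le> Qw * norm (x - y) powr \<alpha>"
        unfolding flexible_def by blast
      have dv': "v' differentiable (at x)" and dW: "W i differentiable (at x)"
        and ide: "partial i v' x * partial j v' x + partial j (W i) x + partial i (W j) x
           = partial i v0 x * partial j v0 x + H i j x"
        and v'b: "\<bar>partial i v' x - partial i v0 x\<bar> \<le> Cg * sqrt (2 * D)"
        and Wb: "\<bar>partial j (W i) x\<bar> \<le> Cg * (sqrt (2 * D) * \<bar>partial i v0 x\<bar> + 2 * D)" for i j x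
        using flex' unfolding flexible_def by blast+
      define Wv :: "real^2 \<Rightarrow> real^2" where "Wv x = (\<Sum>i\<in>UNIV. W i x *\<^sub>R axis i 1)" for x
      define w' where "w' x = w x + Wv x" for x
      have DWv: "(Wv has_derivative (\<lambda>h. \<Sum>i\<in>UNIV. frechet_derivative (W i) (at x) h *\<^sub>R axis i 1)) (at x)" for x
        unfolding Wv_def[abs_def]
        by (intro has_derivative_sum has_derivative_scaleR_left dW[THEN frechet_derivative_works[THEN iffD1]])
      have dWv: "Wv differentiable (at x)" for x using DWv by (auto simp: differentiable_def)
      have pWv: "partial j Wv x $ i = partial j (W i) x" for i j x
        using exhaust_2[of i] by (subst partialI[OF DWv]) (auto simp: partial_def sum_2 axis_def)
      have pw': "partial j w' x = partial j w x + partial j Wv x" if "x \<in> \<Omega>" for j x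
        unfolding w'_def[abs_def] by (rule partial_add[OF dw[OF that] dWv])
      have s2: "sqrt (2 * D) \<le> 2 * sqrt D" using sqrt2_le D by (simp add: real_sqrt_mult mult_right_mono)
      have cW: "continuous_on (closure \<Omega>) Wv" "continuous_on (closure \<Omega>) v'"
        using dWv dv' by (auto intro!: continuous_at_imp_continuous_on differentiable_imp_continuous_within)
      have hv': "Holder_closure 1 \<alpha> \<Omega> v'"
      proof (rule Holder_closure_1I[OF \<alpha>(1) assms(4) cW(2) dv'])
        show "norm (partial i v' x - partial i v' y) \<le> (Qv + G * ca) * norm (x - y) powr \<alpha>" if "x \<in> \<Omega>" "y \<in> \<Omega>" for i x y
        proof -
          have "\<bar>partial i v0 x - partial i v0 y\<bar> \<le> G * (ca * norm (x - y) powr \<alpha>)"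
            by (rule order_trans[OF v0l mult_left_mono[OF ca(2)[OF that] G0]])
          then show ?thesis using Qv[of i x y] by (simp add: distrib_right mult.assoc)
        qed
      qed
      have hw': "Holder_closure 1 \<alpha> \<Omega> w'"
      proof (rule Holder_closure_1I[OF \<alpha>(1) assms(4)])
        show "continuous_on (closure \<Omega>) w'" unfolding w'_def[abs_def] by (intro continuous_on_add cont cW)
        show "w' differentiable (at x)" if "x \<in> \<Omega>" for x
          unfolding w'_def[abs_def] by (intro differentiable_add dw[OF that] dWv)
        show "norm (partial i w' x - partial i w' y) \<le> (Kw * ca + 2 * Qw) * norm (x - y) powr \<alpha>" if "x \<in> \<Omega>" "y \<in> \<Omega>" for i x y
        proof -
          have "norm (partial i Wv x - partial i Wv y) \<le> 2 * (Qw * norm (x - y) powr \<alpha>)"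
            by (rule norm_vec2_le) (simp add: pWv Qw)
          moreover have "partial i w' x - partial i w' y = (partial i w x - partial i w y) + (partial i Wv x - partial i Wv y)"
            by (simp add: pw' that)
          ultimately show ?thesis
            using norm_triangle_ineq[of "partial i w x - partial i w y" "partial i Wv x - partial i Wv y"] w\<alpha>[OF that, of i]
            by (simp add: distrib_right)
        qed
      qed
      have eq: "2 *\<^sub>R sym_grad w' x + tensor (grad v' x) (grad v' x) = A x" if x: "x \<in> \<Omega>" for x
      proof -
        have "(2 *\<^sub>R sym_grad w' x + tensor (grad v' x) (grad v' x)) $ i $ j = A x $ i $ j" for i j
          using ide[of i x j] HO[OF x, of i j] sym_grad_nth[of w' x i j]
          by (simp add: tensor_def grad_def pw'[OF x] pWv H0_def)
        then show ?thesis by (simp add: vec_eq_iff)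
      qed
      have gv: "C0_norm \<Omega> (\<lambda>x. grad v' x - grad v x) \<le> C * sqrt D"
      proof (rule C0_norm_least[OF assms(3)])
        fix x assume x: "x \<in> \<Omega>"
        have "norm (grad v' x - grad v x) \<le> 2 * ((2 * Cg + 1) * sqrt D)"
        proof (rule norm_vec2_le)
          fix i
          have "Cg * sqrt (2 * D) \<le> Cg * (2 * sqrt D)" using s2 Cg by (intro mult_left_mono) auto
          then show "\<bar>(grad v' x - grad v x) $ i\<bar> \<le> (2 * Cg + 1) * sqrt D"
            using v'b[of i x] v0(3)[OF x, of i] \<epsilon>(4) by (simp add: grad_def distrib_right)
        qed
        also have "\<dots> = (2 * (2 * Cg + 1)) * sqrt D" by simp
        also have "\<dots> \<le> C * sqrt D" using C D0 by (intro mult_right_mono) auto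
        finally show "norm (grad v' x - grad v x) \<le> C * sqrt D" .
      qed
      have jac: "norm (jacobian w' (at x) - jacobian w (at x)) \<le> 16 * Cg * (N * sqrt D + D)" if x: "x \<in> \<Omega>" for x
      proof -
        have "\<bar>(jacobian w' (at x) - jacobian w (at x)) $ i $ j\<bar> \<le> 4 * Cg * (N * sqrt D + D)" for i j
        proof -
          have "\<bar>partial i v0 x\<bar> \<le> N + sqrt D" using v0(3)[OF x, of i] pN[OF x, of i] \<epsilon>(4) by linarith
          then have "sqrt (2 * D) * \<bar>partial i v0 x\<bar> \<le> (2 * sqrt D) * (N + sqrt D)"
            using s2 D0 by (intro mult_mono) auto
          also have "\<dots> = 2 * (N * sqrt D) + 2 * D" using D0 by (simp add: algebra_simps)
          finally have "sqrt (2 * D) * \<bar>partial i v0 x\<bar> + 2 * D \<le> (2 * (N * sqrt D) + 2 * D) + 2 * D"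
            by (rule add_right_mono)
          also have "\<dots> \<le> 4 * (N * sqrt D + D)"
            using mult_nonneg_nonneg[OF N0 real_sqrt_ge_zero[OF D0]] by (simp add: distrib_left)
          finally have "sqrt (2 * D) * \<bar>partial i v0 x\<bar> + 2 * D \<le> 4 * (N * sqrt D + D)" .
          from mult_left_mono[OF this less_imp_le[OF Cg]]
          have "\<bar>partial j (W i) x\<bar> \<le> Cg * (4 * (N * sqrt D + D))" by (rule order_trans[OF Wb])
          also have "\<dots> = 4 * Cg * (N * sqrt D + D)" by simp
          finally show ?thesis unfolding vector_minus_component jacobian_nth pw'[OF x] vector_add_component pWv
            by simp
        qed
        then have "norm (jacobian w' (at x) - jacobian w (at x)) \<le> 4 * (4 * Cg * (N * sqrt D + D))" by (rule norm_matrix_le)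
        then show ?thesis by simp
      qed
      have ND: "0 \<le> N * sqrt D + D" using N0 D0 by simp
      have "Lp_norm p \<Omega> (\<lambda>x. jacobian w' (at x) - jacobian w (at x)) \<le> \<mu> * (16 * Cg * (N * sqrt D + D))"
        unfolding \<mu>_def using assms(7) Cg ND jac by (intro Lp_norm_le \<Omega>) auto
      also have "\<dots> = (16 * Cg * \<mu>) * (N * sqrt D + D)" by simp
      also have "\<dots> \<le> C * (N * sqrt D + D)" by (rule mult_right_mono[OF C(3) ND])
      finally have Lp: "Lp_norm p \<Omega> (\<lambda>x. jacobian w' (at x) - jacobian w (at x)) \<le> C * (N * sqrt D + D)" .
      show ?thesis unfolding D_def[symmetric] N_def[symmetric]
        by (rule exI[of _ v'], rule exI[of _ w'], intro conjI ballI hv' hw' eq gv Lp)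
    qed
  qed
  show ?thesis
    by (rule exI[of _ C], rule conjI[OF C(1)], intro allI impI, elim conjE, rule main)
qed

end
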